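(* Let $(\mathcal M,\tau)$ be a finite von Neumann algebra satisfying the weak Dixmier property. If $|\!|\!|\cdot|\!|\!|$ is a normalized tracial gauge norm on $\mathcal M$, then there is a subset $\mathcal F'$ of $\mathcal F$ containing the constant $1$ function on $[0,1]$ such that for every $T\in\mathcal M$, $$|\!|\!|T|\!|\!|=\sup\{|\!|\!|T|\!|\!|_f:\ f\in\mathcal F'\},\qquad\text{where } |\!|\!|T|\!|\!|_f=\int_0^1 f(s)\mu_s(T)\,ds.$$
   Context: A finite von Neumann algebra $(\mathcal M,\tau)$ means a von Neumann algebra $\mathcal M$ with a faithful normal tracial state $\tau$; $\|\cdot\|$ is the operator norm. For $T\in\mathcal M$ and $0\le s\le 1$, the generalized $s$-numbers are $\mu_s(T)=\inf\{\|TE\|: E\in\mathcal M \text{ a projection with } \tau(1-E)\le s\}$. Positive operators $S,T\in\mathcal M$ are equi-measurable if $\tau(S^n)=\tau(T^n)$ for all $n=0,1,2,\dots$ (equivalently $\mu_s(S)=\mu_s(T)$ for all $s$). $(\mathcal M,\tau)$ satisfies the weak Dixmier property if for every positive $T\in\mathcal M$, $\tau(T)1$ is in the operator norm closure of the convex hull of the set of (positive) $S\in\mathcal M$ that are equi-measurable with $T$. A tracial gauge norm on $(\mathcal M,\tau)$ is a norm $|\!|\!|\cdot|\!|\!|$ on $\mathcal M$ with $|\!|\!|T|\!|\!|=|\!|\!|\,|T|\,|\!|\!|$ for all $T\in\mathcal M$, where $|T|=(T^*T)^{1/2}$ (gauge invariant), and $|\!|\!|S|\!|\!|=|\!|\!|T|\!|\!|$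 whenever $S,T$ are equi-measurable positive operators in $\mathcal M$ (tracial). It is normalized if $|\!|\!|1|\!|\!|=1$. $\mathcal F$ is the set of all functions on $[0,1]$ of the form $f(x)=a_1\chi_{[0,\frac1n)}(x)+a_2\chi_{[\frac1n,\frac2n)}(x)+\cdots+a_n\chi_{[\frac{n-1}n,1]}(x)$ with $n\in\{1,2,\dots\}$, $a_1\ge a_2\ge\cdots\ge a_n\ge 0$ and $\frac{a_1+\cdots+a_n}{n}\le 1$. *)

theory Defs
  imports "HOL-Analysis.Analysis"
begin

text \<open>The inner product is linear in its first argument and conjugate-linear in the second.
  Positive definiteness is part of \<open>cinner_self\<close>, completeness of \<^class>\<open>banach\<close>.\<close>

class chilbert_space = banach +
  fixes scaleC :: "complex \<Rightarrow> 'a \<Rightarrow> 'a"  (infixr \<open>*\<^sub>C\<close> 75)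
    and cinner :: "'a \<Rightarrow> 'a \<Rightarrow> complex"
  assumes scaleC_add_right: "c *\<^sub>C (x + y) = c *\<^sub>C x + c *\<^sub>C y"
    and scaleC_add_left: "(c + d) *\<^sub>C x = c *\<^sub>C x + d *\<^sub>C x"
    and scaleC_scaleC: "c *\<^sub>C (d *\<^sub>C x) = (c * d) *\<^sub>C x"
    and scaleR_scaleC: "r *\<^sub>R x = complex_of_real r *\<^sub>C x"
    and cinner_commute: "cinner x y = cnj (cinner y x)"
    and cinner_add_left: "cinner (x + y) z = cinner x z + cinner y z"
    and cinner_scaleC_left: "cinner (c *\<^sub>C x) y = c * cinner x y"
    and cinner_self: "cinner x x = complex_of_real ((norm x)\<^sup>2)"

lemma norm_scaleC: "norm (c *\<^sub>C (x :: 'h::chilbert_space)) = cmod c * norm x"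
proof -
  have right: "cinner x (c *\<^sub>C x) = cnj c * cinner x x"
    by (metis cinner_commute cinner_scaleC_left complex_cnj_mult)
  have "complex_of_real ((norm (c *\<^sub>C x))\<^sup>2) = cinner (c *\<^sub>C x) (c *\<^sub>C x)"
    by (simp only: cinner_self)
  also have "\<dots> = (c * cnj c) * cinner x x"
    by (simp add: cinner_scaleC_left right mult.assoc)
  also have "\<dots> = complex_of_real ((cmod c * norm x)\<^sup>2)"
    by (simp add: cinner_self complex_norm_square [symmetric] power_mult_distrib)
  finally have "(norm (c *\<^sub>C x))\<^sup>2 = (cmod c * norm x)\<^sup>2"
    by (simp only: of_real_eq_iff)
  then show ?thesis
    by (simp add: power2_eq_iff_nonneg)
qed

lemma bounded_linear_scaleC: "bounded_linear (\<lambda>x :: 'h::chilbert_space. c *\<^sub>C x)"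
  by (rule bounded_linear_intro [where K = "cmod c"])
    (simp_all add: scaleC_add_right scaleR_scaleC scaleC_scaleC norm_scaleC mult.commute)

text \<open>\<open>'h \<Rightarrow>\<^sub>L 'h\<close> consists of the bounded real-linear maps; \<open>B(H)\<close> is the subset of
  complex-linear ones. Both carry the same operator norm.\<close>

type_synonym 'h op = "'h \<Rightarrow>\<^sub>L 'h"

definition bounded_ops :: "'h::chilbert_space op set" where
  "bounded_ops = {T :: 'h op. \<forall>c x. T (c *\<^sub>C x) = c *\<^sub>C T x}"

lift_definition scaleC_op :: "complex \<Rightarrow> 'h::chilbert_space op \<Rightarrow> 'h op"
  is "\<lambda>c T x. c *\<^sub>C T x"
  by (rule bounded_linear_compose [OF bounded_linear_scaleC])

text \<open>On \<open>bounded_ops\<close> the adjoint exists by the Riesz representation theorem; it is unique since \<open>cinner\<close> is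
  non-degenerate, and it is automatically complex-linear.\<close>

definition adj :: "'h::chilbert_space op \<Rightarrow> 'h op" where
  "adj T = (THE S :: 'h op. \<forall>x y. cinner (T x) y = cinner x (S y))"

definition op_power :: "'h::chilbert_space op \<Rightarrow> nat \<Rightarrow> 'h op" where
  "op_power T n = ((\<lambda>S. T o\<^sub>L S) ^^ n) id_blinfun"

definition positive_op :: "'h::chilbert_space op \<Rightarrow> bool" where
  "positive_op T \<longleftrightarrow> T \<in> bounded_ops \<and> (\<forall>x. cinner (T x) x \<in> \<real>\<^sub>\<ge>\<^sub>0)"

definition self_adjoint_op :: "'h::chilbert_space op \<Rightarrow> bool" where
  "self_adjoint_op T \<longleftrightarrow> T \<in> bounded_ops \<and> adj T = T"

definition projection_op :: "'h::chilbert_space op \<Rightarrow> bool" where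
  "projection_op E \<longleftrightarrow> self_adjoint_op E \<and> E o\<^sub>L E = E"

definition loewner_le :: "'h::chilbert_space op \<Rightarrow> 'h op \<Rightarrow> bool"  (infix \<open>\<le>\<^sub>o\<close> 50) where
  "S \<le>\<^sub>o T \<longleftrightarrow> positive_op (T - S)"

definition modulus_op :: "'h::chilbert_space op \<Rightarrow> 'h op" where
  "modulus_op T = (THE S. positive_op S \<and> S o\<^sub>L S = adj T o\<^sub>L T)"

text \<open>A unital *-subalgebra of \<open>B(H)\<close> is convex, so it is closed in the strong operator topology
  iff it is closed in the weak one.\<close>

definition von_neumann_algebra :: "'h::chilbert_space op set \<Rightarrow> bool" where
  "von_neumann_algebra M \<longleftrightarrow>
     M \<subseteq> bounded_ops \<and> id_blinfun \<in> M \<and>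
     (\<forall>S\<in>M. \<forall>T\<in>M. S + T \<in> M \<and> S o\<^sub>L T \<in> M) \<and>
     (\<forall>T\<in>M. (\<forall>c. scaleC_op c T \<in> M) \<and> adj T \<in> M) \<and>
     closedin strong_operator_topology M"

definition state_on :: "'h::chilbert_space op set \<Rightarrow> ('h op \<Rightarrow> complex) \<Rightarrow> bool" where
  "state_on M \<tau> \<longleftrightarrow>
     (\<forall>S\<in>M. \<forall>T\<in>M. \<tau> (S + T) = \<tau> S + \<tau> T) \<and>
     (\<forall>c. \<forall>T\<in>M. \<tau> (scaleC_op c T) = c * \<tau> T) \<and>
     (\<forall>T\<in>M. positive_op T \<longrightarrow> \<tau> T \<in> \<real>\<^sub>\<ge>\<^sub>0) \<and>
     \<tau> id_blinfun = 1"

definition tracial_on :: "'h::chilbert_space op set \<Rightarrow> ('h op \<Rightarrow> complex) \<Rightarrow> bool" where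
  "tracial_on M \<tau> \<longleftrightarrow> (\<forall>S\<in>M. \<forall>T\<in>M. \<tau> (S o\<^sub>L T) = \<tau> (T o\<^sub>L S))"

definition faithful_on :: "'h::chilbert_space op set \<Rightarrow> ('h op \<Rightarrow> complex) \<Rightarrow> bool" where
  "faithful_on M \<tau> \<longleftrightarrow> (\<forall>T\<in>M. \<tau> (adj T o\<^sub>L T) = 0 \<longrightarrow> T = 0)"

definition directed_sa :: "'h::chilbert_space op set \<Rightarrow> 'h op set \<Rightarrow> bool" where
  "directed_sa M D \<longleftrightarrow> D \<noteq> {} \<and> D \<subseteq> {T \<in> M. self_adjoint_op T} \<and>
     (\<forall>A\<in>D. \<forall>B\<in>D. \<exists>C\<in>D. A \<le>\<^sub>o C \<and> B \<le>\<^sub>o C)"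

definition lub_sa :: "'h::chilbert_space op set \<Rightarrow> 'h op set \<Rightarrow> 'h op \<Rightarrow> bool" where
  "lub_sa M D S \<longleftrightarrow> S \<in> M \<and> self_adjoint_op S \<and> (\<forall>A\<in>D. A \<le>\<^sub>o S) \<and>
     (\<forall>U\<in>M. self_adjoint_op U \<longrightarrow> (\<forall>A\<in>D. A \<le>\<^sub>o U) \<longrightarrow> S \<le>\<^sub>o U)"

text \<open>Normality of a positive functional: it preserves suprema of bounded increasing nets of
  self-adjoint elements. The real supremum below is over a nonempty set bounded by \<open>Re (\<tau> S)\<close>
  whenever \<open>\<tau>\<close> is positive.\<close>

definition normal_on :: "'h::chilbert_space op set \<Rightarrow> ('h op \<Rightarrow> complex) \<Rightarrow> bool" where
  "normal_on M \<tau> \<longleftrightarrow>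
     (\<forall>D S. directed_sa M D \<and> lub_sa M D S \<longrightarrow> Re (\<tau> S) = (SUP A\<in>D. Re (\<tau> A)))"

definition finite_von_neumann_algebra ::
  "'h::chilbert_space op set \<Rightarrow> ('h op \<Rightarrow> complex) \<Rightarrow> bool" where
  "finite_von_neumann_algebra M \<tau> \<longleftrightarrow>
     von_neumann_algebra M \<and> state_on M \<tau> \<and> tracial_on M \<tau> \<and> faithful_on M \<tau> \<and> normal_on M \<tau>"

definition s_number ::
  "'h::chilbert_space op set \<Rightarrow> ('h op \<Rightarrow> complex) \<Rightarrow> real \<Rightarrow> 'h op \<Rightarrow> real" where
  "s_number M \<tau> s T =
     Inf {norm (T o\<^sub>L E) | E. E \<in> M \<and> projection_op E \<and> Re (\<tau> (id_blinfun - E)) \<le> s}"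

definition equi_measurable ::
  "('h::chilbert_space op \<Rightarrow> complex) \<Rightarrow> 'h op \<Rightarrow> 'h op \<Rightarrow> bool" where
  "equi_measurable \<tau> S T \<longleftrightarrow> (\<forall>n. \<tau> (op_power S n) = \<tau> (op_power T n))"

definition weak_dixmier ::
  "'h::chilbert_space op set \<Rightarrow> ('h op \<Rightarrow> complex) \<Rightarrow> bool" where
  "weak_dixmier M \<tau> \<longleftrightarrow>
     (\<forall>T\<in>M. positive_op T \<longrightarrow>
        scaleC_op (\<tau> T) id_blinfun
          \<in> closure (convex hull {S \<in> M. positive_op S \<and> equi_measurable \<tau> S T}))"

definition norm_on :: "'h::chilbert_space op set \<Rightarrow> ('h op \<Rightarrow> real) \<Rightarrow> bool" where
  "norm_on M N \<longleftrightarrow>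
     (\<forall>T\<in>M. 0 \<le> N T \<and> (N T = 0 \<longleftrightarrow> T = 0)) \<and>
     (\<forall>c. \<forall>T\<in>M. N (scaleC_op c T) = cmod c * N T) \<and>
     (\<forall>S\<in>M. \<forall>T\<in>M. N (S + T) \<le> N S + N T)"

definition tracial_gauge_norm ::
  "'h::chilbert_space op set \<Rightarrow> ('h op \<Rightarrow> complex) \<Rightarrow> ('h op \<Rightarrow> real) \<Rightarrow> bool" where
  "tracial_gauge_norm M \<tau> N \<longleftrightarrow>
     norm_on M N \<and>
     (\<forall>T\<in>M. N T = N (modulus_op T)) \<and>
     (\<forall>S\<in>M. \<forall>T\<in>M. positive_op S \<and> positive_op T \<and> equi_measurable \<tau> S T \<longrightarrow> N S = N T)"

definition normalized :: "('h::chilbert_space op \<Rightarrow> real) \<Rightarrow> bool" where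
  "normalized N \<longleftrightarrow> N id_blinfun = 1"

text \<open>Functions on \<open>[0,1]\<close> are represented by their extensions by \<open>0\<close> to the real line; the
  last interval of the partition is closed.\<close>

definition step_fun :: "nat \<Rightarrow> (nat \<Rightarrow> real) \<Rightarrow> real \<Rightarrow> real" where
  "step_fun n a x =
     (\<Sum>i=1..n. a i * indicat_real
        (if i = n then {real (i - 1) / real n..1}
         else {real (i - 1) / real n..<real i / real n}) x)"

definition step_weights :: "(real \<Rightarrow> real) set" where
  "step_weights = {step_fun n a | n a.
     1 \<le> n \<and> (\<forall>i\<in>{1..n}. \<forall>j\<in>{1..n}. i \<le> j \<longrightarrow> a j \<le> a i) \<and> 0 \<le> a n \<and>
     (\<Sum>i=1..n. a i) / real n \<le> 1}"

definition weighted_norm ::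
  "'h::chilbert_space op set \<Rightarrow> ('h op \<Rightarrow> complex) \<Rightarrow> (real \<Rightarrow> real) \<Rightarrow> 'h op \<Rightarrow> real" where
  "weighted_norm M \<tau> f T = (LBINT s:{0..1}. f s * s_number M \<tau> s T)"

end

theory Submission
  imports Defs
begin

text \<open>
  The set of weights is the largest possible one: all step functions \<open>f\<close> in \<open>\<F>\<close> whose norm
  \<open>\<parallel>\<cdot>\<parallel>\<^sub>f\<close> is dominated by the given norm \<open>N\<close> on all of \<open>M\<close>. It must be shown that this set contains the
  constant function \<open>1\<close> and that it nearly attains \<open>N T\<close> for every \<open>T\<close>.

  Both are reduced to finite dimensions. A partition of the identity into \<open>K\<close> projections of trace \<open>1 / K\<close>
  turns \<open>N\<close> into a norm \<open>nrm K\<close> on \<open>\<real>\<^sup>K\<close>. It is invariant under permutations (\<open>nrm_perm\<close>) because permuting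
  the coefficients of a simple operator gives an equi-measurable one, and monotone (\<open>nrm_mono\<close>) because
  lowering a coefficient is averaging over unitaries. Averaging over rotations inside blocks shows that
  replacing a vector by its block means does not increase the norm (\<open>nrm_block_average\<close>).

  The weak Dixmier property is used for a dichotomy (\<open>divisibility_dichotomy\<close>). If \<open>E\<close> is a minimal
  projection and \<open>P\<close> a nonzero projection with \<open>\<tau> P < \<tau> E\<close>, every projection \<open>S\<close> equi-measurable with \<open>P\<close> satisfies
  \<open>E S E = 0\<close>, so \<open>\<tau> P \<cdot> 1\<close> cannot be approximated by means of such \<open>S\<close>. Hence either there are no minimal
  projections, and projections of every trace exist, or all minimal projections have the same trace
  \<open>1 / n\<close> and every projection is a sum of them. In both cases a positive operator can be sandwiched
  (\<open>sandwich\<close>): there are a partition of a suitable size \<open>K\<close> and vectors \<open>l \<le> u\<close> with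
  \<open>nrm K l \<le> N T \<le> nrm K u\<close> and \<open>l \<le> \<mu>(T) \<le> u\<close> on the cells of \<open>[0, 1]\<close>, up to a small error, and such that no
  weight of total mass \<open>1\<close> sees more than that error of the difference between \<open>l\<close> and \<open>u\<close>. The identification of \<open>\<mu>\<close> on simple
  operators rests on the comparison lemma \<open>tr_le_of_norm_less\<close>.

  Given \<open>T\<close>, let \<open>\<phi>\<close> be a functional on \<open>\<real>\<^sup>K\<close> that supports \<open>nrm K\<close> at \<open>u\<close>, made strictly decreasing
  by a small perturbation. By symmetry and monotonicity \<open>\<phi>\<close> is automatically decreasing and nonnegative
  (\<open>decreasing_support\<close>), so it defines a weight \<open>f\<close>, and \<open>\<parallel>T\<parallel>\<^sub>f\<close> is nearly \<open>nrm K u\<close>, which is at least \<open>N T\<close> up to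
  the error (\<open>nearly_attained\<close>). For any other \<open>S\<close> in \<open>M\<close>, the integral \<open>\<parallel>S\<parallel>\<^sub>f\<close> pairs \<open>\<phi>\<close> with the block means of
  a finer lower vector of \<open>S\<close>, whence \<open>\<parallel>S\<parallel>\<^sub>f \<le> N S\<close> (\<open>weighted_norm_le\<close>). The case \<open>K = 1\<close> is the constant
  function \<open>1\<close>.
\<close>


section \<open>The real inner product and adjoints\<close>

text \<open>The real part of the inner product is a real inner product with the same norm; it carries the
  estimates.\<close>

definition rip :: "'h::chilbert_space \<Rightarrow> 'h \<Rightarrow> real" where
  "rip x y = Re (cinner x y)"

lemma rip_commute: "rip x y = rip y x"
  unfolding rip_def by (subst cinner_commute) simp

lemma rip_add_left: "rip (x + y) z = rip x z + rip y z"
  by (simp add: rip_def cinner_add_left)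

lemma rip_scaleR_left: "rip (r *\<^sub>R x) y = r * rip x y"
  by (simp add: rip_def scaleR_scaleC cinner_scaleC_left)

lemma rip_add_right: "rip z (x + y) = rip z x + rip z y"
  by (metis rip_add_left rip_commute)

lemma rip_scaleR_right: "rip y (r *\<^sub>R x) = r * rip y x"
  by (metis rip_scaleR_left rip_commute)

lemma rip_minus_left: "rip (- x) y = - rip x y"
  using rip_scaleR_left [of "-1" x y] by simp

lemma rip_minus_right: "rip y (- x) = - rip y x"
  using rip_scaleR_right [of y "-1" x] by simp

lemma rip_diff_left: "rip (x - y) z = rip x z - rip y z"
  using rip_add_left [of x "- y" z] by (simp add: rip_minus_left)

lemma rip_diff_right: "rip z (x - y) = rip z x - rip z y"
  by (metis rip_diff_left rip_commute)

lemma rip_zero_left: "rip 0 y = 0"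
  using rip_scaleR_left [of 0 0 y] by simp

lemma rip_zero_right: "rip y 0 = 0"
  by (metis rip_zero_left rip_commute)

lemma rip_sum_left: "rip (sum f A) y = (\<Sum>i\<in>A. rip (f i) y)"
  by (induction A rule: infinite_finite_induct) (auto simp: rip_zero_left rip_add_left)

lemma rip_sum_right: "rip y (sum f A) = (\<Sum>i\<in>A. rip y (f i))"
  by (induction A rule: infinite_finite_induct) (auto simp: rip_zero_right rip_add_right)

lemma rip_self: "rip x x = (norm x)\<^sup>2"
  by (simp add: rip_def cinner_self)

lemmas rip_simps = rip_add_left rip_add_right rip_diff_left rip_diff_right rip_minus_left
  rip_minus_right rip_scaleR_left rip_scaleR_right rip_zero_left rip_zero_right

lemma rip_scaleC: "rip x (c *\<^sub>C y) = rip (cnj c *\<^sub>C x) y"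
  unfolding rip_def
  by (metis cinner_commute cinner_scaleC_left complex_cnj_cnj complex_cnj_mult)

lemma Im_cinner: "Im (cinner x y) = rip x (\<i> *\<^sub>C y)"
  unfolding rip_scaleC by (simp add: rip_def cinner_scaleC_left)

lemma norm_add_sq: "(norm (x + y))\<^sup>2 = (norm x)\<^sup>2 + 2 * rip x y + (norm (y::'h::chilbert_space))\<^sup>2"
  unfolding rip_self [symmetric] by (simp add: rip_simps rip_commute)

lemma norm_diff_sq: "(norm (x - y))\<^sup>2 = (norm x)\<^sup>2 - 2 * rip x y + (norm (y::'h::chilbert_space))\<^sup>2"
  unfolding rip_self [symmetric] by (simp add: rip_simps rip_commute)

lemma rip_le: "rip x y \<le> norm x * norm y"
proof -
  have "(norm (x + y))\<^sup>2 \<le> (norm x + norm y)\<^sup>2"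
    by (simp add: norm_triangle_ineq power_mono)
  then show ?thesis
    unfolding norm_add_sq by (simp add: power2_sum)
qed

lemma abs_rip_le: "\<bar>rip x y\<bar> \<le> norm x * norm y"
  using rip_le [of x y] rip_le [of "- x" y] by (simp add: rip_minus_left)

lemma rip_eqI: "(\<And>x. rip x y = rip x z) \<Longrightarrow> y = z"
  using rip_self [of "y - z"] by (simp add: rip_diff_right)

lemma bounded_bilinear_rip: "bounded_bilinear rip"
proof
  show "\<exists>K. \<forall>a b :: 'a. norm (rip a b) \<le> norm a * norm b * K"
    by (rule exI [of _ 1]) (simp add: abs_rip_le)
qed (simp_all add: rip_simps)

lemmas tendsto_rip = bounded_bilinear.tendsto [OF bounded_bilinear_rip]

text \<open>Riesz representation: the representing vector is the minimiser of
  \<open>\<parallel>x\<parallel>\<^sup>2 - 2 l x\<close>, and the parallelogram law makes minimising sequences Cauchy.\<close>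

lemma riesz:
  fixes l :: "'h::chilbert_space \<Rightarrow> real"
  assumes "bounded_linear l"
  shows "\<exists>z. \<forall>x. l x = rip x z"
proof -
  interpret bounded_linear l by fact
  define J where "J x = (norm x)\<^sup>2 - 2 * l x" for x
  obtain C where C: "\<And>x. \<bar>l x\<bar> \<le> norm x * C"
    using bounded by auto
  have J_lower: "- C\<^sup>2 \<le> J x" for x
  proof -
    have "0 \<le> (norm x - C)\<^sup>2" by simp
    also have "\<dots> = (norm x)\<^sup>2 - 2 * (norm x * C) + C\<^sup>2"
      by (simp add: power2_diff)
    also have "\<dots> \<le> J x + C\<^sup>2"
      using C [of x] by (simp add: J_def)
    finally show ?thesis by simp
  qed
  define d where "d = Inf (range J)"
  have bdd: "bdd_below (range J)"
    using J_lower by (auto intro!: bdd_belowI)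
  have d_le: "d \<le> J x" for x
    unfolding d_def using bdd by (rule cInf_lower [rotated]) simp
  have "\<exists>x. J x < d + inverse (real (Suc n))" for n
  proof -
    have "Inf (range J) < d + inverse (real (Suc n))"
      by (simp add: d_def)
    then show ?thesis
      using cInf_lessD [of "range J"] by auto
  qed
  then obtain X where X: "\<And>n. J (X n) < d + inverse (real (Suc n))"
    by metis
  have par: "(norm (x - y))\<^sup>2 \<le> 2 * (J x - d) + 2 * (J y - d)" for x y
  proof -
    have "d \<le> J ((1/2) *\<^sub>R (x + y))" by (rule d_le)
    also have "\<dots> = (norm (x + y))\<^sup>2 / 4 - (l x + l y)"
      by (simp add: J_def scaleR add power_mult_distrib power_divide add_divide_distrib)
    finally show ?thesis
      by (simp add: norm_add_sq norm_diff_sq J_def add_divide_distrib)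
  qed
  have "Cauchy X"
  proof (rule CauchyI)
    fix e :: real assume e: "0 < e"
    obtain k where k: "inverse (real (Suc k)) < e\<^sup>2 / 4"
      using reals_Archimedean [of "e\<^sup>2 / 4"] e by auto
    have "norm (X m - X n) < e" if "k \<le> m" "k \<le> n" for m n
    proof -
      have small: "J (X i) - d < e\<^sup>2 / 4" if "k \<le> i" for i
      proof -
        have "inverse (real (Suc i)) \<le> inverse (real (Suc k))"
          using that by (simp add: le_imp_inverse_le)
        then show ?thesis using X [of i] k by linarith
      qed
      have "(norm (X m - X n))\<^sup>2 \<le> 2 * (J (X m) - d) + 2 * (J (X n) - d)"
        by (rule par)
      also have "\<dots> < 2 * (e\<^sup>2 / 4) + 2 * (e\<^sup>2 / 4)"
        by (intro add_strict_mono mult_strict_left_mono small that) auto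
      finally have "(norm (X m - X n))\<^sup>2 < e\<^sup>2" by simp
      then show ?thesis using e by (simp add: power_less_imp_less_base)
    qed
    then show "\<exists>M. \<forall>m\<ge>M. \<forall>n\<ge>M. norm (X m - X n) < e" by blast
  qed
  then obtain z where z: "X \<longlonglongrightarrow> z"
    using Cauchy_convergent_iff convergent_def by blast
  have "(\<lambda>n. J (X n)) \<longlonglongrightarrow> J z"
    unfolding J_def by (intro tendsto_intros tendsto z)
  moreover have "(\<lambda>n. d + inverse (real (Suc n))) \<longlonglongrightarrow> d + 0"
    by (intro tendsto_intros LIMSEQ_inverse_real_of_nat)
  ultimately have Jz: "J z \<le> d"
    using X by (intro LIMSEQ_le) (auto intro: less_imp_le)
  have "l x = rip x z" for x
  proof (rule ccontr)
    assume "l x \<noteq> rip x z"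
    define D where "D = rip x z - l x"
    have D: "D \<noteq> 0" using \<open>l x \<noteq> rip x z\<close> by (simp add: D_def)
    have q: "0 \<le> 2 * (t * D) + t\<^sup>2 * (norm x)\<^sup>2" for t
    proof -
      have "J z \<le> J (z + t *\<^sub>R x)" using Jz d_le by (rule order_trans)
      also have "\<dots> = J z + (2 * (t * D) + t\<^sup>2 * (norm x)\<^sup>2)"
        by (simp add: J_def norm_add_sq add scaleR rip_simps D_def rip_commute [of z]
            power_mult_distrib algebra_simps)
      finally show ?thesis by simp
    qed
    define s where "s = 1 / ((norm x)\<^sup>2 + 1)"
    have s: "0 < s" "s * (norm x)\<^sup>2 < 1"
      unfolding s_def by (simp_all add: add_nonneg_pos divide_less_eq)
    have "0 \<le> 2 * ((- s * D) * D) + (- s * D)\<^sup>2 * (norm x)\<^sup>2"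
      by (rule q)
    also have "\<dots> = s * D\<^sup>2 * (s * (norm x)\<^sup>2 - 2)"
      by (simp add: power2_eq_square algebra_simps)
    finally have "0 \<le> s * D\<^sup>2 * (s * (norm x)\<^sup>2 - 2)" .
    moreover have "s * D\<^sup>2 * (s * (norm x)\<^sup>2 - 2) < 0"
      using s D by (intro mult_pos_neg) auto
    ultimately show False by simp
  qed
  then show ?thesis by blast
qed

lemma bounded_ops_scaleC: "T \<in> bounded_ops \<Longrightarrow> T (c *\<^sub>C x) = c *\<^sub>C T x"
  by (simp add: bounded_ops_def)

lemma cinner_adjoint_iff:
  assumes "T \<in> bounded_ops" "S \<in> bounded_ops"
  shows "(\<forall>x y. cinner (T x) y = cinner x (S y)) \<longleftrightarrow> (\<forall>x y. rip (T x) y = rip x (S y))"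
proof
  assume *: "\<forall>x y. rip (T x) y = rip x (S y)"
  show "\<forall>x y. cinner (T x) y = cinner x (S y)"
    using * bounded_ops_scaleC [OF assms(2)]
    by (auto intro!: complex_eqI simp: Im_cinner) (simp add: rip_def)
qed (simp add: rip_def)

lemma adjoint_exists:
  assumes T: "T \<in> bounded_ops"
  shows "\<exists>S \<in> bounded_ops. \<forall>x y. rip (T x) y = rip x (S y)"
proof -
  have "bounded_linear (\<lambda>x. rip (T x) y)" for y
    by (intro bounded_linear_compose [OF bounded_bilinear.bounded_linear_left [OF bounded_bilinear_rip]]
        blinfun.bounded_linear_right)
  then have "\<exists>z. \<forall>x. rip (T x) y = rip x z" for y
    by (rule riesz)
  then obtain s where s: "\<And>x y. rip (T x) y = rip x (s y)"
    by metis
  have bl: "bounded_linear s"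
  proof (rule bounded_linear_intro [where K = "norm T"])
    show "s (x + y) = s x + s y" for x y
      by (rule rip_eqI) (simp add: s [symmetric] rip_simps)
    show "s (r *\<^sub>R x) = r *\<^sub>R s x" for r x
      by (rule rip_eqI) (simp add: s [symmetric] rip_simps)
    show "norm (s y) \<le> norm y * norm T" for y
    proof -
      have "(norm (s y))\<^sup>2 = rip (T (s y)) y"
        by (simp add: s rip_self)
      also have "\<dots> \<le> norm (T (s y)) * norm y" by (rule rip_le)
      also have "\<dots> \<le> (norm T * norm (s y)) * norm y"
        by (intro mult_right_mono norm_blinfun) simp
      finally have "norm (s y) * norm (s y) \<le> norm (s y) * (norm y * norm T)"
        by (simp add: power2_eq_square ac_simps)
      then show ?thesis
        by (cases "s y = 0") auto
    qed
  qed
  have "s (c *\<^sub>C y) = c *\<^sub>C s y" for c y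
    by (rule rip_eqI) (simp add: s [symmetric] rip_scaleC bounded_ops_scaleC [OF T])
  then show ?thesis
    using bl s by (intro bexI [of _ "Blinfun s"])
      (simp_all add: bounded_ops_def bounded_linear_Blinfun_apply)
qed

lemma adj_eqI:
  assumes "T \<in> bounded_ops" "S \<in> bounded_ops" "\<And>x y. rip (T x) y = rip x (S y)"
  shows "adj T = S"
  unfolding adj_def
proof (rule the_equality)
  show "\<forall>x y. cinner (T x) y = cinner x (S y)"
    using assms cinner_adjoint_iff by blast
  fix R :: "'a op" assume "\<forall>x y. cinner (T x) y = cinner x (R y)"
  then have "rip (T x) y = rip x (R y)" for x y
    by (simp add: rip_def)
  then show "R = S"
    using assms(3) by (metis blinfun_eqI rip_eqI)
qed

lemma adj_bounded_ops: "T \<in> bounded_ops \<Longrightarrow> adj T \<in> bounded_ops"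
  using adjoint_exists adj_eqI by metis

lemma rip_adj: "T \<in> bounded_ops \<Longrightarrow> rip (T x) y = rip x (adj T y)"
  using adjoint_exists adj_eqI by metis

lemma self_adjoint_iff:
  "self_adjoint_op T \<longleftrightarrow> T \<in> bounded_ops \<and> (\<forall>x y. rip (T x) y = rip x (T y))"
  unfolding self_adjoint_op_def using adj_eqI rip_adj by metis

lemma self_adjointD: "self_adjoint_op T \<Longrightarrow> rip (T x) y = rip x (T y)"
  by (simp add: self_adjoint_iff)

text \<open>Nonnegativity of a complex quadratic form includes that it is real, and a real form is that of a
  self-adjoint operator, by polarisation along \<open>x + y\<close> and \<open>x + i y\<close>.\<close>

lemma positive_iff: "positive_op T \<longleftrightarrow> self_adjoint_op T \<and> (\<forall>x. 0 \<le> rip (T x) x)"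
proof
  assume pos: "positive_op T"
  then have T: "T \<in> bounded_ops" and real: "Im (cinner (T x) x) = 0" and ge: "0 \<le> rip (T x) x" for x
    by (auto simp: positive_op_def rip_def complex_nonneg_Reals_iff)
  have flip: "Im (cinner (T x) y) = - Im (cinner (T y) x)" for x y
    using real [of "x + y"] real [of x] real [of y]
    by (simp add: Im_cinner scaleC_add_right rip_simps blinfun.add_right)
  have "rip (T x) y = rip x (T y)" for x y
  proof -
    have "rip (T x) y = - Im (cinner (T x) (\<i> *\<^sub>C y))"
      using rip_minus_right [of "T x" y]
      by (simp add: Im_cinner scaleC_scaleC scaleR_scaleC [of "-1", simplified, symmetric])
    also have "\<dots> = Im (cinner (T (\<i> *\<^sub>C y)) x)"
      by (subst flip) simp
    also have "\<dots> = rip (T y) x"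
      by (simp add: bounded_ops_scaleC [OF T] cinner_scaleC_left rip_def)
    finally show ?thesis by (simp add: rip_commute)
  qed
  then show "self_adjoint_op T \<and> (\<forall>x. 0 \<le> rip (T x) x)"
    using T ge by (simp add: self_adjoint_iff)
next
  assume sa: "self_adjoint_op T \<and> (\<forall>x. 0 \<le> rip (T x) x)"
  then have T: "T \<in> bounded_ops" by (simp add: self_adjoint_iff)
  have "Im (cinner (T x) x) = 0" for x
  proof -
    have "cinner (T x) x = cinner x (T x)"
      using sa T cinner_adjoint_iff [OF T T] by (simp add: self_adjoint_iff)
    then have "cinner (T x) x = cnj (cinner (T x) x)"
      by (metis cinner_commute)
    then show ?thesis by (simp add: complex_eq_iff)
  qed
  then show "positive_op T"
    using T sa by (auto simp: positive_op_def rip_def complex_nonneg_Reals_iff)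
qed

lemma positive_self_adjoint: "positive_op T \<Longrightarrow> self_adjoint_op T"
  by (simp add: positive_iff)

lemma positiveD: "positive_op T \<Longrightarrow> 0 \<le> rip (T x) x"
  by (simp add: positive_iff)

text \<open>Polarisation bounds \<open>\<langle>X x, y\<rangle>\<close> by the quadratic form at \<open>x + y\<close> and \<open>x - y\<close>; the best \<open>y\<close> is a multiple of
  \<open>X x\<close> with the length of \<open>x\<close>.\<close>

lemma norm_le_numerical_radius:
  assumes sa: "self_adjoint_op X" and e: "0 \<le> e" and "\<And>x. \<bar>rip (X x) x\<bar> \<le> e * (norm x)\<^sup>2"
  shows "norm X \<le> e"
proof (rule norm_blinfun_bound [OF e])
  fix x
  have pol: "4 * rip (X x) y \<le> 2 * e * ((norm x)\<^sup>2 + (norm y)\<^sup>2)" for y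
  proof -
    have "4 * rip (X x) y = rip (X (x + y)) (x + y) - rip (X (x - y)) (x - y)"
      using self_adjointD [OF sa, of y x]
      by (simp add: blinfun.add_right blinfun.diff_right rip_simps rip_commute)
    also have "\<dots> \<le> e * (norm (x + y))\<^sup>2 + e * (norm (x - y))\<^sup>2"
      using assms(3) [of "x + y"] assms(3) [of "x - y"] by linarith
    also have "\<dots> = 2 * e * ((norm x)\<^sup>2 + (norm y)\<^sup>2)"
      by (simp add: norm_add_sq norm_diff_sq algebra_simps)
    finally show ?thesis .
  qed
  show "norm (X x) \<le> e * norm x"
  proof (cases "X x = 0")
    case False
    then have x: "0 < norm x" and Xx: "0 < norm (X x)"
      by (auto simp: blinfun.zero_right)
    define r where "r = norm x / norm (X x)"
    have "4 * (r * (norm (X x))\<^sup>2) \<le> 2 * e * ((norm x)\<^sup>2 + (norm (r *\<^sub>R X x))\<^sup>2)"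
      using pol [of "r *\<^sub>R X x"] by (simp add: rip_simps rip_self)
    moreover have "norm (r *\<^sub>R X x) = norm x" "r * (norm (X x))\<^sup>2 = norm x * norm (X x)"
      using Xx by (simp_all add: r_def power2_eq_square)
    ultimately have "norm x * norm (X x) \<le> norm x * (e * norm x)"
      by (simp only:) (simp add: power2_eq_square mult.left_commute)
    then show ?thesis using x by simp
  qed (simp add: e)
qed


section \<open>Operator calculus\<close>

lemma comp_assoc_blinfun: "(A o\<^sub>L B) o\<^sub>L C = A o\<^sub>L (B o\<^sub>L C)"
  by (rule blinfun_eqI) simp

lemma comp_id_left: "id_blinfun o\<^sub>L A = A"
  by (rule blinfun_eqI) simp

lemma comp_id_right: "A o\<^sub>L id_blinfun = A"
  by (rule blinfun_eqI) simp

lemmas op_simps =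
  bounded_bilinear.add_left [OF bounded_bilinear_blinfun_compose]
  bounded_bilinear.add_right [OF bounded_bilinear_blinfun_compose]
  bounded_bilinear.diff_left [OF bounded_bilinear_blinfun_compose]
  bounded_bilinear.diff_right [OF bounded_bilinear_blinfun_compose]
  bounded_bilinear.minus_left [OF bounded_bilinear_blinfun_compose]
  bounded_bilinear.minus_right [OF bounded_bilinear_blinfun_compose]
  bounded_bilinear.scaleR_left [OF bounded_bilinear_blinfun_compose]
  bounded_bilinear.scaleR_right [OF bounded_bilinear_blinfun_compose]
  bounded_bilinear.zero_left [OF bounded_bilinear_blinfun_compose]
  bounded_bilinear.zero_right [OF bounded_bilinear_blinfun_compose]
  comp_assoc_blinfun comp_id_left comp_id_right

lemmas comp_sum_left = bounded_bilinear.sum_left [OF bounded_bilinear_blinfun_compose]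
lemmas comp_sum_right = bounded_bilinear.sum_right [OF bounded_bilinear_blinfun_compose]
lemmas tendsto_comp = bounded_bilinear.tendsto [OF bounded_bilinear_blinfun_compose]

lemma scaleC_scaleR: "c *\<^sub>C (r *\<^sub>R x) = r *\<^sub>R (c *\<^sub>C (x::'h::chilbert_space))"
  by (simp add: scaleR_scaleC scaleC_scaleC mult.commute)

lemma bounded_ops_id: "id_blinfun \<in> bounded_ops"
  and bounded_ops_add: "A \<in> bounded_ops \<Longrightarrow> B \<in> bounded_ops \<Longrightarrow> A + B \<in> bounded_ops"
  and bounded_ops_comp: "A \<in> bounded_ops \<Longrightarrow> B \<in> bounded_ops \<Longrightarrow> A o\<^sub>L B \<in> bounded_ops"
  and bounded_ops_scaleR: "A \<in> bounded_ops \<Longrightarrow> r *\<^sub>R A \<in> bounded_ops"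
  by (simp_all add: bounded_ops_def blinfun.add_left blinfun.scaleR_left scaleC_add_right scaleC_scaleR)

lemma bounded_ops_zero: "0 \<in> bounded_ops"
  using bounded_ops_scaleR [OF bounded_ops_id, of 0] by simp

lemma bounded_ops_diff: "A \<in> bounded_ops \<Longrightarrow> B \<in> bounded_ops \<Longrightarrow> A - B \<in> bounded_ops"
  using bounded_ops_add [of A "(-1) *\<^sub>R B"] bounded_ops_scaleR [of B "-1"] by simp

lemma self_adjoint_id: "self_adjoint_op id_blinfun"
  and self_adjoint_zero: "self_adjoint_op 0"
  and self_adjoint_add: "self_adjoint_op A \<Longrightarrow> self_adjoint_op B \<Longrightarrow> self_adjoint_op (A + B)"
  and self_adjoint_diff: "self_adjoint_op A \<Longrightarrow> self_adjoint_op B \<Longrightarrow> self_adjoint_op (A - B)"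
  and self_adjoint_scaleR: "self_adjoint_op A \<Longrightarrow> self_adjoint_op (r *\<^sub>R A)"
  by (auto simp: self_adjoint_iff bounded_ops_id bounded_ops_zero bounded_ops_add bounded_ops_diff
      bounded_ops_scaleR blinfun.add_left blinfun.diff_left blinfun.scaleR_left rip_simps)

lemma self_adjoint_comp:
  "self_adjoint_op A \<Longrightarrow> self_adjoint_op B \<Longrightarrow> A o\<^sub>L B = B o\<^sub>L A \<Longrightarrow> self_adjoint_op (A o\<^sub>L B)"
  unfolding self_adjoint_iff by (metis blinfun_apply_blinfun_compose bounded_ops_comp)

lemma self_adjoint_conj:
  "self_adjoint_op A \<Longrightarrow> self_adjoint_op B \<Longrightarrow> self_adjoint_op (A o\<^sub>L (B o\<^sub>L A))"
  by (simp add: self_adjoint_iff bounded_ops_comp)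

lemma self_adjoint_sum:
  "(\<And>i. i \<in> I \<Longrightarrow> self_adjoint_op (f i)) \<Longrightarrow> self_adjoint_op (sum f I)"
  by (induction I rule: infinite_finite_induct)
    (auto simp: self_adjoint_zero self_adjoint_add)

lemma self_adjoint_limit:
  fixes B :: "'h::chilbert_space op"
  assumes "\<And>n. self_adjoint_op (A n)" "\<And>x. (\<lambda>n. A n x) \<longlonglongrightarrow> B x"
  shows "self_adjoint_op B"
proof -
  have "B (c *\<^sub>C x) = c *\<^sub>C B x" for c x
  proof -
    have "(\<lambda>n. c *\<^sub>C A n x) \<longlonglongrightarrow> c *\<^sub>C B x"
      using bounded_linear.tendsto [OF bounded_linear_scaleC] assms(2) by blast
    moreover have "(\<lambda>n. c *\<^sub>C A n x) = (\<lambda>n. A n (c *\<^sub>C x))"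
      using assms(1) by (simp add: self_adjoint_iff bounded_ops_scaleC)
    ultimately show ?thesis
      using LIMSEQ_unique assms(2) by metis
  qed
  moreover have "rip (B x) y = rip x (B y)" for x y
  proof -
    have "(\<lambda>n. rip (A n x) y) \<longlonglongrightarrow> rip (B x) y" "(\<lambda>n. rip x (A n y)) \<longlonglongrightarrow> rip x (B y)"
      by (intro tendsto_rip assms tendsto_const)+
    moreover have "(\<lambda>n. rip (A n x) y) = (\<lambda>n. rip x (A n y))"
      using assms(1) by (simp add: self_adjoint_iff)
    ultimately show ?thesis
      using LIMSEQ_unique by metis
  qed
  ultimately show ?thesis
    by (simp add: self_adjoint_iff bounded_ops_def)
qed

lemma norm_limit_pointwise:
  fixes A :: "nat \<Rightarrow> ('h::real_normed_vector \<Rightarrow>\<^sub>L 'h)"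
  shows "A \<longlonglongrightarrow> B \<Longrightarrow> (\<lambda>n. A n x) \<longlonglongrightarrow> B x"
  by (intro blinfun.tendsto tendsto_const)

lemma positive_square: "self_adjoint_op A \<Longrightarrow> positive_op (A o\<^sub>L A)"
  by (simp add: positive_iff self_adjoint_comp) (metis self_adjointD rip_self zero_le_power2)

lemma adj_square_positive:
  assumes "T \<in> bounded_ops" shows "positive_op (adj T o\<^sub>L T)"
proof -
  have "rip (adj T x) y = rip x (T y)" for x y
    using rip_adj [OF assms] by (metis rip_commute)
  then show ?thesis
    using assms adj_bounded_ops [OF assms] rip_adj [OF assms]
    by (simp add: positive_iff self_adjoint_iff bounded_ops_comp rip_self)
qed

lemma adj_self_adjoint: "self_adjoint_op T \<Longrightarrow> adj T = T"
  by (simp add: self_adjoint_op_def)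

lemma adj_comp:
  assumes "A \<in> bounded_ops" "B \<in> bounded_ops"
  shows "adj (A o\<^sub>L B) = adj B o\<^sub>L adj A"
  using assms by (intro adj_eqI) (simp_all add: bounded_ops_comp adj_bounded_ops rip_adj)

text \<open>The form of a positive operator is minimal at a vector where it vanishes; moving from \<open>v\<close> in direction
  \<open>- S v\<close> would lower it further unless \<open>S v = 0\<close>.\<close>

lemma positive_kernel:
  assumes S: "positive_op S" and zero: "rip (S v) v = 0"
  shows "S v = 0"
proof -
  define s where "s = 1 / (norm S + 1)"
  have s: "0 < s" "s * norm S < 1"
    unfolding s_def using norm_ge_zero [of S] by (simp_all add: divide_less_eq add_nonneg_pos)
  define w where "w = S v"
  have "0 \<le> rip (S (v - s *\<^sub>R w)) (v - s *\<^sub>R w)"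
    by (rule positiveD [OF S])
  also have "\<dots> = - 2 * s * (norm w)\<^sup>2 + s\<^sup>2 * rip (S w) w"
    using zero self_adjointD [OF positive_self_adjoint [OF S], of w v]
    by (simp add: blinfun.diff_right blinfun.scaleR_right rip_simps rip_self w_def [symmetric]
        power2_eq_square rip_commute algebra_simps)
  also have "s\<^sup>2 * rip (S w) w \<le> s\<^sup>2 * (norm S * norm w * norm w)"
    by (intro mult_left_mono order_trans [OF rip_le] mult_right_mono norm_blinfun) auto
  also have "- 2 * s * (norm w)\<^sup>2 + s\<^sup>2 * (norm S * norm w * norm w)
      = s * (norm w)\<^sup>2 * (s * norm S - 2)"
    by (simp add: power2_eq_square algebra_simps)
  finally have "0 \<le> s * (norm w)\<^sup>2 * (s * norm S - 2)" by simp
  moreover have "s * (norm w)\<^sup>2 * (s * norm S - 2) < 0" if "w \<noteq> 0"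
    using s that by (intro mult_pos_neg) auto
  ultimately show ?thesis
    unfolding w_def [symmetric] by fastforce
qed

text \<open>Commuting roots satisfy \<open>(S + R) (S - R) = 0\<close>, so the forms of \<open>S\<close> and of \<open>R\<close> both vanish on the range of
  \<open>S - R\<close>.\<close>

lemma positive_sqrt_unique:
  assumes S: "positive_op S" and R: "positive_op R" and sq: "S o\<^sub>L S = R o\<^sub>L R"
    and comm: "S o\<^sub>L R = R o\<^sub>L S"
  shows "S = R"
proof (rule blinfun_eqI)
  fix x
  define d where "d = S x - R x"
  have "(S + R) o\<^sub>L (S - R) = 0"
    using sq comm by (simp add: op_simps)
  from arg_cong [OF this, of "\<lambda>A. blinfun_apply A x"]
  have "S d + R d = 0"
    by (simp add: blinfun.add_left blinfun.diff_left d_def)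
  then have "rip (S d) d + rip (R d) d = 0"
    by (metis rip_add_left rip_zero_left)
  then have "rip (S d) d = 0" "rip (R d) d = 0"
    using positiveD [OF S, of d] positiveD [OF R, of d] by linarith+
  then have "S d = 0" "R d = 0"
    using positive_kernel S R by blast+
  have "(norm d)\<^sup>2 = rip (S x - R x) d"
    unfolding rip_self [symmetric] d_def ..
  also have "\<dots> = rip x (S d - R d)"
    using S R by (simp add: rip_simps positive_self_adjoint self_adjointD)
  also have "\<dots> = 0"
    by (simp add: \<open>S d = 0\<close> \<open>R d = 0\<close> rip_simps)
  finally show "S x = R x"
    by (simp add: d_def)
qed

lemma norm_id_minus_positive:
  assumes A: "positive_op A" and "norm A \<le> 1"
  shows "norm (id_blinfun - A) \<le> 1"
proof (rule norm_le_numerical_radius)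
  fix x
  have "rip (A x) x \<le> norm (A x) * norm x"
    by (rule rip_le)
  also have "\<dots> \<le> (1 * norm x) * norm x"
    by (intro mult_right_mono order_trans [OF norm_blinfun]) (use assms in auto)
  finally have "rip (A x) x \<le> (norm x)\<^sup>2"
    by (simp add: power2_eq_square)
  then show "\<bar>rip ((id_blinfun - A) x) x\<bar> \<le> 1 * (norm x)\<^sup>2"
    using positiveD [OF A, of x] by (simp add: blinfun.diff_left rip_simps rip_self)
qed (use A in \<open>simp_all add: self_adjoint_diff self_adjoint_id positive_self_adjoint\<close>)

text \<open>The square root of \<open>id - B\<close> is \<open>id - Y\<close> with \<open>Y = (B + Y\<^sup>2) / 2\<close>. Iterating
  this equation from \<open>0\<close>, the increments are dominated in norm by those of the scalar iteration
  with \<open>B = 1\<close>, which increases to \<open>1\<close>; hence the iteration converges in norm.\<close>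

primrec sqrt_iter :: "'h::chilbert_space op \<Rightarrow> nat \<Rightarrow> 'h op" where
  "sqrt_iter B 0 = 0"
| "sqrt_iter B (Suc n) = (1/2) *\<^sub>R (B + (sqrt_iter B n o\<^sub>L sqrt_iter B n))"

primrec sqrt_iter_real :: "nat \<Rightarrow> real" where
  "sqrt_iter_real 0 = 0"
| "sqrt_iter_real (Suc n) = (1 + (sqrt_iter_real n)\<^sup>2) / 2"

lemma sqrt_iter_real_bounds: "0 \<le> sqrt_iter_real n \<and> sqrt_iter_real n \<le> 1"
  by (induction n) (auto simp: power_le_one)

lemma sqrt_iter_real_mono: "sqrt_iter_real n \<le> sqrt_iter_real (Suc n)"
proof -
  have "0 \<le> (sqrt_iter_real n - 1)\<^sup>2" by simp
  then show ?thesis by (simp add: power2_diff)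
qed

lemma sqrt_iter_commute:
  assumes "C o\<^sub>L B = B o\<^sub>L C"
  shows "C o\<^sub>L sqrt_iter B n = sqrt_iter B n o\<^sub>L C"
proof (induction n)
  case (Suc n)
  then have "C o\<^sub>L (sqrt_iter B n o\<^sub>L sqrt_iter B n) = sqrt_iter B n o\<^sub>L (sqrt_iter B n o\<^sub>L C)"
    by (metis comp_assoc_blinfun)
  then show ?case using assms by (simp add: op_simps)
qed (simp add: op_simps)

lemma sqrt_iter_bounds:
  assumes B: "norm B \<le> 1"
  shows "norm (sqrt_iter B n) \<le> sqrt_iter_real n
    \<and> norm (sqrt_iter B (Suc n) - sqrt_iter B n) \<le> sqrt_iter_real (Suc n) - sqrt_iter_real n"
proof (induction n)
  case 0
  then show ?case using B by simp
next
  case (Suc n)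
  let ?Y = "sqrt_iter B" and ?y = sqrt_iter_real
  have Y: "norm (?Y (Suc n)) \<le> ?y (Suc n)"
    using Suc norm_triangle_ineq [of "?Y (Suc n) - ?Y n" "?Y n"]
    by (simp del: sqrt_iter.simps sqrt_iter_real.simps)
  have "?Y n o\<^sub>L ?Y (Suc n) = ?Y (Suc n) o\<^sub>L ?Y n"
    using sqrt_iter_commute [OF sqrt_iter_commute [of B B n, symmetric], of "Suc n"] by simp
  then have "(?Y (Suc n) + ?Y n) o\<^sub>L (?Y (Suc n) - ?Y n) = (?Y (Suc n) o\<^sub>L ?Y (Suc n)) - (?Y n o\<^sub>L ?Y n)"
    by (simp add: op_simps del: sqrt_iter.simps)
  also have "\<dots> = 2 *\<^sub>R (?Y (Suc (Suc n)) - ?Y (Suc n))"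
    by (simp add: algebra_simps del: sqrt_iter.simps(2)) (simp add: algebra_simps)
  finally have "2 * norm (?Y (Suc (Suc n)) - ?Y (Suc n))
      = norm ((?Y (Suc n) + ?Y n) o\<^sub>L (?Y (Suc n) - ?Y n))"
    by (metis norm_scaleR abs_numeral)
  also have "\<dots> \<le> norm (?Y (Suc n) + ?Y n) * norm (?Y (Suc n) - ?Y n)"
    by (rule norm_blinfun_compose)
  also have "\<dots> \<le> (?y (Suc n) + ?y n) * (?y (Suc n) - ?y n)"
    using Y Suc by (intro mult_mono norm_triangle_le add_mono) (auto intro: add_nonneg_nonneg simp: sqrt_iter_real_bounds simp del: sqrt_iter_real.simps(2))
  also have "\<dots> = 2 * (?y (Suc (Suc n)) - ?y (Suc n))"
    by (simp add: power2_eq_square algebra_simps add_divide_distrib)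
  finally have "norm (?Y (Suc (Suc n)) - ?Y (Suc n)) \<le> ?y (Suc (Suc n)) - ?y (Suc n)"
    by (rule mult_left_le_imp_le) simp
  then show ?case using Y by blast
qed

lemma sqrt_exists_contraction:
  fixes A :: "'h::chilbert_space op"
  assumes A: "positive_op A" "norm A \<le> 1"
  obtains Y where "positive_op (id_blinfun - Y)" "(id_blinfun - Y) o\<^sub>L (id_blinfun - Y) = A"
    "sqrt_iter (id_blinfun - A) \<longlonglongrightarrow> Y"
proof -
  define B where "B = id_blinfun - A"
  have B: "norm B \<le> 1"
    unfolding B_def using A by (rule norm_id_minus_positive)
  have saB: "self_adjoint_op B"
    unfolding B_def using A by (simp add: self_adjoint_diff self_adjoint_id positive_self_adjoint)
  let ?Y = "sqrt_iter B" and ?y = sqrt_iter_real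
  have "convergent ?y"
    using sqrt_iter_real_mono sqrt_iter_real_bounds
    by (intro Bseq_mono_convergent) (auto intro!: BseqI' [where K = 1] incseq_SucI simp: incseq_def [symmetric] abs_of_nonneg simp del: sqrt_iter_real.simps(2))
  then have "Cauchy ?y"
    by (simp add: Cauchy_convergent_iff)
  have diff: "norm (?Y m - ?Y n) \<le> ?y m - ?y n" if "n \<le> m" for m n
    using that
  proof (induction m rule: dec_induct)
    case (step m)
    have "norm (?Y (Suc m) - ?Y n) \<le> norm (?Y (Suc m) - ?Y m) + norm (?Y m - ?Y n)"
      by (metis diff_add_cancel add_diff_eq norm_triangle_ineq)
    then show ?case
      using step sqrt_iter_bounds [OF B, of m] by linarith
  qed simp
  have "Cauchy ?Y"
  proof (rule CauchyI)
    fix e :: real assume "0 < e"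
    then obtain k where k: "\<And>m n. k \<le> m \<Longrightarrow> k \<le> n \<Longrightarrow> norm (?y m - ?y n) < e"
      using CauchyD [OF \<open>Cauchy ?y\<close>] by blast
    have "norm (?Y m - ?Y n) < e" if "k \<le> m" "k \<le> n" for m n
    proof (cases "n \<le> m")
      case True
      then show ?thesis using diff [OF True] k [of m n] that by auto
    next
      case False
      then show ?thesis using diff [of m n] k [of n m] that by (auto simp: norm_minus_commute)
    qed
    then show "\<exists>k. \<forall>m\<ge>k. \<forall>n\<ge>k. norm (?Y m - ?Y n) < e" by blast
  qed
  then obtain Y where Y: "?Y \<longlonglongrightarrow> Y"
    using Cauchy_convergent_iff convergent_def by blast
  have "(\<lambda>n. ?Y (Suc n)) \<longlonglongrightarrow> (1/2) *\<^sub>R (B + (Y o\<^sub>L Y))"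
    unfolding sqrt_iter.simps by (intro tendsto_intros tendsto_comp Y)
  then have fixpoint: "Y = (1/2) *\<^sub>R (B + (Y o\<^sub>L Y))"
    using LIMSEQ_unique LIMSEQ_Suc [OF Y] by blast
  have "2 *\<^sub>R Y = 2 *\<^sub>R ((1/2) *\<^sub>R (B + (Y o\<^sub>L Y)))"
    using fixpoint by (rule arg_cong)
  then have "Y o\<^sub>L Y = Y + Y - B"
    by (simp add: scaleR_2 algebra_simps)
  then have sq: "(id_blinfun - Y) o\<^sub>L (id_blinfun - Y) = A"
    by (simp add: op_simps B_def)
  have "self_adjoint_op (?Y n)" for n
    by (induction n) (auto intro!: self_adjoint_zero self_adjoint_scaleR self_adjoint_add saB self_adjoint_comp)
  then have saY: "self_adjoint_op Y"
    using norm_limit_pointwise [OF Y] self_adjoint_limit by blast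
  have nY: "norm Y \<le> 1"
  proof (rule LIMSEQ_le_const2)
    show "(\<lambda>n. norm (?Y n)) \<longlonglongrightarrow> norm Y" by (intro tendsto_intros Y)
    show "\<exists>N. \<forall>n\<ge>N. norm (?Y n) \<le> 1"
      using sqrt_iter_bounds [OF B] sqrt_iter_real_bounds order_trans by blast
  qed
  have "0 \<le> rip ((id_blinfun - Y) x) x" for x
  proof -
    have "rip (Y x) x \<le> norm (Y x) * norm x"
      by (rule rip_le)
    also have "\<dots> \<le> (1 * norm x) * norm x"
      using nY by (intro mult_right_mono order_trans [OF norm_blinfun]) auto
    finally show ?thesis
      by (simp add: blinfun.diff_left rip_simps rip_self power2_eq_square)
  qed
  then have "positive_op (id_blinfun - Y)"
    using saY by (simp add: positive_iff self_adjoint_diff self_adjoint_id)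
  then show ?thesis
    using that sq Y by (simp add: B_def)
qed


section \<open>Square roots and spectral projections in a von Neumann algebra\<close>

lemma comp_eq_apply: "A o\<^sub>L B = C \<Longrightarrow> A (B x) = C x"
  by auto

lemma comm_apply: "A o\<^sub>L B = C o\<^sub>L D \<Longrightarrow> A (B x) = C (D x)"
  by (metis blinfun_apply_blinfun_compose)

lemma commute_comp:
  assumes "C o\<^sub>L A = A o\<^sub>L C" "C o\<^sub>L B = B o\<^sub>L C"
  shows "C o\<^sub>L (A o\<^sub>L B) = (A o\<^sub>L B) o\<^sub>L C"
  by (rule blinfun_eqI) (simp add: comm_apply [OF assms(1)] comm_apply [OF assms(2)])

lemma pointwise_limit_exists:
  fixes A :: "nat \<Rightarrow> ('h::banach \<Rightarrow>\<^sub>L 'h)"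
  assumes bound: "\<And>n. norm (A n) \<le> C" and Cauchy: "\<And>x. Cauchy (\<lambda>n. A n x)"
  shows "\<exists>B. \<forall>x. (\<lambda>n. A n x) \<longlonglongrightarrow> blinfun_apply B x"
proof -
  have "\<exists>y. (\<lambda>n. A n x) \<longlonglongrightarrow> y" for x
    using Cauchy [of x] Cauchy_convergent_iff convergent_def by blast
  then obtain f where f: "\<And>x. (\<lambda>n. A n x) \<longlonglongrightarrow> f x" by metis
  have "bounded_linear f"
  proof (rule bounded_linear_intro [where K = C])
    show "f (x + y) = f x + f y" for x y
      using LIMSEQ_unique [OF f [of "x + y"]] tendsto_add [OF f [of x] f [of y]]
      by (simp add: blinfun.add_right)
    show "f (r *\<^sub>R x) = r *\<^sub>R f x" for r x
      using LIMSEQ_unique [OF f [of "r *\<^sub>R x"]] tendsto_scaleR [OF tendsto_const f [of x]]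
      by (simp add: blinfun.scaleR_right)
    show "norm (f x) \<le> norm x * C" for x
    proof (rule LIMSEQ_le_const2)
      show "(\<lambda>n. norm (A n x)) \<longlonglongrightarrow> norm (f x)" by (intro tendsto_norm f)
      show "\<exists>N. \<forall>n\<ge>N. norm (A n x) \<le> norm x * C"
        using order_trans [OF norm_blinfun mult_right_mono [OF bound norm_ge_zero]]
        by (auto simp: mult.commute)
    qed
  qed
  then show ?thesis
    using f by (intro exI [of _ "Blinfun f"]) (simp add: bounded_linear_Blinfun_apply)
qed

lemma limitin_strong_operator_topology:
  fixes A :: "nat \<Rightarrow> ('h::real_normed_vector \<Rightarrow>\<^sub>L 'h)"
  assumes "\<And>x. (\<lambda>n. A n x) \<longlonglongrightarrow> blinfun_apply B x"
  shows "limitin strong_operator_topology A B sequentially"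
proof -
  have fun_lim: "limitin euclidean (\<lambda>n. blinfun_apply (A n)) (blinfun_apply B) sequentially"
    unfolding euclidean_product_topology [symmetric] limitin_componentwise
    using assms by simp
  show ?thesis
    unfolding limitin_def
  proof (intro conjI allI impI)
    show "B \<in> topspace strong_operator_topology"
      by (simp add: strong_operator_topology_topspace)
    fix U assume U: "openin strong_operator_topology U \<and> B \<in> U"
    then obtain V where V: "openin euclidean V" "U = blinfun_apply -` V"
      unfolding strong_operator_topology_def openin_pullback_topology by auto
    then show "\<forall>\<^sub>F n in sequentially. A n \<in> U"
      using fun_lim U unfolding limitin_def by auto
  qed
qed

locale finite_vna =
  fixes M :: "'h::chilbert_space op set" and \<tau> :: "'h op \<Rightarrow> complex"
  assumes finite_vna: "finite_von_neumann_algebra M \<tau>"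
begin

lemma vna: "von_neumann_algebra M"
  using finite_vna by (simp add: finite_von_neumann_algebra_def)

lemma M_bounded_ops: "T \<in> M \<Longrightarrow> T \<in> bounded_ops"
  and M_id: "id_blinfun \<in> M"
  and M_add: "S \<in> M \<Longrightarrow> T \<in> M \<Longrightarrow> S + T \<in> M"
  and M_comp: "S \<in> M \<Longrightarrow> T \<in> M \<Longrightarrow> S o\<^sub>L T \<in> M"
  and M_adj: "T \<in> M \<Longrightarrow> adj T \<in> M"
  and M_scaleC: "T \<in> M \<Longrightarrow> scaleC_op c T \<in> M"
  using vna by (auto simp: von_neumann_algebra_def)

lemma scaleC_op_of_real: "scaleC_op (complex_of_real r) T = r *\<^sub>R T"
  by (rule blinfun_eqI) (simp add: scaleC_op.rep_eq blinfun.scaleR_left scaleR_scaleC)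

lemma M_scaleR: "T \<in> M \<Longrightarrow> r *\<^sub>R T \<in> M"
  using M_scaleC [of T "complex_of_real r"] by (simp add: scaleC_op_of_real)

lemma M_diff: "S \<in> M \<Longrightarrow> T \<in> M \<Longrightarrow> S - T \<in> M"
  using M_add [of S "(-1) *\<^sub>R T"] M_scaleR [of T "-1"] by simp

lemma M_zero: "0 \<in> M"
  using M_scaleR [OF M_id, of 0] by simp

lemma M_sum: "(\<And>i. i \<in> I \<Longrightarrow> f i \<in> M) \<Longrightarrow> sum f I \<in> M"
  by (induction I rule: infinite_finite_induct) (auto simp: M_zero M_add)

lemma M_pointwise_limit:
  assumes "\<And>n. A n \<in> M" "\<And>x. (\<lambda>n. A n x) \<longlonglongrightarrow> blinfun_apply B x"
  shows "B \<in> M"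
proof (rule limitin_closedin)
  show "limitin strong_operator_topology A B sequentially"
    using assms(2) by (rule limitin_strong_operator_topology)
  show "closedin strong_operator_topology M"
    using vna by (simp add: von_neumann_algebra_def)
qed (use assms(1) in auto)

lemma M_norm_limit: "(\<And>n. A n \<in> M) \<Longrightarrow> A \<longlonglongrightarrow> B \<Longrightarrow> B \<in> M"
  using M_pointwise_limit norm_limit_pointwise by blast

lemma M_sqrt_iter: "B \<in> M \<Longrightarrow> sqrt_iter B n \<in> M"
  by (induction n) (auto intro!: M_zero M_scaleR M_add M_comp)

text \<open>The square root also commutes with everything that commutes with the operator, which is what
  makes the spectral projections below commute with each other.\<close>

lemma sqrt_exists:
  assumes T: "T \<in> M" "positive_op T"
  obtains R where "R \<in> M" "positive_op R" "R o\<^sub>L R = T"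
    "\<And>C. C o\<^sub>L T = T o\<^sub>L C \<Longrightarrow> C o\<^sub>L R = R o\<^sub>L C"
proof -
  define c where "c = norm T + 1"
  have c: "0 < c" by (simp add: c_def add_nonneg_pos)
  define A where "A = (1 / c) *\<^sub>R T"
  have A: "positive_op A" "A \<in> M" "norm A \<le> 1"
    using T c by (auto simp: A_def positive_iff self_adjoint_scaleR blinfun.scaleR_left rip_simps
        M_scaleR c_def divide_le_eq)
  obtain Y where Y: "positive_op (id_blinfun - Y)" "(id_blinfun - Y) o\<^sub>L (id_blinfun - Y) = A"
    "sqrt_iter (id_blinfun - A) \<longlonglongrightarrow> Y"
    using A(1,3) by (rule sqrt_exists_contraction) (rule that)
  have YM: "Y \<in> M"
    using Y(3) by (rule M_norm_limit [rotated]) (simp add: M_sqrt_iter M_diff M_id A)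
  define R where "R = sqrt c *\<^sub>R (id_blinfun - Y)"
  have "R o\<^sub>L R = c *\<^sub>R A"
    using c unfolding R_def by (simp add: Y(2) op_simps(7,8))
  then have "R o\<^sub>L R = T"
    using c by (simp add: A_def)
  moreover have "C o\<^sub>L R = R o\<^sub>L C" if "C o\<^sub>L T = T o\<^sub>L C" for C
  proof -
    have "C o\<^sub>L (id_blinfun - A) = (id_blinfun - A) o\<^sub>L C"
      using that by (simp add: A_def op_simps)
    then have "(\<lambda>n. C o\<^sub>L sqrt_iter (id_blinfun - A) n) = (\<lambda>n. sqrt_iter (id_blinfun - A) n o\<^sub>L C)"
      using sqrt_iter_commute by blast
    moreover have "(\<lambda>n. C o\<^sub>L sqrt_iter (id_blinfun - A) n) \<longlonglongrightarrow> (C o\<^sub>L Y)"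
      "(\<lambda>n. sqrt_iter (id_blinfun - A) n o\<^sub>L C) \<longlonglongrightarrow> (Y o\<^sub>L C)"
      by (intro tendsto_comp Y tendsto_const)+
    ultimately have "C o\<^sub>L Y = Y o\<^sub>L C"
      using LIMSEQ_unique by metis
    then show ?thesis by (simp add: R_def op_simps)
  qed
  moreover have "R \<in> M" "positive_op R"
    using Y(1) YM c
    by (auto simp: R_def positive_iff self_adjoint_scaleR blinfun.scaleR_left rip_simps M_scaleR M_diff M_id)
  ultimately show ?thesis by (intro that)
qed

lemma modulus:
  assumes T: "T \<in> M"
  shows "modulus_op T \<in> M" "positive_op (modulus_op T)"
    "modulus_op T o\<^sub>L modulus_op T = adj T o\<^sub>L T"
proof -
  have "adj T o\<^sub>L T \<in> M" "positive_op (adj T o\<^sub>L T)"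
    using T by (simp_all add: M_comp M_adj adj_square_positive M_bounded_ops)
  then obtain R where R: "R \<in> M" "positive_op R" "R o\<^sub>L R = adj T o\<^sub>L T"
    and comm: "\<And>C. C o\<^sub>L (adj T o\<^sub>L T) = (adj T o\<^sub>L T) o\<^sub>L C \<Longrightarrow> C o\<^sub>L R = R o\<^sub>L C"
    by (rule sqrt_exists) (rule that)
  have "modulus_op T = R"
    unfolding modulus_op_def
  proof (rule the_equality)
    fix S assume S: "positive_op S \<and> S o\<^sub>L S = adj T o\<^sub>L T"
    have "S o\<^sub>L (S o\<^sub>L S) = (S o\<^sub>L S) o\<^sub>L S"
      by (rule comp_assoc_blinfun [symmetric])
    then have "S o\<^sub>L (adj T o\<^sub>L T) = (adj T o\<^sub>L T) o\<^sub>L S"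
      using conjunct2 [OF S] by (simp only:)
    then have "S o\<^sub>L R = R o\<^sub>L S"
      by (rule comm)
    then show "S = R"
      using S R by (metis positive_sqrt_unique)
  qed (use R in simp)
  then show "modulus_op T \<in> M" "positive_op (modulus_op T)"
    "modulus_op T o\<^sub>L modulus_op T = adj T o\<^sub>L T"
    using R by simp_all
qed

lemma norm_modulus_apply:
  assumes T: "T \<in> M"
  shows "norm (modulus_op T x) = norm (T x)"
proof -
  have "(norm (modulus_op T x))\<^sup>2 = rip x ((modulus_op T o\<^sub>L modulus_op T) x)"
    using self_adjointD [OF positive_self_adjoint [OF modulus(2) [OF T]]]
    by (simp add: rip_self [symmetric])
  also have "\<dots> = (norm (T x))\<^sup>2"
    using rip_adj [OF M_bounded_ops [OF T], of x "T x"] by (simp add: modulus(3) [OF T] rip_self)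
  finally show ?thesis by simp
qed

definition projM :: "'h op \<Rightarrow> bool" where
  "projM E \<longleftrightarrow> E \<in> M \<and> projection_op E"

lemma projM_D:
  assumes "projM E"
  shows "E \<in> M" "projection_op E" "self_adjoint_op E" "E o\<^sub>L E = E" "E (E x) = E x"
    "rip (E x) y = rip x (E y)"
proof -
  show 1: "E \<in> M" "projection_op E" "self_adjoint_op E" "E o\<^sub>L E = E"
    using assms by (auto simp: projM_def projection_op_def)
  show "E (E x) = E x" using 1(4) by (rule comp_eq_apply)
  show "rip (E x) y = rip x (E y)" by (rule self_adjointD [OF 1(3)])
qed

lemma projM_I: "E \<in> M \<Longrightarrow> self_adjoint_op E \<Longrightarrow> E o\<^sub>L E = E \<Longrightarrow> projM E"
  by (simp add: projM_def projection_op_def)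

lemma projM_id: "projM id_blinfun"
  by (intro projM_I M_id self_adjoint_id) (simp add: op_simps)

lemma projM_zero: "projM 0"
  by (intro projM_I M_zero self_adjoint_zero) (simp add: op_simps)

lemma projM_complement: "projM E \<Longrightarrow> projM (id_blinfun - E)"
  by (rule projM_I) (simp_all add: M_diff M_id self_adjoint_diff self_adjoint_id op_simps projM_D(1,3,4))

lemma projM_comp:
  assumes "projM E" "projM F" and comm: "E o\<^sub>L F = F o\<^sub>L E"
  shows "projM (E o\<^sub>L F)"
proof (rule projM_I)
  show "E o\<^sub>L F \<in> M" "self_adjoint_op (E o\<^sub>L F)"
    by (rule M_comp [OF assms(1,2) [THEN projM_D(1)]])
      (rule self_adjoint_comp [OF assms(1,2) [THEN projM_D(3)] comm])
  have "(E o\<^sub>L F) o\<^sub>L (E o\<^sub>L F) = (E o\<^sub>L E) o\<^sub>L (F o\<^sub>L F)"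
    by (intro blinfun_eqI) (simp add: comm_apply [OF comm])
  then show "(E o\<^sub>L F) o\<^sub>L (E o\<^sub>L F) = E o\<^sub>L F"
    using assms(1,2) by (simp add: projM_D(4))
qed

lemma norm_projM_apply_sq: "projM E \<Longrightarrow> (norm (E x))\<^sup>2 = rip (E x) x"
  by (simp add: rip_self [symmetric] projM_D)

lemma projM_positive: "projM E \<Longrightarrow> positive_op E"
  using norm_projM_apply_sq by (metis positive_iff projM_D(3) zero_le_power2)

lemma norm_projM_le: "projM E \<Longrightarrow> norm E \<le> 1"
proof (rule norm_blinfun_bound)
  fix x assume E: "projM E"
  have "norm (E x) * norm (E x) \<le> norm (E x) * norm x"
    using norm_projM_apply_sq [OF E, of x] rip_le [of "E x" x] by (simp add: power2_eq_square)
  then show "norm (E x) \<le> 1 * norm x"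
    by (cases "E x = 0") auto
qed simp

lemma norm_projM_eq: "projM E \<Longrightarrow> E \<noteq> 0 \<Longrightarrow> norm E = 1"
proof -
  assume E: "projM E" and "E \<noteq> 0"
  have "norm E \<le> norm E * norm E"
    using norm_blinfun_compose [of E E] E by (simp add: projM_D)
  then have "1 \<le> norm E" using \<open>E \<noteq> 0\<close> by simp
  then show ?thesis using norm_projM_le [OF E] by simp
qed

text \<open>For \<open>0 \<le> Z \<le> 1\<close> the powers of \<open>Z\<close> decrease, so \<open>\<parallel>Z\<^sup>m x - Z\<^sup>k x\<parallel>\<^sup>2\<close> is a second difference of the
  convergent sequence \<open>\<langle>Z\<^sup>j x, x\<rangle>\<close>; the strong limit of \<open>Z\<^sup>m\<close> is the projection onto the kernel of
  \<open>1 - Z\<close>.\<close>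

lemma kernel_projection_positive:
  assumes Y: "Y \<in> M" "positive_op Y" "norm Y \<le> 1"
  obtains K where "projM K" "Y o\<^sub>L K = 0" "\<And>W :: 'h op. Y o\<^sub>L W = 0 \<Longrightarrow> K o\<^sub>L W = W"
    "\<And>C. C o\<^sub>L Y = Y o\<^sub>L C \<Longrightarrow> C o\<^sub>L K = K o\<^sub>L C"
proof -
  define Z where "Z = id_blinfun - Y"
  have saY: "self_adjoint_op Y" using Y by (simp add: positive_self_adjoint)
  have saZ: "self_adjoint_op Z" by (simp add: Z_def saY self_adjoint_diff self_adjoint_id)
  have ZM: "Z \<in> M" by (simp add: Z_def M_diff M_id Y)
  have nZ: "norm Z \<le> 1"
    unfolding Z_def using Y by (intro norm_id_minus_positive)
  have posZ: "0 \<le> rip (Z x) x" for x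
  proof -
    have "rip (Y x) x \<le> norm (Y x) * norm x"
      by (rule rip_le)
    also have "\<dots> \<le> (1 * norm x) * norm x"
      using Y by (intro mult_right_mono order_trans [OF norm_blinfun]) auto
    finally show ?thesis
      by (simp add: Z_def blinfun.diff_left rip_simps rip_self power2_eq_square)
  qed
  define P where "P n = ((\<lambda>S. Z o\<^sub>L S) ^^ n) id_blinfun" for n
  have P0: "P 0 = id_blinfun" and PSuc: "P (Suc n) = Z o\<^sub>L P n" for n
    by (simp_all add: P_def)
  have Padd: "P (m + n) = P m o\<^sub>L P n" for m n
    by (induction m) (simp_all add: P0 PSuc op_simps)
  have Pcomm: "C o\<^sub>L P n = P n o\<^sub>L C" if "C o\<^sub>L Z = Z o\<^sub>L C" for C n
  proof (induction n)
    case (Suc n)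
    have "C o\<^sub>L (Z o\<^sub>L P n) = Z o\<^sub>L (C o\<^sub>L P n)"
      unfolding comp_assoc_blinfun [symmetric] that ..
    then show ?case by (simp only: PSuc Suc comp_assoc_blinfun)
  qed (simp add: P0 op_simps)
  have saP: "self_adjoint_op (P n)" for n
    by (induction n) (auto simp: P0 PSuc self_adjoint_id intro!: self_adjoint_comp saZ Pcomm)
  have PM: "P n \<in> M" for n
    by (induction n) (auto simp: P0 PSuc M_id M_comp ZM)
  have nP: "norm (P n) \<le> 1" for n
  proof (induction n)
    case 0
    show ?case by (simp add: P0 norm_blinfun_id_le)
  next
    case (Suc n)
    have "norm (P (Suc n)) \<le> norm Z * norm (P n)"
      unfolding PSuc by (rule norm_blinfun_compose)
    also have "\<dots> \<le> 1" using nZ Suc by (simp add: mult_le_one)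
    finally show ?case .
  qed
  define g where "g x n = rip (P n x) x" for x n
  have even: "P (n + n) x = P n (P n x)" for n x
    by (simp add: Padd)
  have g0: "0 \<le> g x n" for x n
  proof (cases "even n")
    case True
    then obtain k where "n = k + k" by (auto elim: evenE simp: mult_2)
    then show ?thesis using self_adjointD [OF saP] by (simp add: g_def even rip_self)
  next
    case False
    then obtain k where "n = Suc (k + k)" by (auto elim: oddE simp: mult_2)
    then have "P n x = P k (Z (P k x))"
      using arg_cong [OF Pcomm [of Z k], of "\<lambda>A. A (P k x)"] by (simp add: PSuc even)
    then show ?thesis using self_adjointD [OF saP] posZ by (simp add: g_def)
  qed
  \<comment> \<open>\<open>Z - Z\<^sup>2 = Z Y Z + Y Z Y\<close>, because \<open>Y + Z = 1\<close>; conjugating by powers of \<open>Z\<close> covers both parities.\<close>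
  have ZY: "Z o\<^sub>L Y = Y o\<^sub>L Z" by (simp add: Z_def op_simps)
  have YZpos: "0 \<le> rip (Z (Y x)) x" for x
  proof -
    have "Z o\<^sub>L Y = (Z o\<^sub>L (Y o\<^sub>L Z)) + (Y o\<^sub>L (Z o\<^sub>L Y))"
      by (simp add: Z_def op_simps)
    then have "Z (Y x) = Z (Y (Z x)) + Y (Z (Y x))"
      by (auto dest: arg_cong [where f = "\<lambda>A. blinfun_apply A x"] simp: blinfun.add_left)
    then have "rip (Z (Y x)) x = rip (Z (Y (Z x)) + Y (Z (Y x))) x"
      by (rule arg_cong)
    also have "\<dots> = rip (Y (Z x)) (Z x) + rip (Z (Y x)) (Y x)"
      unfolding rip_add_left self_adjointD [OF saZ, of "Y (Z x)"] self_adjointD [OF saY, of "Z (Y x)"] ..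
    finally show ?thesis
      using positiveD [OF Y(2), of "Z x"] posZ [of "Y x"] by simp
  qed
  have gdec: "g x (Suc n) \<le> g x n" for x n
  proof -
    have PY: "P k (Y v) = Y (P k v)" for k v
      by (rule comm_apply [OF Pcomm [OF ZY [symmetric]], symmetric])
    have PZ: "P k (Z v) = Z (P k v)" for k v
      by (rule comm_apply [OF Pcomm [OF refl], symmetric])
    have "g x n - g x (Suc n) = rip (Y (P n x)) x"
      by (simp add: g_def PSuc Z_def blinfun.diff_left rip_simps)
    also have "\<dots> \<ge> 0"
    proof (cases "even n")
      case True
      then obtain k where "n = k + k" by (auto elim: evenE simp: mult_2)
      then have "rip (Y (P n x)) x = rip (Y (P k x)) (P k x)"
        by (simp add: even PY [symmetric] self_adjointD [OF saP])
      then show ?thesis using positiveD [OF Y(2)] by simp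
    next
      case False
      then obtain k where "n = Suc (k + k)" by (auto elim: oddE simp: mult_2)
      then have "Y (P n x) = P k (Z (Y (P k x)))"
        by (simp add: PSuc even PY PZ comm_apply [OF ZY])
      then show ?thesis using YZpos by (simp add: self_adjointD [OF saP])
    qed
    finally show ?thesis by simp
  qed
  have gconv: "convergent (g x)" for x
  proof (rule Bseq_monoseq_convergent)
    have "decseq (g x)" using gdec by (rule decseq_SucI)
    then show "monoseq (g x)" by (rule decseq_imp_monoseq)
    have "g x n \<le> g x 0" for n using \<open>decseq (g x)\<close> by (simp add: decseq_def)
    then show "Bseq (g x)" using g0 by (intro BseqI' [where K = "g x 0"]) auto
  qed
  have dist: "(norm (P m x - P k x))\<^sup>2 = g x (m + m) - 2 * g x (m + k) + g x (k + k)" for m k x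
    unfolding norm_diff_sq unfolding rip_self [symmetric] rip_commute [of "P m x" "P k x"]
    by (simp add: g_def Padd self_adjointD [OF saP])
  have Cau: "Cauchy (\<lambda>n. P n x)" for x
  proof (rule CauchyI)
    fix e :: real assume e: "0 < e"
    obtain L where L: "g x \<longlonglongrightarrow> L" using gconv convergent_def by blast
    then obtain N where N: "\<And>n. N \<le> n \<Longrightarrow> \<bar>g x n - L\<bar> < e\<^sup>2 / 4"
      using LIMSEQ_D [OF L, of "e\<^sup>2 / 4"] e by auto
    have "norm (P m x - P k x) < e" if "N \<le> m" "N \<le> k" for m k
    proof -
      have "\<bar>g x (m + m) - L\<bar> < e\<^sup>2 / 4" "\<bar>g x (m + k) - L\<bar> < e\<^sup>2 / 4" "\<bar>g x (k + k) - L\<bar> < e\<^sup>2 / 4"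
        by (rule N, use that in simp)+
      then have "g x (m + m) - 2 * g x (m + k) + g x (k + k) < 4 * (e\<^sup>2 / 4)"
        unfolding abs_less_iff by argo
      then have "(norm (P m x - P k x))\<^sup>2 < e\<^sup>2"
        unfolding dist by simp
      then show ?thesis using e by (simp add: power_less_imp_less_base)
    qed
    then show "\<exists>N. \<forall>m\<ge>N. \<forall>k\<ge>N. norm (P m x - P k x) < e" by blast
  qed
  obtain K where K: "\<And>x. (\<lambda>n. P n x) \<longlonglongrightarrow> blinfun_apply K x"
    using pointwise_limit_exists [OF nP Cau] by blast
  have KM: "K \<in> M" using M_pointwise_limit PM K by blast
  have saK: "self_adjoint_op K" using self_adjoint_limit saP K by blast
  have comm: "C o\<^sub>L K = K o\<^sub>L C" if C: "C o\<^sub>L Y = Y o\<^sub>L C" for C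
  proof (rule blinfun_eqI)
    fix x
    have "C o\<^sub>L Z = Z o\<^sub>L C" using C by (simp add: Z_def op_simps)
    then have "C (P n x) = P n (C x)" for n
      by (rule comm_apply [OF Pcomm])
    moreover have "(\<lambda>n. C (P n x)) \<longlonglongrightarrow> C (K x)"
      by (intro blinfun.tendsto tendsto_const K)
    ultimately have "(\<lambda>n. P n (C x)) \<longlonglongrightarrow> C (K x)"
      by (simp only:)
    then show "(C o\<^sub>L K) x = (K o\<^sub>L C) x"
      using LIMSEQ_unique [OF _ K] by simp
  qed
  have ZK: "Z (K x) = K x" for x
  proof -
    have "(\<lambda>n. P (Suc n) x) \<longlonglongrightarrow> Z (K x)"
      unfolding PSuc blinfun_apply_blinfun_compose by (intro blinfun.tendsto tendsto_const K)
    then show ?thesis using LIMSEQ_unique [OF _ LIMSEQ_Suc [OF K]] by blast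
  qed
  then have YK: "Y o\<^sub>L K = 0"
    by (intro blinfun_eqI) (simp add: Z_def blinfun.diff_left)
  have KW: "K o\<^sub>L W = W" if W: "Y o\<^sub>L W = 0" for W :: "'h op"
  proof (rule blinfun_eqI)
    fix x
    have "Y (W x) = 0" using comp_eq_apply [OF W] by simp
    then have "Z (W x) = W x" by (simp add: Z_def blinfun.diff_left)
    then have "P n (W x) = W x" for n by (induction n) (simp_all add: P0 PSuc)
    then show "(K o\<^sub>L W) x = W x" 
      using LIMSEQ_unique [OF K [of "W x"]] by simp
  qed
  show ?thesis
    by (rule that [OF projM_I [OF KM saK KW [OF YK]] YK KW comm])
qed

text \<open>The kernel of a self-adjoint \<open>X\<close> is that of the positive operator \<open>X\<^sup>2\<close>, scaled to be a contraction.\<close>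

lemma kernel_projection:
  assumes X: "X \<in> M" "self_adjoint_op X"
  obtains K where "projM K" "X o\<^sub>L K = 0" "\<And>W :: 'h op. X o\<^sub>L W = 0 \<Longrightarrow> K o\<^sub>L W = W"
    "\<And>C. C o\<^sub>L X = X o\<^sub>L C \<Longrightarrow> C o\<^sub>L K = K o\<^sub>L C"
proof -
  define c where "c = 1 / (norm (X o\<^sub>L X) + 1)"
  have c: "0 < c" by (simp add: c_def add_nonneg_pos)
  define Y where "Y = c *\<^sub>R (X o\<^sub>L X)"
  have posY: "positive_op Y"
    using positive_square [OF X(2)] c
    by (auto simp: Y_def positive_iff self_adjoint_scaleR blinfun.scaleR_left rip_simps)
  have nY: "norm Y \<le> 1"
    unfolding Y_def c_def by (simp add: divide_le_eq not_less)
  have "Y \<in> M" by (simp add: Y_def M_scaleR M_comp X)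
  then obtain K where K: "projM K" "Y o\<^sub>L K = 0" "\<And>W :: 'h op. Y o\<^sub>L W = 0 \<Longrightarrow> K o\<^sub>L W = W"
    "\<And>C. C o\<^sub>L Y = Y o\<^sub>L C \<Longrightarrow> C o\<^sub>L K = K o\<^sub>L C"
    using posY nY by (rule kernel_projection_positive) (rule that)
  have "X (K x) = 0" for x
  proof -
    have "c *\<^sub>R X (X (K x)) = 0"
      using arg_cong [OF K(2), of "\<lambda>A. A x"] by (simp add: Y_def blinfun.scaleR_left)
    then have "rip (X (X (K x))) (K x) = 0" using c by (simp add: rip_zero_left)
    then show ?thesis by (simp add: self_adjointD [OF X(2)] rip_self)
  qed
  then have "X o\<^sub>L K = 0" by (intro blinfun_eqI) simp
  moreover have "K o\<^sub>L W = W" if "X o\<^sub>L W = 0" for W :: "'h op"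
    using that by (intro K(3)) (simp add: Y_def op_simps)
  moreover have "C o\<^sub>L K = K o\<^sub>L C" if "C o\<^sub>L X = X o\<^sub>L C" for C
  proof (rule K(4))
    have "C o\<^sub>L (X o\<^sub>L X) = (X o\<^sub>L X) o\<^sub>L C" 
      by (rule commute_comp [OF that that])
    then show "C o\<^sub>L Y = Y o\<^sub>L C" by (simp add: Y_def op_simps)
  qed
  ultimately show ?thesis using K(1) by (intro that)
qed

text \<open>Splitting the spectrum of \<open>T\<close> at \<open>s\<close>: with \<open>X = T - s\<close>, the projection onto the kernel of
  \<open>\<bar>X\<bar> - X\<close> is the spectral projection of \<open>[s, \<infinity>)\<close>.\<close>

lemma spectral_split:
  assumes T: "T \<in> M" "self_adjoint_op T"
  obtains E where "projM E" "\<And>C. C o\<^sub>L T = T o\<^sub>L C \<Longrightarrow> C o\<^sub>L E = E o\<^sub>L C"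
    "\<And>x. E x = x \<Longrightarrow> s * (norm x)\<^sup>2 \<le> rip (T x) x"
    "\<And>x. E x = 0 \<Longrightarrow> rip (T x) x \<le> s * (norm x)\<^sup>2"
proof -
  define X where "X = T - s *\<^sub>R id_blinfun"
  have X: "X \<in> M" "self_adjoint_op X"
    by (simp_all add: X_def M_diff M_scaleR M_id T self_adjoint_diff self_adjoint_scaleR self_adjoint_id)
  obtain R where R: "R \<in> M" "positive_op R" "R o\<^sub>L R = X o\<^sub>L X"
    "\<And>C. C o\<^sub>L (X o\<^sub>L X) = (X o\<^sub>L X) o\<^sub>L C \<Longrightarrow> C o\<^sub>L R = R o\<^sub>L C"
    using M_comp [OF X(1) X(1)] positive_square [OF X(2)] by (rule sqrt_exists) (rule that)
  have commR: "C o\<^sub>L R = R o\<^sub>L C" if "C o\<^sub>L X = X o\<^sub>L C" for C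
    by (rule R(4) [OF commute_comp [OF that that]])
  have "R - X \<in> M" "self_adjoint_op (R - X)"
    using R(1,2) X by (simp_all add: M_diff self_adjoint_diff positive_self_adjoint)
  then obtain E where E: "projM E" "(R - X) o\<^sub>L E = 0" "\<And>W :: 'h op. (R - X) o\<^sub>L W = 0 \<Longrightarrow> E o\<^sub>L W = W"
    "\<And>C. C o\<^sub>L (R - X) = (R - X) o\<^sub>L C \<Longrightarrow> C o\<^sub>L E = E o\<^sub>L C"
    by (rule kernel_projection) (rule that)
  have comm: "C o\<^sub>L E = E o\<^sub>L C" if "C o\<^sub>L T = T o\<^sub>L C" for C
  proof (rule E(4))
    have "C o\<^sub>L X = X o\<^sub>L C" using that by (simp add: X_def op_simps)
    then show "C o\<^sub>L (R - X) = (R - X) o\<^sub>L C" using commR [of C] by (simp add: op_simps)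
  qed
  have TX: "rip (T x) x = rip (X x) x + s * (norm x)\<^sup>2" for x
    by (simp add: X_def blinfun.diff_left blinfun.scaleR_left rip_simps rip_self)
  have lower: "s * (norm x)\<^sup>2 \<le> rip (T x) x" if "E x = x" for x
  proof -
    have "X x = R x"
      using arg_cong [OF E(2), of "\<lambda>A. A x"] that by (simp add: blinfun.diff_left)
    then show ?thesis using positiveD [OF R(2), of x] by (simp add: TX)
  qed
  have upper: "rip (T x) x \<le> s * (norm x)\<^sup>2" if Ex: "E x = 0" for x
  proof -
    have "(R - X) o\<^sub>L (R + X) = 0"
      using R(3) commR [OF refl] by (simp add: op_simps)
    then have EW: "E o\<^sub>L (R + X) = R + X" by (rule E(3))
    have "(R + X) o\<^sub>L (R - X) = (R - X) o\<^sub>L (R + X)"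
      using commR [OF refl] by (simp add: op_simps)
    from comm_apply [OF E(4) [OF this], of x]
    have "(R + X) (E x) = E (R x + X x)"
      by (simp add: blinfun.add_left)
    moreover have "E (R x + X x) = R x + X x"
      using comp_eq_apply [OF EW, of x] by (simp add: blinfun.add_left)
    ultimately have "R x + X x = 0"
      using Ex by (simp add: blinfun.zero_right)
    then have "X x = - R x"
      by (simp add: eq_neg_iff_add_eq_0 add.commute)
    then show ?thesis using positiveD [OF R(2), of x] by (simp add: TX rip_simps)
  qed
  show ?thesis by (rule that [OF E(1) comm lower upper])
qed

end


context finite_vna
begin

section \<open>Orthogonal partitions and simple operators\<close>

text \<open>The index set is arbitrary, so that the common refinement of two partitions can be indexed by pairs.\<close>

definition opart :: "'i set \<Rightarrow> ('i \<Rightarrow> 'h op) \<Rightarrow> bool" where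
  "opart J G \<longleftrightarrow> finite J \<and> (\<forall>j\<in>J. projM (G j)) \<and>
     (\<forall>i\<in>J. \<forall>j\<in>J. i \<noteq> j \<longrightarrow> G i o\<^sub>L G j = 0) \<and> sum G J = id_blinfun"

definition simple_op :: "'i set \<Rightarrow> ('i \<Rightarrow> 'h op) \<Rightarrow> ('i \<Rightarrow> real) \<Rightarrow> 'h op" where
  "simple_op J G a = (\<Sum>j\<in>J. a j *\<^sub>R G j)"

lemma opartD:
  assumes "opart J G"
  shows "finite J" "j \<in> J \<Longrightarrow> projM (G j)" "sum G J = id_blinfun"
    "i \<in> J \<Longrightarrow> j \<in> J \<Longrightarrow> i \<noteq> j \<Longrightarrow> G i o\<^sub>L G j = 0"
  using assms by (auto simp: opart_def)

lemma opart_apply_sum: "opart J G \<Longrightarrow> (\<Sum>j\<in>J. G j x) = x"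
  by (simp add: opartD(3) flip: blinfun.sum_left)

lemma opart_comp_eq:
  "opart J G \<Longrightarrow> i \<in> J \<Longrightarrow> j \<in> J \<Longrightarrow> G i o\<^sub>L G j = (if i = j then G i else 0)"
  using projM_D(4) by (auto simp: opart_def)

lemma simple_op_apply: "simple_op J G a x = (\<Sum>j\<in>J. a j *\<^sub>R G j x)"
  by (simp add: simple_op_def blinfun.sum_left blinfun.scaleR_left)

lemma simple_op_M: "opart J G \<Longrightarrow> simple_op J G a \<in> M"
  unfolding simple_op_def by (intro M_sum M_scaleR) (auto dest: opartD(2) projM_D(1))

lemma simple_op_self_adjoint: "opart J G \<Longrightarrow> self_adjoint_op (simple_op J G a)"
  unfolding simple_op_def by (intro self_adjoint_sum self_adjoint_scaleR) (auto dest: opartD(2) projM_D(3))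

lemma comp_simple_op:
  assumes "opart J G" "j \<in> J"
  shows "G j o\<^sub>L simple_op J G a = a j *\<^sub>R G j"
proof -
  have "G j o\<^sub>L simple_op J G a = (\<Sum>i\<in>J. if j = i then a j *\<^sub>R G j else 0)"
    unfolding simple_op_def comp_sum_right
    by (intro sum.cong) (auto simp: op_simps opart_comp_eq [OF assms])
  then show ?thesis by (simp add: opartD(1) [OF assms(1)] assms(2))
qed

lemma simple_op_comp_part:
  assumes "opart J G" "j \<in> J"
  shows "simple_op J G a o\<^sub>L G j = a j *\<^sub>R G j"
proof -
  have "simple_op J G a o\<^sub>L G j = (\<Sum>i\<in>J. if j = i then a j *\<^sub>R G j else 0)"
    unfolding simple_op_def comp_sum_left
    by (intro sum.cong) (auto simp: op_simps opart_comp_eq [OF assms(1) _ assms(2)])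
  then show ?thesis by (simp add: opartD(1) [OF assms(1)] assms(2))
qed

lemma simple_op_comp:
  assumes "opart J G"
  shows "simple_op J G a o\<^sub>L simple_op J G b = simple_op J G (\<lambda>j. a j * b j)"
proof -
  have "simple_op J G a o\<^sub>L simple_op J G b = (\<Sum>j\<in>J. a j *\<^sub>R (G j o\<^sub>L simple_op J G b))"
    by (simp add: simple_op_def comp_sum_left op_simps)
  also have "\<dots> = simple_op J G (\<lambda>j. a j * b j)"
    unfolding simple_op_def [of J G "\<lambda>j. a j * b j"]
    by (intro sum.cong) (simp_all add: comp_simple_op [OF assms])
  finally show ?thesis .
qed

lemma simple_op_one: "opart J G \<Longrightarrow> simple_op J G (\<lambda>_. 1) = id_blinfun"
  by (simp add: simple_op_def opartD)

lemma op_power_Suc: "op_power T (Suc n) = T o\<^sub>L op_power T n"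
  by (simp add: op_power_def)

lemma op_power_0: "op_power T 0 = id_blinfun"
  by (simp add: op_power_def)

lemma op_power_simple: "opart J G \<Longrightarrow> op_power (simple_op J G a) n = simple_op J G (\<lambda>j. a j ^ n)"
  by (induction n) (simp_all add: op_power_0 op_power_Suc simple_op_one simple_op_comp)

lemma simple_op_add: "simple_op J G a + simple_op J G b = simple_op J G (\<lambda>j. a j + b j)"
  by (simp add: simple_op_def sum.distrib scaleR_add_left)

lemma simple_op_diff: "simple_op J G a - simple_op J G b = simple_op J G (\<lambda>j. a j - b j)"
  by (simp add: simple_op_def sum_subtractf scaleR_diff_left)

lemma simple_op_scaleR: "c *\<^sub>R simple_op J G a = simple_op J G (\<lambda>j. c * a j)"
  by (simp add: simple_op_def scaleR_sum_right)

lemma rip_simple_op: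
  assumes "opart J G"
  shows "rip (simple_op J G a x) x = (\<Sum>j\<in>J. a j * (norm (G j x))\<^sup>2)"
  unfolding simple_op_apply rip_sum_left
  by (intro sum.cong) (auto simp: rip_simps norm_projM_apply_sq opartD(2) [OF assms])

lemma norm_simple_op_apply:
  assumes G: "opart J G"
  shows "(norm (simple_op J G a x))\<^sup>2 = (\<Sum>j\<in>J. (a j)\<^sup>2 * (norm (G j x))\<^sup>2)"
proof -
  have "(norm (simple_op J G a x))\<^sup>2 = rip (simple_op J G (\<lambda>j. a j * a j) x) x"
    using self_adjointD [OF simple_op_self_adjoint [OF G], of a "simple_op J G a x" x]
    by (simp add: simple_op_comp [OF G, symmetric] rip_self rip_commute)
  then show ?thesis by (simp add: rip_simple_op [OF G] power2_eq_square)
qed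

lemma opart_norm_sq: "opart J G \<Longrightarrow> (norm x)\<^sup>2 = (\<Sum>j\<in>J. (norm (G j x))\<^sup>2)"
  using rip_simple_op [of J G "\<lambda>_. 1" x] by (simp add: simple_op_one rip_self)

lemma simple_op_positive:
  "opart J G \<Longrightarrow> (\<And>j. j \<in> J \<Longrightarrow> 0 \<le> a j) \<Longrightarrow> positive_op (simple_op J G a)"
  by (auto simp: positive_iff simple_op_self_adjoint rip_simple_op intro!: sum_nonneg)

text \<open>The products of two commuting partitions form a common refinement, over which simple operators of both
  kinds can be compared coefficient by coefficient.\<close>

lemma opart_product:
  assumes P: "opart J P" and E: "opart I E"
    and comm: "\<And>j i. j \<in> J \<Longrightarrow> i \<in> I \<Longrightarrow> P j o\<^sub>L E i = E i o\<^sub>L P j"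
  defines "G \<equiv> \<lambda>(j, i). P j o\<^sub>L E i"
  shows "opart (J \<times> I) G" "simple_op J P a = simple_op (J \<times> I) G (\<lambda>(j, i). a j)"
    "simple_op I E b = simple_op (J \<times> I) G (\<lambda>(j, i). b i)"
proof -
  show simpleP: "simple_op J P a = simple_op (J \<times> I) G (\<lambda>(j, i). a j)" for a
  proof -
    have "simple_op J P a = (\<Sum>j\<in>J. a j *\<^sub>R (P j o\<^sub>L sum E I))"
      by (simp add: simple_op_def opartD(3) [OF E] op_simps)
    also have "\<dots> = (\<Sum>j\<in>J. \<Sum>i\<in>I. a j *\<^sub>R (P j o\<^sub>L E i))"
      by (simp add: comp_sum_right scaleR_sum_right)
    finally show ?thesis
      by (simp add: simple_op_def G_def sum.cartesian_product split_def)
  qed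
  show "simple_op I E b = simple_op (J \<times> I) G (\<lambda>(j, i). b i)"
  proof -
    have "simple_op I E b = (\<Sum>i\<in>I. b i *\<^sub>R (sum P J o\<^sub>L E i))"
      by (simp add: simple_op_def opartD(3) [OF P] op_simps)
    also have "\<dots> = (\<Sum>i\<in>I. \<Sum>j\<in>J. b i *\<^sub>R (P j o\<^sub>L E i))"
      by (simp add: comp_sum_left scaleR_sum_right)
    also have "\<dots> = (\<Sum>j\<in>J. \<Sum>i\<in>I. b i *\<^sub>R (P j o\<^sub>L E i))"
      by (rule sum.swap)
    finally show ?thesis
      by (simp add: simple_op_def G_def sum.cartesian_product split_def)
  qed
  have "sum G (J \<times> I) = id_blinfun"
    using simpleP [of "\<lambda>_. 1"] by (simp add: simple_op_one [OF P]) (simp add: simple_op_def split_def)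
  moreover have "G p o\<^sub>L G q = 0" if pq_in: "p \<in> J \<times> I" "q \<in> J \<times> I" and ne: "p \<noteq> q" for p q
  proof -
    obtain j i j' i' where pq: "p = (j, i)" "q = (j', i')" "j \<in> J" "i \<in> I" "j' \<in> J" "i' \<in> I"
      using pq_in by blast
    have "G p o\<^sub>L G q = P j o\<^sub>L ((E i o\<^sub>L P j') o\<^sub>L E i')"
      by (simp add: G_def pq comp_assoc_blinfun)
    also have "\<dots> = (P j o\<^sub>L P j') o\<^sub>L (E i o\<^sub>L E i')"
      by (simp add: comm [symmetric] pq comp_assoc_blinfun)
    also have "\<dots> = 0"
      using ne pq by (auto simp: opart_comp_eq [OF P] opart_comp_eq [OF E] op_simps)
    finally show ?thesis .
  qed
  ultimately show "opart (J \<times> I) G"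
    using P E comm unfolding opart_def by (auto simp: G_def projM_comp)
qed

text \<open>Spectral projections of \<open>T\<close> commute with whatever commutes with \<open>T\<close>, hence with \<open>T\<close> and
  with each other.\<close>

definition bicommutes :: "'h op \<Rightarrow> 'h op \<Rightarrow> bool" where
  "bicommutes T A \<longleftrightarrow> (\<forall>C. C o\<^sub>L T = T o\<^sub>L C \<longrightarrow> C o\<^sub>L A = A o\<^sub>L C)"

lemma bicommutesD: "bicommutes T A \<Longrightarrow> C o\<^sub>L T = T o\<^sub>L C \<Longrightarrow> C o\<^sub>L A = A o\<^sub>L C"
  by (simp add: bicommutes_def)

text \<open>The spectral subspaces of the intervals of length \<open>e\<close> are split off one by one, starting from the top.\<close>

lemma spectral_partition:
  assumes T: "T \<in> M" "positive_op T" and e: "0 < e"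
    and F: "projM F" "bicommutes T F"
      "\<And>x. F x = x \<Longrightarrow> rip (T x) x \<le> real (Suc m) * e * (norm x)\<^sup>2"
  shows "\<exists>P. (\<forall>k\<le>m. projM (P k) \<and> bicommutes T (P k) \<and>
        (\<forall>x. P k x = x \<longrightarrow> real k * e * (norm x)\<^sup>2 \<le> rip (T x) x
              \<and> rip (T x) x \<le> real (Suc k) * e * (norm x)\<^sup>2)) \<and>
      (\<forall>i\<le>m. \<forall>j\<le>m. i \<noteq> j \<longrightarrow> P i o\<^sub>L P j = 0) \<and> (\<Sum>k\<le>m. P k) = F"
  using F
proof (induction m arbitrary: F)
  case 0
  then show ?case
    using positiveD [OF T(2)] by (intro exI [of _ "\<lambda>_. F"]) auto
next
  case (Suc m)
  note F = Suc.prems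
  obtain E where E: "projM E" "\<And>C. C o\<^sub>L T = T o\<^sub>L C \<Longrightarrow> C o\<^sub>L E = E o\<^sub>L C"
    "\<And>x. E x = x \<Longrightarrow> (real (Suc m) * e) * (norm x)\<^sup>2 \<le> rip (T x) x"
    "\<And>x. E x = 0 \<Longrightarrow> rip (T x) x \<le> (real (Suc m) * e) * (norm x)\<^sup>2"
    using T(1) positive_self_adjoint [OF T(2)] by (rule spectral_split) (rule that)
  have FE: "F o\<^sub>L E = E o\<^sub>L F"
    by (rule E(2) [OF bicommutesD [OF F(2) refl, symmetric]])
  have EF: "projM (E o\<^sub>L F)"
    using projM_comp [OF E(1) F(1)] FE by simp
  have F': "projM (F - (E o\<^sub>L F))"
  proof -
    have "projM ((id_blinfun - E) o\<^sub>L F)"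
      using FE by (intro projM_comp projM_complement E F) (simp add: op_simps)
    then show ?thesis by (simp add: op_simps)
  qed
  define F' where "F' = F - (E o\<^sub>L F)"
  have commEF: "C o\<^sub>L (E o\<^sub>L F) = (E o\<^sub>L F) o\<^sub>L C" if "C o\<^sub>L T = T o\<^sub>L C" for C
    by (rule commute_comp [OF E(2) [OF that] bicommutesD [OF F(2) that]])
  have "\<exists>P. (\<forall>k\<le>m. projM (P k) \<and> bicommutes T (P k) \<and>
        (\<forall>x. P k x = x \<longrightarrow> real k * e * (norm x)\<^sup>2 \<le> rip (T x) x
              \<and> rip (T x) x \<le> real (Suc k) * e * (norm x)\<^sup>2)) \<and>
      (\<forall>i\<le>m. \<forall>j\<le>m. i \<noteq> j \<longrightarrow> P i o\<^sub>L P j = 0) \<and> (\<Sum>k\<le>m. P k) = F'"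
  proof (rule Suc.IH)
    show "projM F'" using F' by (simp add: F'_def)
    have "C o\<^sub>L F' = F' o\<^sub>L C" if "C o\<^sub>L T = T o\<^sub>L C" for C
      using commEF [OF that] bicommutesD [OF F(2) that]
      by (simp only: F'_def bounded_bilinear.diff_left [OF bounded_bilinear_blinfun_compose]
        bounded_bilinear.diff_right [OF bounded_bilinear_blinfun_compose])
    then show "bicommutes T F'" by (simp only: bicommutes_def) blast
    show "rip (T x) x \<le> real (Suc m) * e * (norm x)\<^sup>2" if "F' x = x" for x
    proof (rule E(4))
      have "E (F' x) = 0"
        by (simp add: F'_def blinfun.diff_left blinfun.diff_right projM_D(5) [OF E(1)])
      then show "E x = 0" using that by simp
    qed
  qed
  then obtain P where P: "\<And>k. k \<le> m \<Longrightarrow> projM (P k)"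
      "\<And>k. k \<le> m \<Longrightarrow> bicommutes T (P k)"
      "\<And>k x. k \<le> m \<Longrightarrow> P k x = x \<Longrightarrow> real k * e * (norm x)\<^sup>2 \<le> rip (T x) x
              \<and> rip (T x) x \<le> real (Suc k) * e * (norm x)\<^sup>2"
      "\<And>i j. i \<le> m \<Longrightarrow> j \<le> m \<Longrightarrow> i \<noteq> j \<Longrightarrow> P i o\<^sub>L P j = 0" "(\<Sum>k\<le>m. P k) = F'"
    by blast
  have EF': "(E o\<^sub>L F) o\<^sub>L F' = 0" "F' o\<^sub>L (E o\<^sub>L F) = 0"
    by (rule blinfun_eqI, simp add: F'_def blinfun.diff_left blinfun.diff_right
        projM_D(5) [OF E(1)] projM_D(5) [OF F(1)] comm_apply [OF FE])+
  have F'P: "F' o\<^sub>L P k = P k" "P k o\<^sub>L F' = P k" if "k \<le> m" for k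
  proof -
    have "F' o\<^sub>L P k = (\<Sum>i\<le>m. if i = k then P k else 0)"
      unfolding P(5) [symmetric] comp_sum_left using P(1,4) that
      by (intro sum.cong) (auto simp: projM_D(4))
    then show "F' o\<^sub>L P k = P k" using that by simp
    have "P k o\<^sub>L F' = (\<Sum>i\<le>m. if i = k then P k else 0)"
      unfolding P(5) [symmetric] comp_sum_right using P(1,4) that
      by (intro sum.cong) (auto simp: projM_D(4))
    then show "P k o\<^sub>L F' = P k" using that by simp
  qed
  have orth: "(E o\<^sub>L F) o\<^sub>L P k = 0" "P k o\<^sub>L (E o\<^sub>L F) = 0" if "k \<le> m" for k
  proof -
    have "(E o\<^sub>L F) (F' (P k x)) = 0" for x
      using comp_eq_apply [OF EF'(1), of "P k x"] by simp
    then show "(E o\<^sub>L F) o\<^sub>L P k = 0"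
      unfolding comp_eq_apply [OF F'P(1) [OF that]] by (intro blinfun_eqI) simp
    have "P k (F' ((E o\<^sub>L F) x)) = 0" for x
      unfolding comp_eq_apply [OF EF'(2)] by (simp add: blinfun.zero_right)
    then show "P k o\<^sub>L (E o\<^sub>L F) = 0"
      unfolding comp_eq_apply [OF F'P(2) [OF that]] by (intro blinfun_eqI) simp
  qed
  define P' where "P' = P(Suc m := E o\<^sub>L F)"
  have bound: "real (Suc m) * e * (norm x)\<^sup>2 \<le> rip (T x) x"
    "rip (T x) x \<le> real (Suc (Suc m)) * e * (norm x)\<^sup>2" if "(E o\<^sub>L F) x = x" for x
  proof -
    have "E x = x" "F x = x"
      using that projM_D(5) [OF E(1), of "F x"] projM_D(5) [OF F(1), of "E x"] comm_apply [OF FE, of x]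
      by auto
    then show "real (Suc m) * e * (norm x)\<^sup>2 \<le> rip (T x) x"
      "rip (T x) x \<le> real (Suc (Suc m)) * e * (norm x)\<^sup>2"
      using E(3) F(3) by blast+
  qed
  have sum: "(\<Sum>k\<le>Suc m. P' k) = F"
  proof -
    have "(\<Sum>k\<le>m. P' k) = (\<Sum>k\<le>m. P k)"
      by (rule sum.cong) (auto simp: P'_def)
    then show ?thesis by (simp add: P(5)) (simp add: P'_def F'_def)
  qed
  have top: "P' (Suc m) = (E o\<^sub>L F)" and low: "k \<le> m \<Longrightarrow> P' k = P k" for k
    by (auto simp: P'_def)
  have "bicommutes T (E o\<^sub>L F)"
    unfolding bicommutes_def using commEF by blast
  then have 1: "projM (P' k)" "bicommutes T (P' k)" if "k \<le> Suc m" for k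
    using that EF P(1,2) top low by (metis le_Suc_eq)+
  have 2: "real k * e * (norm x)\<^sup>2 \<le> rip (T x) x \<and> rip (T x) x \<le> real (Suc k) * e * (norm x)\<^sup>2"
    if "k \<le> Suc m" "P' k x = x" for k x
    using that bound P(3) top low by (metis le_Suc_eq)
  have 3: "P' i o\<^sub>L P' j = 0" if "i \<le> Suc m" "j \<le> Suc m" "i \<noteq> j" for i j
    using that P(4) orth top low by (metis le_Suc_eq)
  have "\<forall>k\<le>Suc m. projM (P' k) \<and> bicommutes T (P' k) \<and>
        (\<forall>x. P' k x = x \<longrightarrow> real k * e * (norm x)\<^sup>2 \<le> rip (T x) x
              \<and> rip (T x) x \<le> real (Suc k) * e * (norm x)\<^sup>2)"
  proof (intro allI impI conjI)
    fix k assume "k \<le> Suc m"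
    note 1 [OF this] and 2 [OF this]
    then show "projM (P' k)" "bicommutes T (P' k)"
      and "P' k x = x \<Longrightarrow> real k * e * (norm x)\<^sup>2 \<le> rip (T x) x"
      and "P' k x = x \<Longrightarrow> rip (T x) x \<le> real (Suc k) * e * (norm x)\<^sup>2" for x
      by - (assumption | elim conjunct1 conjunct2 | blast)+
  qed
  moreover have "\<forall>i\<le>Suc m. \<forall>j\<le>Suc m. i \<noteq> j \<longrightarrow> P' i o\<^sub>L P' j = 0"
    by (intro allI impI) (rule 3)
  ultimately show ?case
    using sum by (intro exI [of _ P'] conjI)
qed

text \<open>On the spectral subspace of an interval of length \<open>e\<close> the operator differs from the left end point by at
  most \<open>e\<close>. The partition is renumbered from the top, since s-numbers are decreasing.\<close>

lemma simple_approximation: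
  assumes T: "T \<in> M" "positive_op T" and e: "0 < e"
  obtains n :: nat and P a where "opart {..<n} P" "\<And>j. 0 \<le> a j"
    "\<And>i j. i \<le> j \<Longrightarrow> j < n \<Longrightarrow> a j \<le> a i"
    "\<And>k. k < n \<Longrightarrow> bicommutes T (P k)"
    "norm (T - simple_op {..<n} P a) \<le> e"
proof -
  obtain m :: nat where "norm T / e \<le> real m" using real_arch_simple by blast
  then have m: "norm T \<le> real (Suc m) * e"
    using e by (simp add: divide_le_eq algebra_simps)
  have bound: "rip (T x) x \<le> real (Suc m) * e * (norm x)\<^sup>2" for x
  proof -
    have "rip (T x) x \<le> norm (T x) * norm x" by (rule rip_le)
    also have "\<dots> \<le> (norm T * norm x) * norm x"
      by (intro mult_right_mono norm_blinfun) simp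
    also have "\<dots> \<le> (real (Suc m) * e * norm x) * norm x"
      by (intro mult_right_mono m) simp_all
    finally show ?thesis by (simp add: power2_eq_square mult.assoc)
  qed
  have bic: "bicommutes T id_blinfun"
    by (simp only: bicommutes_def comp_id_left comp_id_right simp_thms)
  have "\<exists>P. (\<forall>k\<le>m. projM (P k) \<and> bicommutes T (P k) \<and>
        (\<forall>x. P k x = x \<longrightarrow> real k * e * (norm x)\<^sup>2 \<le> rip (T x) x
              \<and> rip (T x) x \<le> real (Suc k) * e * (norm x)\<^sup>2)) \<and>
      (\<forall>i\<le>m. \<forall>j\<le>m. i \<noteq> j \<longrightarrow> P i o\<^sub>L P j = 0) \<and> (\<Sum>k\<le>m. P k) = id_blinfun"
    by (rule spectral_partition [OF T e projM_id bic]) (rule bound)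
  then obtain P where P0: "\<forall>k\<le>m. projM (P k) \<and> bicommutes T (P k) \<and>
        (\<forall>x. P k x = x \<longrightarrow> real k * e * (norm x)\<^sup>2 \<le> rip (T x) x
              \<and> rip (T x) x \<le> real (Suc k) * e * (norm x)\<^sup>2)"
      "\<forall>i\<le>m. \<forall>j\<le>m. i \<noteq> j \<longrightarrow> P i o\<^sub>L P j = 0" "(\<Sum>k\<le>m. P k) = id_blinfun"
    by (elim exE conjE) (rule that)
  note P = P0(1) [rule_format, THEN conjunct1]
    P0(1) [rule_format, THEN conjunct2, THEN conjunct1]
    P0(1) [rule_format, THEN conjunct2, THEN conjunct2, rule_format]
    P0(2) [rule_format] P0(3)
  define Q where "Q k = P (m - k)" for k
  define a where "a k = real (m - k) * e" for k
  have sumQ: "(\<Sum>k<Suc m. Q k) = id_blinfun"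
    using sum.nat_diff_reindex [of P "Suc m"] P(5) by (simp add: Q_def lessThan_Suc_atMost)
  have part: "opart {..<Suc m} Q"
    unfolding opart_def using P(1,4) sumQ by (auto simp: Q_def)
  have "norm (T - simple_op {..<Suc m} Q a) \<le> e"
  proof (rule norm_le_numerical_radius)
    show "self_adjoint_op (T - simple_op {..<Suc m} Q a)"
      by (intro self_adjoint_diff positive_self_adjoint T simple_op_self_adjoint part)
    show "0 \<le> e" using e by simp
    fix x
    have TQ: "Q k (T x) = T (Q k x)" for k
      using comm_apply [OF bicommutesD [OF P(2) refl, symmetric], of "m - k" x] by (simp add: Q_def)
    have "rip (T x) x = rip (T x) (\<Sum>k<Suc m. Q k x)"
      by (simp only: opart_apply_sum [OF part])
    also have "\<dots> = (\<Sum>k<Suc m. rip (T x) (Q k x))"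
      by (rule rip_sum_right)
    also have "\<dots> = (\<Sum>k<Suc m. rip (T (Q k x)) (Q k x))"
      using projM_D(5,6) [OF opartD(2) [OF part]]
      by (intro sum.cong refl) (metis TQ)
    finally have rT: "rip (T x) x = (\<Sum>k<Suc m. rip (T (Q k x)) (Q k x))" .
    have diff: "rip ((T - simple_op {..<Suc m} Q a) x) x
        = (\<Sum>k<Suc m. rip (T (Q k x)) (Q k x) - a k * (norm (Q k x))\<^sup>2)"
      unfolding blinfun.diff_left rip_diff_left rT rip_simple_op [OF part] sum_subtractf ..
    have bnd: "0 \<le> rip (T (Q k x)) (Q k x) - a k * (norm (Q k x))\<^sup>2 \<and>
        rip (T (Q k x)) (Q k x) - a k * (norm (Q k x))\<^sup>2 \<le> e * (norm (Q k x))\<^sup>2" if "k < Suc m" for k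
      using P(3) [of "m - k" "Q k x"] projM_D(5) [OF P(1) [of "m - k"], of x]
      by (simp add: Q_def a_def algebra_simps)
    have "(\<Sum>k<Suc m. rip (T (Q k x)) (Q k x) - a k * (norm (Q k x))\<^sup>2) \<le> (\<Sum>k<Suc m. e * (norm (Q k x))\<^sup>2)"
      using bnd by (intro sum_mono) auto
    also have "\<dots> = e * (norm x)\<^sup>2"
      by (simp only: opart_norm_sq [OF part, of x] sum_distrib_left)
    moreover have "0 \<le> (\<Sum>k<Suc m. rip (T (Q k x)) (Q k x) - a k * (norm (Q k x))\<^sup>2)"
      using bnd by (intro sum_nonneg) auto
    ultimately show "\<bar>rip ((T - simple_op {..<Suc m} Q a) x) x\<bar> \<le> e * (norm x)\<^sup>2"
      unfolding diff by linarith
  qed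
  moreover have "0 \<le> a k" "i \<le> j \<Longrightarrow> a j \<le> a i" for k i j
    using e by (auto simp: a_def intro!: mult_right_mono)
  moreover have "bicommutes T (Q k)" for k
    unfolding Q_def by (rule P(2)) simp
  ultimately show ?thesis using part by (intro that) auto
qed

end


context finite_vna
begin

section \<open>The trace\<close>

definition tr :: "'h op \<Rightarrow> real" where "tr X = Re (\<tau> X)"

lemma state: "state_on M \<tau>"
  and tracial: "tracial_on M \<tau>"
  and faithful: "faithful_on M \<tau>"
  and normal: "normal_on M \<tau>"
  using finite_vna by (auto simp: finite_von_neumann_algebra_def)

lemma tau_add: "S \<in> M \<Longrightarrow> T \<in> M \<Longrightarrow> \<tau> (S + T) = \<tau> S + \<tau> T"
  and tau_scaleC: "T \<in> M \<Longrightarrow> \<tau> (scaleC_op c T) = c * \<tau> T"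
  and tau_positive: "T \<in> M \<Longrightarrow> positive_op T \<Longrightarrow> \<tau> T \<in> \<real>\<^sub>\<ge>\<^sub>0"
  and tau_id: "\<tau> id_blinfun = 1"
  using state by (simp_all add: state_on_def)

lemma tau_comm: "S \<in> M \<Longrightarrow> T \<in> M \<Longrightarrow> \<tau> (S o\<^sub>L T) = \<tau> (T o\<^sub>L S)"
  using tracial by (simp add: tracial_on_def)

lemma tau_scaleR: "T \<in> M \<Longrightarrow> \<tau> (r *\<^sub>R T) = of_real r * \<tau> T"
  using tau_scaleC [of T "of_real r"] by (simp add: scaleC_op_of_real)

lemma tr_add: "S \<in> M \<Longrightarrow> T \<in> M \<Longrightarrow> tr (S + T) = tr S + tr T"
  by (simp add: tr_def tau_add)

lemma tr_scaleR: "T \<in> M \<Longrightarrow> tr (r *\<^sub>R T) = r * tr T"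
  by (simp add: tr_def tau_scaleR)

lemma tr_diff: "S \<in> M \<Longrightarrow> T \<in> M \<Longrightarrow> tr (S - T) = tr S - tr T"
  using tr_add [of S "(-1) *\<^sub>R T"] tr_scaleR [of T "-1"] M_scaleR [of T "-1"] by simp

lemma tr_zero: "tr 0 = 0"
  using tr_scaleR [OF M_zero, of 0] by simp

lemma tr_sum: "(\<And>i. i \<in> I \<Longrightarrow> f i \<in> M) \<Longrightarrow> tr (sum f I) = (\<Sum>i\<in>I. tr (f i))"
  by (induction I rule: infinite_finite_induct) (auto simp: tr_zero tr_add M_sum)

lemma tr_id: "tr id_blinfun = 1"
  by (simp add: tr_def tau_id)

lemma tr_positive: "T \<in> M \<Longrightarrow> positive_op T \<Longrightarrow> 0 \<le> tr T"
  using tau_positive by (auto simp: tr_def complex_nonneg_Reals_iff)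

lemma tau_eq_tr: "T \<in> M \<Longrightarrow> positive_op T \<Longrightarrow> \<tau> T = of_real (tr T)"
  using tau_positive by (auto simp: tr_def complex_nonneg_Reals_iff complex_eq_iff)

lemma tr_comm: "S \<in> M \<Longrightarrow> T \<in> M \<Longrightarrow> tr (S o\<^sub>L T) = tr (T o\<^sub>L S)"
  by (simp add: tr_def tau_comm)

lemma tr_faithful:
  assumes "T \<in> M" "self_adjoint_op T" "tr (T o\<^sub>L T) = 0"
  shows "T = 0"
  using assms faithful tau_eq_tr [OF M_comp [OF assms(1,1)] positive_square [OF assms(2)]]
  by (simp add: faithful_on_def adj_self_adjoint)

lemma rip_apply_le: "rip (blinfun_apply X x) x \<le> norm X * (norm x)\<^sup>2"
proof -
  have "rip (X x) x \<le> norm (X x) * norm x" by (rule rip_le)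
  also have "\<dots> \<le> (norm X * norm x) * norm x"
    by (intro mult_right_mono norm_blinfun) simp
  finally show ?thesis by (simp add: power2_eq_square mult.assoc)
qed

lemma tr_le_norm:
  assumes "X \<in> M" "self_adjoint_op X"
  shows "tr X \<le> norm X"
proof -
  have "positive_op ((norm X *\<^sub>R id_blinfun) - X)"
    using assms rip_apply_le [of X]
    by (auto simp: positive_iff self_adjoint_diff self_adjoint_scaleR self_adjoint_id
        blinfun.diff_left blinfun.scaleR_left rip_simps rip_self)
  then have "0 \<le> tr ((norm X *\<^sub>R id_blinfun) - X)"
    using assms by (intro tr_positive) (simp_all add: M_diff M_scaleR M_id)
  then show ?thesis
    using assms by (simp add: tr_diff tr_scaleR M_scaleR M_id tr_id)
qed

lemma tr_projM_nonneg: "projM E \<Longrightarrow> 0 \<le> tr E"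
  by (simp add: tr_positive projM_D(1) projM_positive)

lemma tr_projM_zero: "projM E \<Longrightarrow> tr E = 0 \<Longrightarrow> E = 0"
  by (rule tr_faithful) (simp_all add: projM_D(1,3,4))

lemma tr_projM_pos: "projM E \<Longrightarrow> E \<noteq> 0 \<Longrightarrow> 0 < tr E"
  using tr_projM_nonneg tr_projM_zero by fastforce

lemma tr_complement: "projM E \<Longrightarrow> tr (id_blinfun - E) = 1 - tr E"
  by (simp add: tr_diff M_id projM_D(1) tr_id)

lemma tr_projM_le_1: "projM E \<Longrightarrow> tr E \<le> 1"
  using tr_complement tr_projM_nonneg [OF projM_complement] by fastforce

text \<open>The order of projections, phrased algebraically.\<close>

definition subproj :: "'h op \<Rightarrow> 'h op \<Rightarrow> bool" where
  "subproj P Q \<longleftrightarrow> projM P \<and> projM Q \<and> P o\<^sub>L Q = P \<and> Q o\<^sub>L P = P"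

lemma subprojI:
  assumes "projM P" "projM Q" "Q o\<^sub>L P = P"
  shows "subproj P Q"
proof -
  have "adj (Q o\<^sub>L P) = P o\<^sub>L Q"
    using assms(1,2) by (simp add: adj_comp M_bounded_ops projM_D(1) adj_self_adjoint projM_D(3))
  then show ?thesis
    using assms by (simp add: subproj_def adj_self_adjoint projM_D(3))
qed

lemma subprojD:
  assumes "subproj P Q"
  shows "projM P" "projM Q" "P o\<^sub>L Q = P" "Q o\<^sub>L P = P"
  using assms by (auto simp: subproj_def)

lemma subproj_diff:
  assumes "subproj P Q"
  shows "projM (Q - P)" "subproj (Q - P) Q" "tr (Q - P) = tr Q - tr P"
proof -
  note D = subprojD [OF assms]
  show 1: "projM (Q - P)"
    by (rule projM_I) (simp_all add: M_diff self_adjoint_diff projM_D(1,3) D op_simps projM_D(4))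
  show "subproj (Q - P) Q"
    by (rule subprojI [OF 1 D(2)]) (simp add: op_simps projM_D(4) D)
  show "tr (Q - P) = tr Q - tr P"
    by (simp add: tr_diff projM_D(1) D)
qed

lemma subproj_tr_mono: "subproj P Q \<Longrightarrow> tr P \<le> tr Q"
  using subproj_diff tr_projM_nonneg by fastforce

lemma subproj_tr_eq: "subproj P Q \<Longrightarrow> tr P = tr Q \<Longrightarrow> P = Q"
  using subproj_diff(1,3) tr_projM_zero by fastforce

lemma subproj_refl: "projM P \<Longrightarrow> subproj P P"
  by (simp add: subproj_def projM_D(4))

lemma subproj_zero: "projM P \<Longrightarrow> subproj 0 P"
  by (simp add: subproj_def projM_zero op_simps)

lemma subproj_id: "projM P \<Longrightarrow> subproj P id_blinfun"
  by (simp add: subproj_def projM_id op_simps)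

lemma subproj_trans:
  assumes "subproj P Q" "subproj Q R" shows "subproj P R"
proof (rule subprojI)
  have "R o\<^sub>L (Q o\<^sub>L P) = Q o\<^sub>L P"
    unfolding comp_assoc_blinfun [symmetric] subprojD(4) [OF assms(2)] ..
  then show "R o\<^sub>L P = P" by (simp add: subprojD(4) [OF assms(1)])
qed (use assms in \<open>auto simp: subproj_def\<close>)

lemma orth_add:
  assumes "projM P" "projM Q" "P o\<^sub>L Q = 0"
  shows "projM (P + Q)" "subproj P (P + Q)" "subproj Q (P + Q)" "tr (P + Q) = tr P + tr Q" "Q o\<^sub>L P = 0"
proof -
  have "adj (P o\<^sub>L Q) = Q o\<^sub>L P"
    using assms(1,2) by (simp add: adj_comp M_bounded_ops projM_D(1) adj_self_adjoint projM_D(3))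
  then show QP: "Q o\<^sub>L P = 0"
    using assms(3) by (simp add: adj_self_adjoint [OF self_adjoint_zero])
  show 1: "projM (P + Q)"
    by (rule projM_I) (simp_all add: M_add self_adjoint_add projM_D(1,3) assms op_simps projM_D(4) QP)
  show "subproj P (P + Q)" "subproj Q (P + Q)"
    using assms 1 QP by (simp_all add: subproj_def op_simps projM_D(4))
  show "tr (P + Q) = tr P + tr Q"
    by (simp add: tr_add projM_D(1) assms)
qed

lemma opart_tr_power:
  assumes "opart J G"
  shows "\<tau> (op_power (simple_op J G a) n) = (\<Sum>j\<in>J. of_real (a j ^ n) * of_real (tr (G j)))"
proof -
  have "\<tau> (\<Sum>j\<in>I. f j *\<^sub>R G j) = (\<Sum>j\<in>I. of_real (f j) * of_real (tr (G j)))"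
    if "I \<subseteq> J" for I f
  proof -
    have "finite I" using that opartD(1) [OF assms] finite_subset by blast
    then show ?thesis
      using that
    proof (induction I)
      case empty
      show ?case using tau_scaleR [OF M_zero, of 0] by simp
    next
      case (insert j I)
      then have j: "projM (G j)" using opartD(2) [OF assms] by blast
      have "(\<Sum>j\<in>I. f j *\<^sub>R G j) \<in> M"
        using insert opartD(2) [OF assms] by (intro M_sum M_scaleR projM_D) blast
      then show ?case
        using insert j by (simp add: tau_add M_scaleR projM_D(1) tau_scaleR tau_eq_tr projM_positive)
    qed
  qed
  from this [OF order_refl, of "\<lambda>j. a j ^ n"] show ?thesis
    unfolding op_power_simple [OF assms] by (simp only: simple_op_def)
qed

section \<open>Comparison of projections\<close>

lemma op_power_M: "X \<in> M \<Longrightarrow> op_power X n \<in> M"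
  by (induction n) (simp_all add: op_power_0 op_power_Suc M_id M_comp)

lemma op_power_commute: "C o\<^sub>L X = X o\<^sub>L C \<Longrightarrow> C o\<^sub>L op_power X n = op_power X n o\<^sub>L C"
proof (induction n)
  case (Suc n)
  then show ?case by (simp only: op_power_Suc commute_comp)
qed (simp add: op_power_0 op_simps)

lemma op_power_self_adjoint: "self_adjoint_op X \<Longrightarrow> self_adjoint_op (op_power X n)"
  by (induction n)
    (auto simp: op_power_0 op_power_Suc self_adjoint_id intro!: self_adjoint_comp op_power_commute)

lemma op_power_add: "op_power X (m + n) = op_power X m o\<^sub>L op_power X n"
  by (induction m) (simp_all add: op_power_0 op_power_Suc op_simps)

lemma norm_op_power: "norm (op_power X (Suc n)) \<le> norm X ^ Suc n"
proof (induction n)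
  case (Suc n)
  have "norm (op_power X (Suc (Suc n))) \<le> norm X * norm (op_power X (Suc n))"
    unfolding op_power_Suc [of X "Suc n"] by (rule norm_blinfun_compose)
  also have "\<dots> \<le> norm X * norm X ^ Suc n"
    using Suc by (intro mult_left_mono) auto
  finally show ?case by simp
qed (simp add: op_power_0 op_power_Suc op_simps)

text \<open>This replaces the parallelogram law of projections and needs only polynomials. With \<open>H = F E\<close>
  one has \<open>E (1 - H)\<^sup>m = (E (1 - F) E)\<^sup>m\<close> and
  \<open>(1 - H)\<^sup>m F = (F (1 - E) F)\<^sup>m\<close>, while \<open>1 - (1 - H)\<^sup>m\<close> is absorbed by \<open>F\<close> on the left and by \<open>E\<close>
  on the right, so that the trace property gives
  \<open>\<tau> E - \<tau> ((E (1 - F) E)\<^sup>m) = \<tau> F - \<tau> ((F (1 - E) F)\<^sup>m)\<close>. For even \<open>m\<close> the last term is nonnegative,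
  and the second one tends to \<open>0\<close>.\<close>

lemma tr_le_of_norm_less:
  assumes E: "projM E" and F: "projM F" and less: "norm ((id_blinfun - F) o\<^sub>L E) < 1"
  shows "tr E \<le> tr F"
proof -
  define H where "H = F o\<^sub>L E"
  define L where "L = id_blinfun - H"
  define X where "X = E o\<^sub>L ((id_blinfun - F) o\<^sub>L E)"
  define W where "W = F o\<^sub>L ((id_blinfun - E) o\<^sub>L F)"
  define K where "K m = op_power L m" for m
  define R where "R m = id_blinfun - K m" for m
  have EM: "E \<in> M" and FM: "F \<in> M" using E F by (simp_all add: projM_D(1))
  have HM: "H \<in> M" and LM: "L \<in> M" using EM FM by (simp_all add: H_def L_def M_comp M_diff M_id)
  have XM: "X \<in> M" and WM: "W \<in> M"
    unfolding X_def W_def by (intro M_comp M_diff M_id EM FM)+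
  have saX: "self_adjoint_op X" "self_adjoint_op W"
    unfolding X_def W_def
    by (intro self_adjoint_conj self_adjoint_diff self_adjoint_id projM_D(3) E F)+
  have KM: "K m \<in> M" and RM: "R m \<in> M" for m
    by (simp_all add: K_def R_def op_power_M LM M_diff M_id)
  have EE: "E (E x) = E x" "F (F x) = F x" for x
    using E F by (simp_all add: projM_D(5))
  have KL: "K (Suc m) = L o\<^sub>L K m" "K (Suc m) = K m o\<^sub>L L" for m
    using op_power_commute [of L L m] by (simp_all add: K_def op_power_Suc)
  have RE: "R m o\<^sub>L E = R m" and FR: "F o\<^sub>L R m = R m" for m
  proof -
    show "R m o\<^sub>L E = R m"
    proof (induction m)
      case (Suc m)
      have "R (Suc m) = R m + (K m o\<^sub>L H)" by (simp add: R_def KL(2) L_def op_simps)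
      moreover have "H o\<^sub>L E = H" by (rule blinfun_eqI) (simp add: H_def EE)
      ultimately show ?case using Suc by (simp add: op_simps)
    qed (simp add: R_def K_def op_power_0 op_simps)
    show "F o\<^sub>L R m = R m"
    proof (induction m)
      case (Suc m)
      have "R (Suc m) = R m + (H o\<^sub>L K m)" by (simp add: R_def KL(1) L_def op_simps)
      moreover have "F o\<^sub>L (H o\<^sub>L K m) = H o\<^sub>L K m" by (rule blinfun_eqI) (simp add: H_def EE)
      ultimately show ?case using Suc by (simp add: bounded_bilinear.add_right [OF bounded_bilinear_blinfun_compose])
    qed (simp add: R_def K_def op_power_0 op_simps)
  qed
  have EK: "E o\<^sub>L K m = E o\<^sub>L op_power X m" for m
  proof (induction m)
    case (Suc m)
    have "E o\<^sub>L K (Suc m) = X o\<^sub>L (E o\<^sub>L K m)"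
    proof (rule blinfun_eqI)
      fix x
      show "(E o\<^sub>L K (Suc m)) x = (X o\<^sub>L (E o\<^sub>L K m)) x"
        by (simp add: KL(1) L_def H_def X_def blinfun.diff_left blinfun.diff_right EE)
    qed
    also have "\<dots> = X o\<^sub>L (E o\<^sub>L op_power X m)" by (simp only: Suc)
    also have "\<dots> = E o\<^sub>L op_power X (Suc m)"
      by (rule blinfun_eqI) (simp add: op_power_Suc X_def blinfun.diff_left blinfun.diff_right EE)
    finally show ?case .
  qed (simp add: K_def op_power_0)
  have KF: "K m o\<^sub>L F = F o\<^sub>L op_power W m" for m
  proof (induction m)
    case (Suc m)
    have "L o\<^sub>L F = F o\<^sub>L W"
      by (rule blinfun_eqI) (simp add: L_def H_def W_def blinfun.diff_left blinfun.diff_right EE)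
    then have "K (Suc m) o\<^sub>L F = (K m o\<^sub>L F) o\<^sub>L W"
      by (simp add: KL(2) comp_assoc_blinfun)
    also have "\<dots> = F o\<^sub>L (op_power W m o\<^sub>L W)" by (simp add: Suc comp_assoc_blinfun)
    also have "\<dots> = F o\<^sub>L op_power W (Suc m)"
      using op_power_commute [of W W m] by (simp add: op_power_Suc)
    finally show ?case .
  qed (simp add: K_def op_power_0 op_simps)
  have EX: "E o\<^sub>L op_power X (Suc m) = op_power X (Suc m)"
    and FW: "F o\<^sub>L op_power W (Suc m) = op_power W (Suc m)" for m
    by (rule blinfun_eqI, simp add: op_power_Suc X_def W_def EE)+
  have eq: "tr E - tr (E o\<^sub>L K m) = tr F - tr (K m o\<^sub>L F)" for m
  proof -
    have "tr E - tr (E o\<^sub>L K m) = tr (E o\<^sub>L R m)"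
      by (simp add: R_def op_simps tr_diff EM M_comp KM)
    also have "\<dots> = tr (R m)"
      using tr_comm [OF EM RM] RE by simp
    also have "\<dots> = tr (R m o\<^sub>L F)"
      using tr_comm [OF FM RM] FR by simp
    also have "\<dots> = tr F - tr (K m o\<^sub>L F)"
      by (simp add: R_def op_simps tr_diff FM M_comp KM)
    finally show ?thesis .
  qed
  define r where "r = norm X"
  have r: "0 \<le> r" "r < 1"
  proof -
    have "norm X \<le> norm E * norm ((id_blinfun - F) o\<^sub>L E)"
      unfolding X_def by (rule norm_blinfun_compose)
    also have "\<dots> \<le> 1 * norm ((id_blinfun - F) o\<^sub>L E)"
      using norm_projM_le [OF E] by (intro mult_right_mono) auto
    finally show "r < 1" using less by (simp add: r_def)
  qed (simp add: r_def)
  have bound: "tr E - r ^ Suc (Suc (n + n)) \<le> tr F" for n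
  proof -
    let ?m = "Suc (Suc (n + n))"
    have "tr (E o\<^sub>L K ?m) \<le> norm (op_power X ?m)"
      unfolding EK EX by (intro tr_le_norm op_power_M XM op_power_self_adjoint saX)
    also have "\<dots> \<le> r ^ ?m"
      unfolding r_def by (rule norm_op_power)
    finally have "tr (E o\<^sub>L K ?m) \<le> r ^ ?m" .
    moreover have "0 \<le> tr (K ?m o\<^sub>L F)"
    proof -
      have "op_power W ?m = op_power W (Suc n) o\<^sub>L op_power W (Suc n)"
        using op_power_add [of W "Suc n" "Suc n"] by simp
      then show ?thesis
        unfolding KF FW
        by (simp add: tr_positive positive_square op_power_self_adjoint saX M_comp op_power_M WM)
    qed
    ultimately show ?thesis using eq [of ?m] by linarith
  qed
  have "(\<lambda>n. r ^ n) \<longlonglongrightarrow> 0" using r by (intro LIMSEQ_power_zero) simp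
  then have "(\<lambda>n. r ^ Suc (Suc (n + n))) \<longlonglongrightarrow> 0"
    by (rule LIMSEQ_subseq_LIMSEQ [unfolded comp_def]) (simp add: strict_mono_def)
  then have "(\<lambda>n. tr E - r ^ Suc (Suc (n + n))) \<longlonglongrightarrow> tr E - 0"
    by (intro tendsto_diff tendsto_const)
  then show ?thesis
    using bound LIMSEQ_le_const2 by fastforce
qed

text \<open>\<open>\<parallel>Q n x\<parallel>\<^sup>2\<close> increases and is bounded, and its increments are \<open>\<parallel>Q n x - Q m x\<parallel>\<^sup>2\<close>, so the sequence
  converges strongly. Its limit is the least upper bound in \<open>M\<close>, and normality gives the trace.\<close>

lemma projM_sequence_sup:
  assumes inc: "\<And>n. subproj (Q n) (Q (Suc n))" and le: "\<And>n. subproj (Q n) P"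
  obtains S where "projM S" "\<And>n. subproj (Q n) S" "subproj S P" "(\<lambda>n. tr (Q n)) \<longlonglongrightarrow> tr S"
proof -
  have Q: "projM (Q n)" for n using inc subprojD by blast
  have mono: "subproj (Q m) (Q n)" if "m \<le> n" for m n
    using that by (induction n rule: dec_induct) (auto intro: subproj_refl Q subproj_trans inc)
  have QQ: "Q m (Q n x) = Q m x" "Q n (Q m x) = Q m x" if "m \<le> n" for m n x
    using subprojD(3,4) [OF mono [OF that]] comp_eq_apply by blast+
  define g where "g x n = (norm (Q n x))\<^sup>2" for x n
  have dist: "(norm (Q n x - Q m x))\<^sup>2 = g x n - g x m" if "m \<le> n" for m n x
  proof -
    have "rip (Q n x) (Q m x) = rip (Q m x) (Q m x)"
      using QQ [OF that] projM_D(6) [OF Q] by (metis projM_D(5) [OF Q])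
    then show ?thesis by (simp add: norm_diff_sq g_def rip_self)
  qed
  have ginc: "incseq (g x)" for x
  proof (rule incseq_SucI)
    show "g x n \<le> g x (Suc n)" for n
      using dist [of n "Suc n" x] zero_le_power2 [of "norm (Q (Suc n) x - Q n x)"] by simp
  qed
  have nQ: "norm (Q n) \<le> 1" for n using norm_projM_le [OF Q] .
  have gbound: "g x n \<le> (norm x)\<^sup>2" for x n
  proof -
    have "norm (Q n x) \<le> 1 * norm x"
      using nQ order_trans [OF norm_blinfun mult_right_mono] norm_ge_zero by blast
    then show ?thesis by (simp add: g_def power_mono)
  qed
  have Cau: "Cauchy (\<lambda>n. Q n x)" for x
  proof (rule CauchyI)
    fix e :: real assume e: "0 < e"
    have "convergent (g x)"
    proof (rule Bseq_mono_convergent)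
      show "Bseq (g x)" using gbound by (intro BseqI' [where K = "(norm x)\<^sup>2"]) (simp add: g_def)
      show "\<forall>m. \<forall>n\<ge>m. g x m \<le> g x n" using ginc by (simp add: incseq_def)
    qed
    then have "Cauchy (g x)" by (rule convergent_Cauchy)
    then obtain N where N: "\<And>m n. N \<le> m \<Longrightarrow> N \<le> n \<Longrightarrow> \<bar>g x m - g x n\<bar> < e\<^sup>2"
      using CauchyD [of "g x" "e\<^sup>2"] e by auto
    have *: "norm (Q n x - Q m x) < e" if "N \<le> m" "m \<le> n" for m n
    proof -
      have "(norm (Q n x - Q m x))\<^sup>2 < e\<^sup>2"
        unfolding dist [OF that(2)] using N [of n m] that by simp
      then show ?thesis using e by (simp add: power_less_imp_less_base)
    qed
    have "norm (Q m x - Q n x) < e" if "N \<le> m" "N \<le> n" for m n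
      using *[of m n] *[of n m] that by (cases "m \<le> n") (auto simp: norm_minus_commute)
    then show "\<exists>N. \<forall>m\<ge>N. \<forall>n\<ge>N. norm (Q m x - Q n x) < e" by blast
  qed
  obtain S where S: "\<And>x. (\<lambda>n. Q n x) \<longlonglongrightarrow> blinfun_apply S x"
    using pointwise_limit_exists [OF nQ Cau] by blast
  have SM: "S \<in> M" using M_pointwise_limit projM_D(1) [OF Q] S by blast
  have saS: "self_adjoint_op S" using self_adjoint_limit projM_D(3) [OF Q] S by blast
  have lim_Q: "C (S x) = y" if "\<And>n. k \<le> n \<Longrightarrow> C (Q n x) = y" for C :: "'h op" and k x y
  proof -
    have "(\<lambda>n. C (Q n x)) \<longlonglongrightarrow> C (S x)"
      by (intro blinfun.tendsto tendsto_const S)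
    moreover have "(\<lambda>n. C (Q n x)) \<longlonglongrightarrow> y"
      using that by (intro tendsto_eventually eventually_sequentiallyI [of k])
    ultimately show ?thesis by (rule LIMSEQ_unique)
  qed
  have QS: "Q k (S x) = Q k x" for k x
    using QQ(1) by (rule lim_Q)
  have SS: "S (S x) = S x" for x
    using LIMSEQ_unique [OF S [of "S x"]] S [of x] by (simp add: QS)
  have PS: "P (S x) = S x" for x
  proof -
    have "(\<lambda>n. P (Q n x)) \<longlonglongrightarrow> P (S x)"
      by (intro blinfun.tendsto tendsto_const S)
    moreover have "P (Q n x) = Q n x" for n
      using comp_eq_apply [OF subprojD(4) [OF le]] .
    ultimately have "(\<lambda>n. Q n x) \<longlonglongrightarrow> P (S x)" by (simp only:)
    then show ?thesis by (rule LIMSEQ_unique [OF _ S])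
  qed
  have SQ: "S (Q k x) = Q k x" for k x
  proof -
    have "\<forall>\<^sub>F n in sequentially. Q n (Q k x) = Q k x"
      using QQ(2) by (intro eventually_sequentiallyI [of k])
    then have "(\<lambda>n. Q n (Q k x)) \<longlonglongrightarrow> Q k x" by (rule tendsto_eventually)
    then show ?thesis by (rule LIMSEQ_unique [OF S])
  qed
  have pS: "projM S"
    using SS by (intro projM_I SM saS blinfun_eqI) simp
  have sub: "subproj (Q n) S" for n
    using SQ by (intro subprojI Q pS blinfun_eqI) simp
  have subP: "subproj S P"
    using PS subprojD(2) [OF le] by (intro subprojI pS blinfun_eqI) simp_all
  have pos_sub: "positive_op (B - A)" if "subproj A B" for A B
    using projM_positive [OF subproj_diff(1) [OF that]] .
  have "directed_sa M (range Q)"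
    unfolding directed_sa_def
  proof (intro conjI ballI)
    show "range Q \<subseteq> {T \<in> M. self_adjoint_op T}"
      using projM_D(1,3) [OF Q] by auto
    fix A B assume "A \<in> range Q" "B \<in> range Q"
    then obtain m n where "A = Q m" "B = Q n" by auto
    then have "A \<le>\<^sub>o Q (max m n)" "B \<le>\<^sub>o Q (max m n)"
      unfolding loewner_le_def by (auto intro!: pos_sub mono)
    then show "\<exists>C\<in>range Q. A \<le>\<^sub>o C \<and> B \<le>\<^sub>o C" by blast
  qed simp
  moreover have "lub_sa M (range Q) S"
    unfolding lub_sa_def
  proof (intro conjI ballI impI SM saS)
    show "A \<le>\<^sub>o S" if "A \<in> range Q" for A
      using that sub pos_sub by (auto simp: loewner_le_def)
    fix U assume U: "U \<in> M" "self_adjoint_op U" "\<forall>A\<in>range Q. A \<le>\<^sub>o U"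
    have "0 \<le> rip ((U - S) x) x" for x
    proof (rule LIMSEQ_le_const)
      show "(\<lambda>n. rip (U x - Q n x) x) \<longlonglongrightarrow> rip ((U - S) x) x"
        unfolding blinfun.diff_left by (intro tendsto_rip tendsto_diff tendsto_const S)
      have "0 \<le> rip (U x - Q n x) x" for n
        using U(3) positiveD [of "U - Q n" x] by (auto simp: loewner_le_def blinfun.diff_left)
      then show "\<exists>N. \<forall>n\<ge>N. 0 \<le> rip (U x - Q n x) x" by blast
    qed
    then show "S \<le>\<^sub>o U"
      using U saS by (simp add: loewner_le_def positive_iff self_adjoint_diff)
  qed
  ultimately have sup: "tr S = (SUP A\<in>range Q. tr A)"
    using normal unfolding normal_on_def tr_def by blast
  have "(\<lambda>n. tr (Q n)) \<longlonglongrightarrow> (SUP n. tr (Q n))"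
  proof (rule LIMSEQ_incseq_SUP)
    show "bdd_above (range (\<lambda>n. tr (Q n)))"
      using tr_projM_le_1 [OF Q] by (auto intro!: bdd_aboveI [where M = 1])
    show "incseq (\<lambda>n. tr (Q n))"
      using subproj_tr_mono [OF mono] by (simp add: incseq_def)
  qed
  then have "(\<lambda>n. tr (Q n)) \<longlonglongrightarrow> tr S"
    unfolding sup by (simp add: image_image)
  then show ?thesis by (rule that [OF pS sub subP])
qed

end


context finite_vna
begin

section \<open>Minimal projections and the weak Dixmier property\<close>

lemma subproj_extend:
  assumes AB: "subproj A B" and Q: "subproj Q (B - A)"
  shows "subproj A (A + Q)" "subproj (A + Q) B" "tr (A + Q) = tr A + tr Q"
proof -
  note D = subproj_diff [OF AB]
  have "A o\<^sub>L (B - A) = 0"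
    by (simp add: op_simps subprojD(3) [OF AB] projM_D(4) [OF subprojD(1) [OF AB]])
  then have "A ((B - A) (Q x)) = 0" for x
    using comp_eq_apply [of A "B - A" 0] by simp
  then have "A (Q x) = 0" for x
    by (simp only: comp_eq_apply [OF subprojD(4) [OF Q]])
  then have "A o\<^sub>L Q = 0" by (intro blinfun_eqI) simp
  note S = orth_add [OF subprojD(1) [OF AB] subprojD(1) [OF Q] this]
  show "subproj A (A + Q)" "tr (A + Q) = tr A + tr Q" using S by simp_all
  have "subproj Q B" using subproj_trans [OF Q D(2)] .
  then have "B o\<^sub>L (A + Q) = A + Q"
    by (simp add: op_simps subprojD(4) [OF AB] subprojD(4))
  then show "subproj (A + Q) B" by (intro subprojI S(1) subprojD(2) [OF AB])
qed

definition minimal_proj :: "'h op \<Rightarrow> bool" where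
  "minimal_proj E \<longleftrightarrow> projM E \<and> E \<noteq> 0 \<and> (\<forall>Q. subproj Q E \<longrightarrow> Q = 0 \<or> Q = E)"

lemma minimal_projD:
  assumes "minimal_proj E"
  shows "projM E" "E \<noteq> 0" "subproj Q E \<Longrightarrow> Q = 0 \<or> Q = E"
  using assms by (auto simp: minimal_proj_def)

text \<open>If \<open>Q\<close> is not minimal, it has a proper part \<open>R\<close>, and one of \<open>R\<close> and \<open>Q - R\<close> has at most half the trace.\<close>

lemma small_subproj:
  assumes P: "projM P" "P \<noteq> 0" and nomin: "\<And>E. subproj E P \<Longrightarrow> \<not> minimal_proj E" and d: "0 < d"
  obtains Q where "subproj Q P" "Q \<noteq> 0" "tr Q < d"
proof -
  have halving: "\<exists>Q. subproj Q P \<and> Q \<noteq> 0 \<and> tr Q \<le> 1 / 2 ^ n" for n :: nat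
  proof (induction n)
    case 0
    show ?case using P subproj_refl tr_projM_le_1 by (intro exI [of _ P]) simp
  next
    case (Suc n)
    then obtain Q where Q: "subproj Q P" "Q \<noteq> 0" "tr Q \<le> 1 / 2 ^ n" by blast
    have "\<not> minimal_proj Q" using nomin Q by blast
    then obtain R where R: "subproj R Q" "R \<noteq> 0" "R \<noteq> Q"
      using Q subprojD(1) unfolding minimal_proj_def by blast
    note D = subproj_diff [OF R(1)]
    show ?case
    proof (cases "tr R \<le> tr Q / 2")
      case True
      then show ?thesis
        using R Q subproj_trans by (intro exI [of _ R]) auto
    next
      case False
      then have "tr (Q - R) \<le> tr Q / 2" using D(3) by simp
      then show ?thesis
        using R(3) Q D(2) subproj_trans by (intro exI [of _ "Q - R"]) auto
    qed
  qed
  obtain n where "(1/2) ^ n < d" using real_arch_pow_inv [OF d, of "1/2"] by auto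
  then show ?thesis
    using halving [of n] that by (fastforce simp: power_one_over)
qed

text \<open>A greedy increasing sequence of subprojections of trace at most \<open>s\<close>, each step of which gains at
  least half of what is still possible, has a supremum of trace exactly \<open>s\<close>: otherwise a small part of
  \<open>P\<close> outside it could be added at every step, although the gains of the steps tend to \<open>0\<close>.\<close>

lemma subproj_of_trace_diffuse:
  assumes diffuse: "\<And>E. \<not> minimal_proj E" and P: "projM P" and s: "0 \<le> s" "s \<le> tr P"
  shows "\<exists>Q. subproj Q P \<and> tr Q = s"
proof -
  define adm where "adm Q \<longleftrightarrow> subproj Q P \<and> tr Q \<le> s" for Q
  define good where "good Q N \<longleftrightarrow> subproj Q N \<and> adm N \<and>
      (\<forall>Q'. subproj Q Q' \<and> adm Q' \<longrightarrow> tr Q' - tr Q \<le> 2 * (tr N - tr Q))" for Q N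
  have step: "\<exists>N. good Q N" if Q: "adm Q" for Q
  proof -
    let ?A = "{tr Q' | Q'. subproj Q Q' \<and> adm Q'}"
    have ne: "tr Q \<in> ?A" using Q subproj_refl subprojD(1) by (auto simp: adm_def)
    have bdd: "bdd_above ?A" by (auto simp: adm_def intro!: bdd_aboveI [where M = s])
    have upper: "tr Q' \<le> Sup ?A" if "subproj Q Q'" "adm Q'" for Q'
      using that by (intro cSup_upper bdd) auto
    show ?thesis
    proof (cases "Sup ?A \<le> tr Q")
      case True
      then show ?thesis
        using Q upper subproj_refl [OF subprojD(1)] unfolding good_def adm_def
        by (intro exI [of _ Q]) fastforce
    next
      case False
      then have "(tr Q + Sup ?A) / 2 < Sup ?A" by simp
      then obtain x where "x \<in> ?A" "(tr Q + Sup ?A) / 2 < x"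
        using less_cSupD [of ?A] ne by blast
      then obtain N where N: "subproj Q N" "adm N" "(tr Q + Sup ?A) / 2 < tr N" by auto
      have "tr Q' - tr Q \<le> 2 * (tr N - tr Q)" if "subproj Q Q'" "adm Q'" for Q'
        using upper [OF that] N(3) by simp
      then show ?thesis using N unfolding good_def by (intro exI [of _ N]) blast
    qed
  qed
  define nxt where "nxt Q = (SOME N. good Q N)" for Q
  define Qs where "Qs n = (nxt ^^ n) 0" for n
  have nxt: "good Q (nxt Q)" if "adm Q" for Q
    unfolding nxt_def using step [OF that] by (rule someI_ex)
  have adm: "adm (Qs n)" for n
  proof (induction n)
    case 0
    show ?case using P s subproj_zero by (simp add: Qs_def adm_def tr_zero)
  next
    case (Suc n)
    then show ?case using nxt [OF Suc] by (simp add: Qs_def good_def)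
  qed
  have good: "good (Qs n) (Qs (Suc n))" for n
    using nxt [OF adm [of n]] by (simp add: Qs_def)
  have inc: "subproj (Qs n) (Qs (Suc n))" for n
    using good [of n] by (simp add: good_def)
  have le: "subproj (Qs n) P" for n
    using adm [of n] by (simp add: adm_def)
  obtain S where S: "projM S" "\<And>n. subproj (Qs n) S" "subproj S P" "(\<lambda>n. tr (Qs n)) \<longlonglongrightarrow> tr S"
    using inc le by (rule projM_sequence_sup) (rule that)
  have Ss: "tr S \<le> s"
    using S(4) by (rule LIMSEQ_le_const2) (use adm in \<open>auto simp: adm_def\<close>)
  have "tr S = s"
  proof (rule ccontr)
    assume "tr S \<noteq> s"
    then have less: "tr S < s" using Ss by simp
    note D = subproj_diff [OF S(3)]
    have "tr (P - S) \<noteq> 0" using D(3) less s by linarith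
    then have "P - S \<noteq> 0" using tr_zero by auto
    then obtain R where R: "subproj R (P - S)" "R \<noteq> 0" "tr R < s - tr S"
      using small_subproj [OF D(1)] diffuse less by (metis diff_gt_0_iff_gt)
    note A = subproj_extend [OF S(3) R(1)]
    have admSR: "adm (S + R)" using A(2,3) R(3) by (simp add: adm_def)
    have bound: "tr R \<le> 2 * (tr (Qs (Suc n)) - tr (Qs n))" for n
    proof -
      have "subproj (Qs n) (S + R)" using subproj_trans [OF S(2) A(1)] .
      then have "tr (S + R) - tr (Qs n) \<le> 2 * (tr (Qs (Suc n)) - tr (Qs n))"
        using good [of n] admSR by (simp add: good_def)
      then show ?thesis using A(3) subproj_tr_mono [OF S(2), of n] by linarith
    qed
    have "(\<lambda>n. 2 * (tr (Qs (Suc n)) - tr (Qs n))) \<longlonglongrightarrow> 2 * (tr S - tr S)"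
      by (intro tendsto_intros LIMSEQ_Suc S(4))
    then have "tr R \<le> 2 * (tr S - tr S)"
      by (rule LIMSEQ_le_const) (use bound in auto)
    then show False using tr_projM_pos [OF subprojD(1) [OF R(1)] R(2)] by simp
  qed
  then show ?thesis using S(3) by blast
qed

text \<open>All moments of \<open>S\<close> of positive order are \<open>\<tau> P\<close>, so \<open>\<tau> ((S\<^sup>2 - S)\<^sup>2) = 0\<close>, and the trace is faithful.\<close>

lemma equi_measurable_projection:
  assumes P: "projM P" and S: "S \<in> M" "positive_op S" "equi_measurable \<tau> S P"
  shows "projM S" "tr S = tr P"
proof -
  have sa: "self_adjoint_op S" using S by (simp add: positive_self_adjoint)
  have powP: "op_power P (Suc n) = P" for n
    by (induction n) (simp_all add: op_power_Suc op_power_0 op_simps projM_D(4) [OF P])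
  have mom: "tr (op_power S (Suc n)) = tr P" for n
    using S(3) powP unfolding equi_measurable_def tr_def by metis
  have pow: "op_power S 1 = S" "op_power S 2 = S o\<^sub>L S" "op_power S 3 = S o\<^sub>L (S o\<^sub>L S)"
    "op_power S 4 = S o\<^sub>L (S o\<^sub>L (S o\<^sub>L S))"
    by (simp_all add: op_power_Suc op_power_0 op_simps numeral_eq_Suc)
  show "tr S = tr P" using mom [of 0] by (simp add: op_power_Suc op_power_0 op_simps)
  define D where "D = (S o\<^sub>L S) - S"
  have "D o\<^sub>L D = (op_power S 4 - op_power S 3) - (op_power S 3 - op_power S 2)"
    unfolding pow by (simp add: D_def op_simps)
  then have "tr (D o\<^sub>L D) = 0"
    using mom [of 1] mom [of 2] mom [of 3]
    by (simp add: tr_diff M_diff op_power_M S(1) numeral_eq_Suc)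
  moreover have "D \<in> M" "self_adjoint_op D"
    unfolding D_def using S(1) sa by (auto intro!: M_diff M_comp self_adjoint_diff self_adjoint_comp)
  ultimately have "D = 0" by (intro tr_faithful)
  then show "projM S"
    using S(1) sa by (intro projM_I) (simp_all add: D_def)
qed

text \<open>Compressing to a minimal projection \<open>E\<close> yields scalars. If \<open>\<tau> S < \<tau> E\<close>, the comparison lemma
  forces \<open>\<parallel>(1 - S) E\<parallel> = 1\<close>, and then the scalar \<open>E (1 - S) E\<close> must be \<open>E\<close>.\<close>

lemma compression_minimal_zero:
  assumes E: "minimal_proj E" and S: "projM S" and less: "tr S < tr E"
  shows "E o\<^sub>L (S o\<^sub>L E) = 0"
proof -
  note pE = minimal_projD(1) [OF E]
  have pS': "projM (id_blinfun - S)" using S by (rule projM_complement)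
  define X where "X = E o\<^sub>L ((id_blinfun - S) o\<^sub>L E)"
  have XM: "X \<in> M" unfolding X_def by (intro M_comp projM_D(1) pE pS')
  have saX: "self_adjoint_op X" unfolding X_def by (intro self_adjoint_conj projM_D(3) pE pS')
  have form: "rip (X x) x = (norm ((id_blinfun - S) (E x)))\<^sup>2" for x
    by (simp only: X_def blinfun_apply_blinfun_compose projM_D(6) [OF pE] norm_projM_apply_sq [OF pS'])
  have posX: "positive_op X" using saX form by (simp add: positive_iff)
  have nX: "1 \<le> norm X"
  proof (rule ccontr)
    assume "\<not> 1 \<le> norm X"
    then have lt: "sqrt (norm X) < 1" by simp
    have "norm ((id_blinfun - S) o\<^sub>L E) \<le> sqrt (norm X)"
    proof (rule norm_blinfun_bound)
      fix x
      have "(norm ((id_blinfun - S) (E x)))\<^sup>2 \<le> norm X * (norm x)\<^sup>2"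
        using rip_apply_le [of X x] form by simp
      also have "\<dots> = (sqrt (norm X) * norm x)\<^sup>2" by (simp add: power_mult_distrib)
      finally have "norm ((id_blinfun - S) (E x)) \<le> sqrt (norm X) * norm x"
        by (rule power2_le_imp_le) simp
      then show "norm (((id_blinfun - S) o\<^sub>L E) x) \<le> sqrt (norm X) * norm x"
        by simp
    qed simp
    then have "norm ((id_blinfun - S) o\<^sub>L E) < 1" using lt by linarith
    then show False using tr_le_of_norm_less [OF pE S] less by simp
  qed
  have nX': "norm X \<le> 1"
  proof -
    have "norm X \<le> norm E * (norm (id_blinfun - S) * norm E)"
      unfolding X_def
      by (rule order_trans [OF norm_blinfun_compose mult_left_mono [OF norm_blinfun_compose]]) simp
    also have "\<dots> \<le> 1 * (1 * 1)"
      using norm_projM_le [OF pE] norm_projM_le [OF pS'] by (intro mult_mono) auto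
    finally show ?thesis by simp
  qed
  have EX: "E o\<^sub>L X = X" "X o\<^sub>L E = X"
    unfolding X_def by (rule blinfun_eqI, simp add: projM_D(5) [OF pE])+
  have close: "norm (X - E) \<le> 2 * e" if e: "0 < e" for e
  proof -
    obtain n :: nat and P a where P: "opart {..<n} P" and a: "\<And>j. 0 \<le> a j"
      and "\<And>i j. i \<le> j \<Longrightarrow> j < n \<Longrightarrow> a j \<le> a i"
      and comm: "\<And>k. k < n \<Longrightarrow> bicommutes X (P k)"
      and approx: "norm (X - simple_op {..<n} P a) \<le> e"
      using XM posX e by (rule simple_approximation) (rule that)
    have PE: "E o\<^sub>L P k = P k o\<^sub>L E" if "k < n" for k
      using EX by (intro bicommutesD [OF comm [OF that]]) simp
    have cases: "P k o\<^sub>L E = 0 \<or> P k o\<^sub>L E = E" if k: "k < n" for k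
    proof -
      have "projM (P k o\<^sub>L E)"
        using opartD(2) [OF P] k pE PE [OF k] by (intro projM_comp) auto
      moreover have "E o\<^sub>L (P k o\<^sub>L E) = P k o\<^sub>L E"
        using comm_apply [OF PE [OF k]] by (intro blinfun_eqI) (simp add: projM_D(5) [OF pE])
      ultimately show ?thesis
        using minimal_projD(3) [OF E] subprojI [OF _ pE] by blast
    qed
    have "\<exists>k<n. P k o\<^sub>L E \<noteq> 0"
    proof (rule ccontr)
      assume "\<not> ?thesis"
      then have "(\<Sum>k<n. P k o\<^sub>L E) = 0" by (intro sum.neutral) auto
      then have "sum P {..<n} o\<^sub>L E = 0" by (simp add: comp_sum_left)
      then show False using opartD(3) [OF P] minimal_projD(2) [OF E] by (simp add: op_simps)
    qed
    then obtain k where k: "k < n" "P k o\<^sub>L E = E" using cases by blast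
    have "simple_op {..<n} P a o\<^sub>L E = (simple_op {..<n} P a o\<^sub>L P k) o\<^sub>L E"
      by (simp only: comp_assoc_blinfun k(2))
    also have "\<dots> = a k *\<^sub>R E"
      using k by (simp add: simple_op_comp_part [OF P] op_simps)
    finally have "X - a k *\<^sub>R E = (X - simple_op {..<n} P a) o\<^sub>L E"
      by (simp add: op_simps EX)
    then have "norm (X - a k *\<^sub>R E) \<le> norm (X - simple_op {..<n} P a) * norm E"
      by (metis norm_blinfun_compose)
    also have "\<dots> \<le> e * 1"
      using approx norm_projM_le [OF pE] e by (intro mult_mono) auto
    finally have 1: "norm (X - a k *\<^sub>R E) \<le> e" by simp
    have nE: "norm E = 1" using norm_projM_eq minimal_projD [OF E] by blast
    have "\<bar>norm X - norm (a k *\<^sub>R E)\<bar> \<le> e"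
      using norm_triangle_ineq3 [of X "a k *\<^sub>R E"] 1 by linarith
    then have "\<bar>a k - 1\<bar> \<le> e"
      using nX nX' nE a [of k] by simp
    then have 2: "norm ((a k - 1) *\<^sub>R E) \<le> e" by (simp add: nE)
    have "X - E = (X - a k *\<^sub>R E) + (a k - 1) *\<^sub>R E"
      by (simp add: algebra_simps)
    then have "norm (X - E) \<le> norm (X - a k *\<^sub>R E) + norm ((a k - 1) *\<^sub>R E)"
      by (simp only: norm_triangle_ineq)
    then show ?thesis using 1 2 by linarith
  qed
  have "norm (X - E) \<le> 0"
  proof (rule field_le_epsilon)
    fix e :: real assume "0 < e"
    then show "norm (X - E) \<le> 0 + e" using close [of "e / 2"] by simp
  qed
  then have "X = E" by simp
  moreover have "X = E - (E o\<^sub>L (S o\<^sub>L E))"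
    by (simp add: X_def op_simps projM_D(4) [OF pE])
  ultimately show ?thesis by simp
qed

text \<open>Otherwise compression to \<open>E\<close> kills all operators equi-measurable with \<open>P\<close>, hence by linearity and
  continuity their closed convex hull, which contains \<open>\<tau> P \<cdot> 1\<close> by the weak Dixmier property.\<close>

lemma minimal_proj_least_trace:
  assumes dixmier: "weak_dixmier M \<tau>" and E: "minimal_proj E" and P: "projM P" "P \<noteq> 0"
  shows "tr E \<le> tr P"
proof (rule ccontr)
  assume "\<not> tr E \<le> tr P"
  then have less: "tr P < tr E" by simp
  define A where "A = {S \<in> M. positive_op S \<and> equi_measurable \<tau> S P}"
  define f where "f Y = E o\<^sub>L (Y o\<^sub>L E)" for Y
  have bl: "bounded_linear f"
    unfolding f_def
    by (intro bounded_linear_compose [OF bounded_bilinear.bounded_linear_right [OF bounded_bilinear_blinfun_compose]]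
        bounded_bilinear.bounded_linear_left [OF bounded_bilinear_blinfun_compose])
  then have lin: "linear f" by (rule bounded_linear.linear)
  have "A \<subseteq> {Y. f Y = 0}"
    using compression_minimal_zero [OF E] equi_measurable_projection [OF P(1)] less
    by (auto simp: A_def f_def)
  then have "convex hull A \<subseteq> {Y. f Y = 0}"
    using subspace_imp_convex [OF linear_subspace_kernel [OF lin]] by (intro hull_minimal)
  moreover have "closed {Y. f Y = 0}"
    by (intro closed_Collect_eq continuous_on_const linear_continuous_on bl)
  ultimately have "closure (convex hull A) \<subseteq> {Y. f Y = 0}"
    by (intro closure_minimal)
  moreover have "scaleC_op (\<tau> P) id_blinfun \<in> closure (convex hull A)"
    using dixmier P(1) unfolding weak_dixmier_def A_def by (simp add: projM_D(1) projM_positive)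
  ultimately have "f (tr P *\<^sub>R id_blinfun) = 0"
    using tau_eq_tr [OF projM_D(1) projM_positive, OF P(1) P(1)] by (auto simp: scaleC_op_of_real)
  then have "tr P *\<^sub>R E = 0"
    by (simp add: f_def op_simps projM_D(4) [OF minimal_projD(1) [OF E]])
  then show False
    using tr_projM_pos [OF P] minimal_projD(2) [OF E] by simp
qed

text \<open>Cuts are required in every interval of projections, not only in those starting at \<open>0\<close>: in the diffuse
  case \<open>tr A\<close> need not be a multiple of \<open>1 / K\<close>.\<close>

definition divisible :: "nat \<Rightarrow> bool" where
  "divisible K \<longleftrightarrow> 0 < K \<and> (\<forall>A B i. subproj A B \<longrightarrow> tr A \<le> real i / real K \<longrightarrow> real i / real K \<le> tr B \<longrightarrow>
      (\<exists>Q. subproj A Q \<and> subproj Q B \<and> tr Q = real i / real K))"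

text \<open>All minimal projections have the same trace \<open>e\<close>, which is also the least trace of a nonzero projection.
  Subtracting minimal projections one by one exhausts any projection, so its trace is a multiple of \<open>e\<close>;
  for the identity this says \<open>e = 1 / n\<close>.\<close>

lemma atomic_divisible:
  assumes dixmier: "weak_dixmier M \<tau>" and E: "minimal_proj E"
  obtains n where "divisible n" "\<And>P. projM P \<Longrightarrow> \<exists>i. tr P = real i / real n"
proof -
  define e where "e = tr E"
  have e: "0 < e" unfolding e_def using minimal_projD [OF E] by (intro tr_projM_pos)
  have le: "e \<le> tr P" if "projM P" "P \<noteq> 0" for P
    unfolding e_def using minimal_proj_least_trace [OF dixmier E that] .
  have min: "\<exists>F. subproj F P \<and> tr F = e" if P: "projM P" "P \<noteq> 0" for P
  proof -
    obtain F where F: "subproj F P" "minimal_proj F"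
      using small_subproj [OF P _ e] le subprojD(1) by (metis not_less)
    have "tr F \<le> e"
      unfolding e_def using minimal_projD [OF E] by (intro minimal_proj_least_trace [OF dixmier F(2)])
    then show ?thesis
      using F le [of F] minimal_projD(1,2) [OF F(2)] by (intro exI [of _ F]) auto
  qed
  have cut: "\<exists>Q. subproj Q P \<and> tr Q = real i * e" if P: "projM P" and "real i * e \<le> tr P" for P i
    using that(2)
  proof (induction i)
    case 0
    then show ?case using P subproj_zero by (intro exI [of _ 0]) (simp add: tr_zero)
  next
    case (Suc i)
    have prem: "real i * e + e \<le> tr P" using Suc.prems by (simp add: algebra_simps)
    then have "real i * e \<le> tr P" using e by linarith
    then obtain Q where Q: "subproj Q P" "tr Q = real i * e"
      using Suc.IH by blast
    note D = subproj_diff [OF Q(1)]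
    have "tr (P - Q) \<noteq> 0" using D(3) Q(2) prem e by linarith
    then have "P - Q \<noteq> 0" using tr_zero by auto
    then obtain F where F: "subproj F (P - Q)" "tr F = e" using min [OF D(1)] by blast
    note A = subproj_extend [OF Q(1) F(1)]
    have "tr (Q + F) = real (Suc i) * e" using A(3) Q(2) F(2) by (simp add: algebra_simps)
    then show ?case using A(2) by blast
  qed
  have multiple: "\<exists>i. tr P = real i * e" if P: "projM P" for P
  proof -
    define i where "i = nat \<lfloor>tr P / e\<rfloor>"
    have ge: "0 \<le> tr P / e" using tr_projM_nonneg [OF P] e by simp
    have "real i = of_int \<lfloor>tr P / e\<rfloor>" using ge by (simp add: i_def)
    then have "real i \<le> tr P / e" "tr P / e < real i + 1" by linarith+
    then have i: "real i * e \<le> tr P" "tr P < (real i + 1) * e"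
      using e by (simp_all add: pos_le_divide_eq pos_divide_less_eq)
    obtain Q where Q: "subproj Q P" "tr Q = real i * e" using cut [OF P i(1)] by blast
    note D = subproj_diff [OF Q(1)]
    have "tr (P - Q) < e" using D(3) Q(2) i(2) by (simp add: algebra_simps)
    then have "P - Q = 0" using le [OF D(1)] by fastforce
    then show ?thesis using Q(2) by auto
  qed
  obtain n where n: "1 = real n * e" using multiple [OF projM_id] tr_id by auto
  then have "0 < n" using e by (cases n) auto
  then have e_eq: "e = 1 / real n" using n by (simp add: field_simps)
  show ?thesis
  proof (rule that [of n])
    have "\<exists>Q. subproj A Q \<and> subproj Q B \<and> tr Q = real i * e"
      if AB: "subproj A B" and le: "tr A \<le> real i * e" "real i * e \<le> tr B" for A B i
    proof -
      note D = subproj_diff [OF AB]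
      obtain j where j: "tr A = real j * e" using multiple [OF subprojD(1) [OF AB]] by blast
      then have "j \<le> i" using le(1) e by simp
      then have diff: "real (i - j) * e = real i * e - tr A" by (simp add: j algebra_simps of_nat_diff)
      then obtain Q where Q: "subproj Q (B - A)" "tr Q = real (i - j) * e"
        using cut [OF D(1), of "i - j"] D(3) le by auto
      show ?thesis
        using subproj_extend [OF AB Q(1)] Q(2) diff by (intro exI [of _ "A + Q"]) simp
    qed
    then show "divisible n"
      using \<open>0 < n\<close> unfolding divisible_def e_eq by simp
    show "\<exists>i. tr P = real i / real n" if "projM P" for P
      using multiple [OF that] unfolding e_eq by simp
  qed
qed

text \<open>Only this consequence of the weak Dixmier property enters the representation: the algebra is diffuse,
  or all traces of projections lie on one grid and cuts exist at its points.\<close>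

lemma divisibility_dichotomy:
  assumes "weak_dixmier M \<tau>"
  shows "(\<forall>K>0. divisible K) \<or> (\<exists>n. divisible n \<and> (\<forall>P. projM P \<longrightarrow> (\<exists>i. tr P = real i / real n)))"
proof (cases "\<exists>E. minimal_proj E")
  case True
  then show ?thesis using atomic_divisible [OF assms] by metis
next
  case False
  have "\<exists>Q. subproj A Q \<and> subproj Q B \<and> tr Q = s"
    if AB: "subproj A B" and s: "tr A \<le> s" "s \<le> tr B" for A B s
  proof -
    note D = subproj_diff [OF AB]
    obtain Q where Q: "subproj Q (B - A)" "tr Q = s - tr A"
      using subproj_of_trace_diffuse [OF _ D(1), of "s - tr A"] False D(3) s by auto
    show ?thesis
      using subproj_extend [OF AB Q(1)] Q(2) by (intro exI [of _ "A + Q"]) simp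
  qed
  then show ?thesis
    unfolding divisible_def by simp
qed

end


context finite_vna
begin

section \<open>Partitions adapted to a flag of projections\<close>

text \<open>Members of a flag commute, and they are compared by their traces alone.\<close>

definition flag :: "'h op set \<Rightarrow> bool" where
  "flag C \<longleftrightarrow> finite C \<and> (\<forall>A\<in>C. projM A) \<and> (\<forall>A\<in>C. \<forall>B\<in>C. subproj A B \<or> subproj B A)"

lemma flag_le_iff:
  assumes "flag C" "A \<in> C" "B \<in> C" shows "subproj A B \<longleftrightarrow> tr A \<le> tr B"
proof
  assume "tr A \<le> tr B"
  moreover have "subproj A B \<or> subproj B A" using assms by (auto simp: flag_def)
  ultimately show "subproj A B"
    using subproj_tr_mono [of B A] subproj_tr_eq [of B A] by (metis order_antisym subproj_refl subprojD(1))
qed (rule subproj_tr_mono)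

text \<open>The new projection is cut out between the largest member of trace at most \<open>i / K\<close> and the smallest one of
  trace at least \<open>i / K\<close>, so that it is comparable with all members.\<close>

lemma flag_insert:
  assumes C: "flag C" "0 \<in> C" "id_blinfun \<in> C" and div: "divisible K" and i: "i \<le> K"
  obtains Q where "tr Q = real i / real K" "flag (insert Q C)"
proof -
  define s where "s = real i / real K"
  have K: "0 < K" using div by (simp add: divisible_def)
  have s: "0 \<le> s" "s \<le> 1" using i K by (simp_all add: s_def)
  let ?L = "{A \<in> C. tr A \<le> s}" and ?U = "{A \<in> C. s \<le> tr A}"
  have fin: "finite ?L" "finite ?U" using C by (simp_all add: flag_def)
  have "0 \<in> ?L" "id_blinfun \<in> ?U" using C s by (simp_all add: tr_zero tr_id)
  then have "Max (tr ` ?L) \<in> tr ` ?L" "Min (tr ` ?U) \<in> tr ` ?U"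
    using fin by (auto intro!: Max_in Min_in)
  then obtain L U where L: "L \<in> ?L" "Max (tr ` ?L) = tr L" and U: "U \<in> ?U" "Min (tr ` ?U) = tr U"
    by blast
  have Lmax: "subproj A L" if "A \<in> ?L" for A
  proof -
    have "tr A \<le> Max (tr ` ?L)" using fin that by (intro Max_ge) auto
    then show ?thesis using flag_le_iff [OF C(1)] that L by auto
  qed
  have Umin: "subproj U A" if "A \<in> ?U" for A
  proof -
    have "Min (tr ` ?U) \<le> tr A" using fin that by (intro Min_le) auto
    then show ?thesis using flag_le_iff [OF C(1)] that U by auto
  qed
  have LU: "subproj L U" using flag_le_iff [OF C(1)] L(1) U(1) by auto
  have "tr L \<le> s" "s \<le> tr U" using L(1) U(1) by simp_all
  then obtain Q where Q: "subproj L Q" "subproj Q U" "tr Q = s"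
    using div LU unfolding divisible_def s_def by blast
  show ?thesis
  proof (rule that [of Q])
    show "tr Q = real i / real K" using Q(3) by (simp add: s_def)
    have pQ: "projM Q" using Q subprojD by blast
    have "subproj A Q \<or> subproj Q A" if "A \<in> C" for A
      using that Lmax [of A] Umin [of A] Q subproj_trans by (cases "tr A \<le> s") auto
    then show "flag (insert Q C)"
      using C(1) pQ subproj_refl [OF pQ] by (auto simp: flag_def)
  qed
qed

lemma flag_grid:
  assumes C: "flag C" "0 \<in> C" "id_blinfun \<in> C" and div: "divisible K"
  shows "m \<le> K \<Longrightarrow> \<exists>Q. (\<forall>i\<le>m. tr (Q i) = real i / real K) \<and> flag (C \<union> Q ` {..m})"
proof (induction m)
  case 0
  have "C \<union> (\<lambda>_. 0) ` {..0::nat} = C" using C(2) by auto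
  then show ?case using C(1) by (intro exI [of _ "\<lambda>_. 0"]) (simp add: tr_zero)
next
  case (Suc m)
  then obtain Q where Q: "\<forall>i\<le>m. tr (Q i) = real i / real K" "flag (C \<union> Q ` {..m})" by auto
  obtain R where R: "tr R = real (Suc m) / real K" "flag (insert R (C \<union> Q ` {..m}))"
    using Q(2) _ _ div Suc.prems by (rule flag_insert) (use C in auto)
  have "C \<union> (Q(Suc m := R)) ` {..Suc m} = insert R (C \<union> Q ` {..m})"
    by (auto simp: atMost_Suc)
  then show ?case
    using R Q(1) by (intro exI [of _ "Q(Suc m := R)"]) (simp add: le_Suc_eq)
qed

text \<open>The partial sums of \<open>P\<close> form a flag, which is completed by projections of trace \<open>i / K\<close>; the new partition
  consists of the differences of consecutive cuts. Laying out both partitions on \<open>[0, 1]\<close> by their traces,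
  members meet only if their intervals overlap.\<close>

lemma adapted_partition:
  assumes P: "opart {..<n} P" and div: "divisible K"
  defines "r \<equiv> \<lambda>k. tr (\<Sum>i<k. P i)"
  obtains E where "opart {..<K} E" "\<And>i. i < K \<Longrightarrow> tr (E i) = 1 / real K"
    "\<And>k i. k < n \<Longrightarrow> i < K \<Longrightarrow> P k o\<^sub>L E i = E i o\<^sub>L P k"
    "\<And>k i. k < n \<Longrightarrow> i < K \<Longrightarrow> P k o\<^sub>L E i \<noteq> 0 \<Longrightarrow>
      r k < real (Suc i) / real K \<and> real i / real K < r (Suc k)"
proof -
  have K: "0 < K" using div by (simp add: divisible_def)
  define R where "R k = (\<Sum>i<k. P i)" for k
  have Rstep: "projM (R k) \<and> (\<forall>j. k \<le> j \<and> j < n \<longrightarrow> R k o\<^sub>L P j = 0)" if "k \<le> n" for k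
    using that
  proof (induction k)
    case 0
    show ?case by (simp add: R_def projM_zero op_simps)
  next
    case (Suc k)
    then have k: "projM (R k)" "projM (P k)" "R k o\<^sub>L P k = 0"
      using opartD(2) [OF P] by auto
    have "R (Suc k) = R k + P k" by (simp add: R_def)
    then show ?case
      using orth_add(1) [OF k] Suc opartD(4) [OF P] by (auto simp: op_simps)
  qed
  have pR: "projM (R k)" if "k \<le> n" for k using Rstep that by blast
  have RSuc: "subproj (R k) (R (Suc k))" if "k < n" for k
    using orth_add(2) [of "R k" "P k"] Rstep [of k] opartD(2) [OF P] that by (simp add: R_def)
  have Rmono: "subproj (R j) (R k)" if "j \<le> k" "k \<le> n" for j k
    using that
  proof (induction k rule: dec_induct)
    case base
    then show ?case by (intro subproj_refl pR)
  next
    case (step k)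
    then show ?case using subproj_trans RSuc by simp
  qed
  have Rn: "R n = id_blinfun" using opartD(3) [OF P] by (simp add: R_def)
  have flagR: "flag (R ` {..n})"
    unfolding flag_def using pR Rmono by (auto) (meson nle_le)
  have "0 \<in> R ` {..n}" by (rule image_eqI [of _ _ 0]) (simp_all add: R_def)
  moreover have "id_blinfun \<in> R ` {..n}" using Rn by (intro image_eqI [of _ _ n]) auto
  ultimately obtain Q where Q: "\<And>i. i \<le> K \<Longrightarrow> tr (Q i) = real i / real K" "flag (R ` {..n} \<union> Q ` {..K})"
    using flag_grid [OF flagR _ _ div order_refl] by blast
  define C where "C = R ` {..n} \<union> Q ` {..K}"
  have flagC: "flag C" using Q(2) by (simp add: C_def)
  have RC: "R k \<in> C" if "k \<le> n" for k using that by (auto simp: C_def)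
  have QC: "Q i \<in> C" if "i \<le> K" for i using that by (auto simp: C_def)
  have comm: "A o\<^sub>L B = B o\<^sub>L A" if "A \<in> C" "B \<in> C" for A B
    using flagC that subprojD(3,4) unfolding flag_def by metis
  have Qmono: "subproj (Q i) (Q j)" if "i \<le> j" "j \<le> K" for i j
    using flag_le_iff [OF flagC QC QC] Q(1) K that by (simp add: divide_right_mono)
  have QQ: "Q i o\<^sub>L Q j = Q i" "Q j o\<^sub>L Q i = Q i" if "i \<le> j" "j \<le> K" for i j
    using subprojD(3,4) [OF Qmono [OF that]] by simp_all
  have pQ: "projM (Q i)" if "i \<le> K" for i using QC [OF that] flagC by (auto simp: flag_def)
  define E where "E i = Q (Suc i) - Q i" for i
  have PR: "P k = R (Suc k) - R k" for k by (simp add: R_def)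
  have pE: "projM (E i)" "tr (E i) = 1 / real K" if "i < K" for i
    using subproj_diff(1,3) [OF Qmono [of i "Suc i"]] Q(1) that
    by (simp_all add: E_def add_divide_distrib)
  have orthE: "E i o\<^sub>L E j = 0 \<and> E j o\<^sub>L E i = 0" if "i < j" "j < K" for i j
    using that by (simp add: E_def op_simps QQ pQ [THEN projM_D(4)])
  have "E i o\<^sub>L E j = 0" if "i < K" "j < K" "i \<noteq> j" for i j
    using orthE [of i j] orthE [of j i] that by (cases "i < j") auto
  moreover have "sum E {..<K} = id_blinfun"
  proof -
    have "sum E {..<K} = Q K - Q 0"
      unfolding E_def by (rule sum_lessThan_telescope)
    moreover have "Q 0 = 0" using tr_projM_zero [OF pQ] Q(1) by simp
    moreover have "Q K = id_blinfun"
      using subproj_tr_eq [OF subproj_id [OF pQ]] Q(1) K by (simp add: tr_id)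
    ultimately show ?thesis by simp
  qed
  ultimately have part: "opart {..<K} E"
    unfolding opart_def using pE(1) by auto
  have PE: "P k o\<^sub>L E i = E i o\<^sub>L P k" if "k < n" "i < K" for k i
    using that comm [OF RC QC] by (simp add: PR E_def op_simps)
  have zero: "P k o\<^sub>L E i = 0" if ki: "k < n" "i < K"
    and far: "real (Suc i) / real K \<le> r k \<or> r (Suc k) \<le> real i / real K" for k i
  proof -
    have r: "r k = tr (R k)" for k by (simp add: r_def R_def)
    show ?thesis
      using far
    proof
      assume "real (Suc i) / real K \<le> r k"
      then have "subproj (Q (Suc i)) (R k)"
        using ki flag_le_iff [OF flagC QC RC] Q(1) by (simp add: r)
      moreover from this have "subproj (Q i) (R k)"
        using ki(2) by (intro subproj_trans [OF Qmono [of i "Suc i"]]) simp_all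
      ultimately have "subproj (Q (Suc i)) (R (Suc k))" "subproj (Q i) (R (Suc k))"
        "subproj (Q (Suc i)) (R k)" "subproj (Q i) (R k)"
        using RSuc [OF ki(1)] subproj_trans by blast+
      note this [THEN subprojD(4)]
      then show ?thesis by (simp add: PR E_def op_simps)
    next
      assume "r (Suc k) \<le> real i / real K"
      then have "subproj (R (Suc k)) (Q i)"
        using ki flag_le_iff [OF flagC RC QC] Q(1) by (simp add: r)
      then have "subproj (R k) (Q (Suc i))" "subproj (R k) (Q i)"
        "subproj (R (Suc k)) (Q (Suc i))" "subproj (R (Suc k)) (Q i)"
        using RSuc [OF ki(1)] Qmono [of i "Suc i"] ki(2) subproj_trans by (meson Suc_leI le_SucI order_refl)+
      note this [THEN subprojD(3)]
      then show ?thesis by (simp add: PR E_def op_simps)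
    qed
  qed
  show ?thesis
  proof (rule that [of E])
    show "r k < real (Suc i) / real K \<and> real i / real K < r (Suc k)"
      if "k < n" "i < K" "P k o\<^sub>L E i \<noteq> 0" for k i
      using zero [OF that(1,2)] that(3) by (meson not_le)
  qed (use part pE(2) PE in auto)
qed

section \<open>Generalized s-numbers\<close>

definition mu :: "real \<Rightarrow> 'h op \<Rightarrow> real" where "mu s T = s_number M \<tau> s T"

definition small_cokernel_proj :: "real \<Rightarrow> 'h op set" where
  "small_cokernel_proj s = {E. projM E \<and> tr (id_blinfun - E) \<le> s}"

lemma mu_eq: "mu s T = Inf ((\<lambda>E. norm (T o\<^sub>L E)) ` small_cokernel_proj s)"
  unfolding mu_def s_number_def small_cokernel_proj_def projM_def tr_def
  by (rule arg_cong [of _ _ Inf]) auto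

lemma id_small_cokernel_proj: "0 \<le> s \<Longrightarrow> id_blinfun \<in> small_cokernel_proj s"
  by (simp add: small_cokernel_proj_def projM_id tr_zero)

lemma mu_bdd_below: "bdd_below ((\<lambda>E. norm (T o\<^sub>L E)) ` small_cokernel_proj s)"
  by (rule bdd_belowI [where m = 0]) auto

lemma mu_le: "E \<in> small_cokernel_proj s \<Longrightarrow> mu s T \<le> norm (T o\<^sub>L E)"
  unfolding mu_eq by (rule cInf_lower [OF _ mu_bdd_below]) auto

lemma mu_ge:
  "0 \<le> s \<Longrightarrow> (\<And>E. E \<in> small_cokernel_proj s \<Longrightarrow> c \<le> norm (T o\<^sub>L E)) \<Longrightarrow> c \<le> mu s T"
  unfolding mu_eq using id_small_cokernel_proj by (intro cInf_greatest) auto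

lemma mu_nonneg: "0 \<le> s \<Longrightarrow> 0 \<le> mu s T"
  by (rule mu_ge) auto

lemma mu_le_norm: "0 \<le> s \<Longrightarrow> mu s T \<le> norm T"
  using mu_le [OF id_small_cokernel_proj] by (simp add: op_simps)

lemma mu_antimono: "0 \<le> s \<Longrightarrow> s \<le> t \<Longrightarrow> mu t T \<le> mu s T"
  by (rule mu_ge, assumption, rule mu_le) (auto simp: small_cokernel_proj_def)

lemma mu_lipschitz:
  assumes "0 \<le> s" shows "mu s S \<le> mu s T + norm (S - T)"
proof -
  have "mu s S - norm (S - T) \<le> mu s T"
  proof (rule mu_ge [OF assms])
    fix E assume E: "E \<in> small_cokernel_proj s"
    have "mu s S \<le> norm (S o\<^sub>L E)" using E by (rule mu_le)
    also have "S o\<^sub>L E = (T o\<^sub>L E) + ((S - T) o\<^sub>L E)" by (simp add: op_simps)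
    also have "norm \<dots> \<le> norm (T o\<^sub>L E) + norm ((S - T) o\<^sub>L E)" by (rule norm_triangle_ineq)
    also have "norm ((S - T) o\<^sub>L E) \<le> norm (S - T) * norm E" by (rule norm_blinfun_compose)
    also have "\<dots> \<le> norm (S - T) * 1"
      using E norm_projM_le by (intro mult_left_mono) (auto simp: small_cokernel_proj_def)
    finally show "mu s S - norm (S - T) \<le> norm (T o\<^sub>L E)" by simp
  qed
  then show ?thesis by simp
qed

lemma mu_modulus:
  assumes "T \<in> M" shows "mu s (modulus_op T) = mu s T"
proof -
  have "norm (modulus_op T o\<^sub>L E) = norm (T o\<^sub>L E)" for E :: "'h op"
    using norm_modulus_apply [OF assms] by (simp add: norm_blinfun.rep_eq onorm_def)
  then show ?thesis by (simp add: mu_eq)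
qed

text \<open>For the upper bound, remove the first \<open>i\<close> members of \<open>E\<close>. For the lower one, let \<open>Q\<close> be the sum of the first
  \<open>i + 1\<close> members, on which the operator is bounded below by \<open>l i\<close>. If \<open>D\<close> had \<open>\<parallel>T D\<parallel> < l i\<close>, then \<open>\<parallel>Q D\<parallel> < 1\<close>, and
  by comparison of traces \<open>tr D \<le> 1 - tr Q\<close>, which is too small.\<close>

lemma mu_simple_bounds:
  assumes P: "opart J P" and E: "opart {..<K} E" and trE: "\<And>i. i < K \<Longrightarrow> tr (E i) = 1 / real K"
    and comm: "\<And>j i. j \<in> J \<Longrightarrow> i < K \<Longrightarrow> P j o\<^sub>L E i = E i o\<^sub>L P j"
    and sandwich: "\<And>j i. j \<in> J \<Longrightarrow> i < K \<Longrightarrow> P j o\<^sub>L E i \<noteq> 0 \<Longrightarrow> l i \<le> a j \<and> a j \<le> u i"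
    and l0: "\<And>i. i < K \<Longrightarrow> 0 \<le> l i"
    and ldec: "\<And>i j. i \<le> j \<Longrightarrow> j < K \<Longrightarrow> l j \<le> l i" and udec: "\<And>i j. i \<le> j \<Longrightarrow> j < K \<Longrightarrow> u j \<le> u i"
    and u0: "\<And>i. i < K \<Longrightarrow> 0 \<le> u i"
    and i: "i < K" and s: "real i / real K \<le> s" "s < real (Suc i) / real K"
  shows "l i \<le> mu s (simple_op J P a)" "mu s (simple_op J P a) \<le> u i"
proof -
  have K: "0 < K" using i by simp
  have s0: "0 \<le> s" using s(1) by (rule order_trans [rotated]) simp
  define G where "G = (\<lambda>(j, i). P j o\<^sub>L E i)"
  define A where "A = J \<times> {..<K}"
  define T where "T = simple_op J P a"
  note G = opart_product [OF P E, folded G_def A_def]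
  have pG: "opart A G" and TG: "T = simple_op A G (\<lambda>(j, i). a j)"
    and EG: "\<And>b. simple_op {..<K} E b = simple_op A G (\<lambda>(j, i). b i)"
    unfolding T_def using G(1) G(2) G(3) comm by auto
  have normT: "(norm (T x))\<^sup>2 = (\<Sum>(j, m)\<in>A. (a j)\<^sup>2 * (norm (P j (E m x)))\<^sup>2)" for x
    unfolding TG norm_simple_op_apply [OF pG] by (rule sum.cong) (auto simp: G_def)
  have normE: "(norm (simple_op {..<K} E b x))\<^sup>2 = (\<Sum>(j, m)\<in>A. (b m)\<^sup>2 * (norm (P j (E m x)))\<^sup>2)" for x b
    unfolding EG norm_simple_op_apply [OF pG] by (rule sum.cong) (auto simp: G_def)
  have bnd: "l m \<le> a j \<and> a j \<le> u m" if "j \<in> J" "m < K" "P j (E m x) \<noteq> 0" for j m x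
  proof (rule sandwich [OF that(1,2)])
    show "P j o\<^sub>L E m \<noteq> 0" using that(3) by (metis blinfun_apply_blinfun_compose zero_blinfun.rep_eq)
  qed
  have trS: "tr (simple_op {..<K} E b) = (\<Sum>m<K. b m) / real K" for b
  proof -
    have "tr (simple_op {..<K} E b) = (\<Sum>m<K. b m * tr (E m))"
      unfolding simple_op_def
      by (subst tr_sum) (auto intro!: sum.cong M_scaleR tr_scaleR projM_D(1) [OF opartD(2) [OF E]])
    also have "\<dots> = (\<Sum>m<K. b m) / real K"
      by (simp add: trE sum_divide_distrib)
    finally show ?thesis .
  qed
  have projS: "projM (simple_op {..<K} E (\<lambda>m. if m \<in> I then 1 else 0))" for I
  proof (rule projM_I [OF simple_op_M [OF E] simple_op_self_adjoint [OF E]])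
    show "simple_op {..<K} E (\<lambda>m. if m \<in> I then 1 else 0) o\<^sub>L simple_op {..<K} E (\<lambda>m. if m \<in> I then 1 else 0)
        = simple_op {..<K} E (\<lambda>m. if m \<in> I then 1 else 0)"
      unfolding simple_op_comp [OF E] by (rule arg_cong [of _ _ "simple_op {..<K} E"]) auto
  qed
  show "mu s (simple_op J P a) \<le> u i"
  proof -
    define F where "F = simple_op {..<K} E (\<lambda>m. if m \<in> {i..} then 1 else 0)"
    have pF: "projM F" unfolding F_def by (rule projS)
    have "id_blinfun - F = simple_op {..<K} E (\<lambda>m. if m \<in> {..<i} then 1 else 0)"
      unfolding F_def simple_op_one [OF E, symmetric] simple_op_diff
      by (rule arg_cong [of _ _ "simple_op {..<K} E"]) auto
    moreover have "(\<Sum>m<K. if m \<in> {..<i} then 1 else 0 :: real) = real i"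
    proof -
      have "{..<K} \<inter> {..<i} = {..<i}" using i by auto
      then show ?thesis by (simp add: sum.If_cases flip: lessThan_def)
    qed
    ultimately have "tr (id_blinfun - F) = real i / real K"
      using trS [of "\<lambda>m. if m \<in> {..<i} then 1 else 0"] by simp
    then have "F \<in> small_cokernel_proj s" using pF s by (simp add: small_cokernel_proj_def)
    moreover have "norm (T o\<^sub>L F) \<le> u i"
    proof (rule norm_blinfun_bound [OF u0 [OF i]])
      fix x
      define y where "y = F x"
      have Ey: "E m y = 0" if "m < i" for m
      proof -
        have "E m o\<^sub>L F = 0"
          using that i comp_simple_op [OF E, of m "\<lambda>m. if m \<in> {i..} then 1 else 0"] by (simp add: F_def)
        then show ?thesis unfolding y_def by (simp add: comp_eq_apply)
      qed
      have "(norm (T y))\<^sup>2 \<le> (\<Sum>(j, m)\<in>A. (u i)\<^sup>2 * (norm (P j (E m y)))\<^sup>2)"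
        unfolding normT
      proof (rule sum_mono, clarify)
        fix j m assume "(j, m) \<in> A"
        then have jm: "j \<in> J" "m < K" by (auto simp: A_def)
        show "(a j)\<^sup>2 * (norm (P j (E m y)))\<^sup>2 \<le> (u i)\<^sup>2 * (norm (P j (E m y)))\<^sup>2"
        proof (cases "P j (E m y) = 0")
          case False
          then have "i \<le> m" using Ey [of m] by (metis blinfun.zero_right not_le)
          then have "0 \<le> a j" "a j \<le> u i"
            using bnd [OF jm False] l0 [OF jm(2)] udec [OF _ jm(2)] by fastforce+
          then show ?thesis by (intro mult_right_mono power_mono) auto
        qed simp
      qed
      also have "\<dots> = (norm (u i *\<^sub>R y))\<^sup>2"
      proof -
        have "simple_op {..<K} E (\<lambda>_. u i) = u i *\<^sub>R id_blinfun"
          using simple_op_scaleR [of "u i" "{..<K}" E "\<lambda>_. 1"] by (simp add: simple_op_one [OF E])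
        then show ?thesis using normE [of "\<lambda>_. u i" y] by (simp add: blinfun.scaleR_left)
      qed
      finally have "norm (T y) \<le> norm (u i *\<^sub>R y)" by (rule power2_le_imp_le) simp
      also have "\<dots> = u i * norm y" using u0 [OF i] by simp
      also have "norm y \<le> 1 * norm x"
        unfolding y_def by (intro order_trans [OF norm_blinfun] mult_right_mono norm_projM_le pF) simp
      finally show "norm ((T o\<^sub>L F) x) \<le> u i * norm x"
        using u0 [OF i] by (simp add: y_def mult_left_mono)
    qed
    ultimately show ?thesis using mu_le [of F s T] by (simp add: T_def)
  qed
  show "l i \<le> mu s (simple_op J P a)"
    unfolding T_def [symmetric]
  proof (rule mu_ge [OF s0], rule ccontr)
    fix D assume "D \<in> small_cokernel_proj s"
    then have D: "projM D" "1 - tr D \<le> s" by (auto simp: small_cokernel_proj_def tr_complement)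
    assume "\<not> l i \<le> norm (T o\<^sub>L D)"
    then have less: "norm (T o\<^sub>L D) < l i" by simp
    then have li: "0 < l i" using norm_ge_zero [of "T o\<^sub>L D"] by linarith
    define Q where "Q = simple_op {..<K} E (\<lambda>m. if m \<in> {..i} then 1 else 0)"
    have pQ: "projM Q" unfolding Q_def by (rule projS)
    have "(\<Sum>m<K. if m \<in> {..i} then 1 else 0 :: real) = real (Suc i)"
    proof -
      have "{..<K} \<inter> {m. m \<le> i} = {..i}" using i by auto
      then show ?thesis by (simp add: sum.If_cases)
    qed
    then have trQ: "tr Q = real (Suc i) / real K"
      unfolding Q_def using trS [of "\<lambda>m. if m \<in> {..i} then 1 else 0"] by simp
    have QT: "l i * norm (Q x) \<le> norm (T x)" for x
    proof -
      have "(norm (l i *\<^sub>R Q x))\<^sup>2 = (norm (simple_op {..<K} E (\<lambda>m. if m \<in> {..i} then l i else 0) x))\<^sup>2"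
      proof -
        have "l i *\<^sub>R Q = simple_op {..<K} E (\<lambda>m. if m \<in> {..i} then l i else 0)"
          unfolding Q_def simple_op_scaleR by (rule arg_cong [of _ _ "simple_op {..<K} E"]) auto
        then show ?thesis by (metis blinfun.scaleR_left)
      qed
      also have "\<dots> \<le> (norm (T x))\<^sup>2"
        unfolding normT normE
      proof (rule sum_mono, clarify)
        fix j m assume "(j, m) \<in> A"
        then have jm: "j \<in> J" "m < K" by (auto simp: A_def)
        show "(if m \<in> {..i} then l i else 0)\<^sup>2 * (norm (P j (E m x)))\<^sup>2 \<le> (a j)\<^sup>2 * (norm (P j (E m x)))\<^sup>2"
        proof (cases "m \<le> i \<and> P j (E m x) \<noteq> 0")
          case True
          then have "l i \<le> a j" using bnd [OF jm] ldec [of m i] i by fastforce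
          then show ?thesis using True li by (intro mult_right_mono) (auto intro: power_mono)
        qed auto
      qed
      finally have "norm (l i *\<^sub>R Q x) \<le> norm (T x)" by (rule power2_le_imp_le) simp
      then show ?thesis using li by simp
    qed
    have "norm (Q o\<^sub>L D) \<le> norm (T o\<^sub>L D) / l i"
    proof (rule norm_blinfun_bound)
      fix x
      have "l i * norm (Q (D x)) \<le> norm ((T o\<^sub>L D) x)" using QT [of "D x"] by simp
      also have "\<dots> \<le> norm (T o\<^sub>L D) * norm x" by (rule norm_blinfun)
      finally show "norm ((Q o\<^sub>L D) x) \<le> norm (T o\<^sub>L D) / l i * norm x"
        using li by (simp add: field_simps)
    qed (use li in simp)
    also have "\<dots> < 1" using less li by simp
    finally have "norm ((id_blinfun - (id_blinfun - Q)) o\<^sub>L D) < 1" by simp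
    then have "tr D \<le> tr (id_blinfun - Q)"
      by (rule tr_le_of_norm_less [OF D(1) projM_complement [OF pQ]])
    then show False
      using D(2) trQ s(2) by (simp add: tr_complement [OF pQ])
  qed
qed

end


section \<open>Tracial gauge norms on simple operators\<close>

locale tracial_gauge = finite_vna +
  fixes N :: "'a op \<Rightarrow> real"
  assumes gauge: "tracial_gauge_norm M \<tau> N" and normalized: "normalized N"
begin

lemma N_scaleC: "T \<in> M \<Longrightarrow> N (scaleC_op c T) = cmod c * N T"
  and N_add: "S \<in> M \<Longrightarrow> T \<in> M \<Longrightarrow> N (S + T) \<le> N S + N T"
  and N_modulus: "T \<in> M \<Longrightarrow> N T = N (modulus_op T)"
  and N_equi: "S \<in> M \<Longrightarrow> T \<in> M \<Longrightarrow> positive_op S \<Longrightarrow> positive_op T \<Longrightarrow> equi_measurable \<tau> S T \<Longrightarrow> N S = N T"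
  and N_id: "N id_blinfun = 1"
  using gauge normalized unfolding tracial_gauge_norm_def norm_on_def normalized_def by blast+

lemma N_scaleR: "T \<in> M \<Longrightarrow> N (r *\<^sub>R T) = \<bar>r\<bar> * N T"
  using N_scaleC [of T "of_real r"] by (simp add: scaleC_op_of_real)

lemma N_sum: "(\<And>i. i \<in> I \<Longrightarrow> f i \<in> M) \<Longrightarrow> N (sum f I) \<le> (\<Sum>i\<in>I. N (f i))"
proof (induction I rule: infinite_finite_induct)
  case (insert i I)
  then show ?case using N_add [of "f i" "sum f I"] M_sum [of I f] by fastforce
qed (use N_scaleR [OF M_zero, of 0] in simp_all)

text \<open>The modulus of \<open>U T\<close> is that of \<open>T\<close>.\<close>

lemma N_isometry:
  assumes U: "U \<in> M" "adj U o\<^sub>L U = id_blinfun" and T: "T \<in> M"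
  shows "N (U o\<^sub>L T) = N T"
proof -
  have "adj (U o\<^sub>L T) o\<^sub>L (U o\<^sub>L T) = adj T o\<^sub>L ((adj U o\<^sub>L U) o\<^sub>L T)"
    using U(1) T by (simp add: adj_comp M_bounded_ops comp_assoc_blinfun)
  also have "\<dots> = adj T o\<^sub>L T" by (simp only: U(2) comp_id_left)
  finally have "modulus_op (U o\<^sub>L T) = modulus_op T" by (simp add: modulus_op_def)
  then show ?thesis using N_modulus [OF M_comp [OF U(1) T]] N_modulus [OF T] by simp
qed

text \<open>A positive contraction \<open>X\<close> is the mean of the two unitaries \<open>X \<plusminus> i (1 - X\<^sup>2)\<^sup>1\<^sup>/\<^sup>2\<close>.\<close>

lemma N_positive_contraction:
  assumes X: "X \<in> M" "positive_op X" "norm X \<le> 1"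
  shows "N X \<le> 1"
proof -
  have saX: "self_adjoint_op X" using X by (simp add: positive_self_adjoint)
  have XX: "X o\<^sub>L X \<in> M" "self_adjoint_op (X o\<^sub>L X)"
    using X saX by (auto intro: M_comp self_adjoint_comp)
  have "positive_op (id_blinfun - (X o\<^sub>L X))"
    unfolding positive_iff
  proof (intro conjI allI self_adjoint_diff self_adjoint_id XX)
    fix x
    have "norm (X x) \<le> 1 * norm x"
      by (rule order_trans [OF norm_blinfun mult_right_mono [OF X(3)]]) simp
    then have "(norm (X x))\<^sup>2 \<le> (norm x)\<^sup>2" by (simp add: power_mono)
    then show "0 \<le> rip ((id_blinfun - (X o\<^sub>L X)) x) x"
      by (simp add: blinfun.diff_left rip_simps rip_self self_adjointD [OF saX, of "X x"]
          flip: self_adjointD [OF saX, of x "X x"])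
  qed
  then obtain V where V: "V \<in> M" "positive_op V" "V o\<^sub>L V = id_blinfun - (X o\<^sub>L X)"
    "\<And>C. C o\<^sub>L (id_blinfun - (X o\<^sub>L X)) = (id_blinfun - (X o\<^sub>L X)) o\<^sub>L C \<Longrightarrow> C o\<^sub>L V = V o\<^sub>L C"
    by (rule sqrt_exists [OF M_diff [OF M_id XX(1)]]) (rule that)
  have saV: "self_adjoint_op V" using V(2) by (rule positive_self_adjoint)
  have XV: "X (V x) = V (X x)" for x
    by (rule comm_apply [OF V(4)]) (simp add: op_simps)
  have VV: "V (V x) = x - X (X x)" for x
    using comp_eq_apply [OF V(3)] by (simp add: blinfun.diff_left)
  define W where "W c = X + scaleC_op c V" for c
  have WM: "W c \<in> M" for c by (simp add: W_def M_add M_scaleC X(1) V(1))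
  have W_apply: "W c x = X x + c *\<^sub>C V x" for c x
    by (simp add: W_def blinfun.add_left scaleC_op.rep_eq)
  have linX: "X (c *\<^sub>C x) = c *\<^sub>C X x" and linV: "V (c *\<^sub>C x) = c *\<^sub>C V x" for c x
    using X(1) V(1) by (simp_all add: bounded_ops_scaleC M_bounded_ops)
  have N1: "N (W c) = 1" if c: "cnj c = - c" "c * c = -1" for c
  proof -
    have "adj (W c) = W (- c)"
    proof (rule adj_eqI)
      fix x y
      have "rip (c *\<^sub>C V x) y = rip x (V ((- c) *\<^sub>C y))"
        using rip_scaleC [of "V x" "- c" y] c self_adjointD [OF saV, of x] linV by simp
      then show "rip (W c x) y = rip x (W (- c) y)"
        by (simp add: W_apply rip_simps self_adjointD [OF saX] linV)
    qed (simp_all add: M_bounded_ops WM)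
    moreover have "W (- c) o\<^sub>L W c = id_blinfun"
    proof (rule blinfun_eqI)
      fix x
      have "(- c) *\<^sub>C (c *\<^sub>C V (V x)) = V (V x)"
        using scaleR_scaleC [of 1 "V (V x)"] c by (simp add: scaleC_scaleC)
      moreover have "c *\<^sub>C V (X x) + (- c) *\<^sub>C V (X x) = 0"
        using scaleR_scaleC [of 0 "V (X x)"] by (simp add: scaleC_add_left [symmetric])
      moreover have "(W (- c) o\<^sub>L W c) x
          = (X (X x) + (- c) *\<^sub>C (c *\<^sub>C V (V x))) + (c *\<^sub>C V (X x) + (- c) *\<^sub>C V (X x))"
        by (simp add: W_apply blinfun.add_right scaleC_add_right linX linV XV ac_simps)
      ultimately show "(W (- c) o\<^sub>L W c) x = id_blinfun x"
        by (simp only: VV id_blinfun.rep_eq id_apply) simp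
    qed
    ultimately show ?thesis
      using N_isometry [OF WM, of c id_blinfun] M_id N_id by (simp add: op_simps)
  qed
  have "X + X = W \<i> + W (- \<i>)"
  proof (rule blinfun_eqI)
    fix x
    have "\<i> *\<^sub>C V x + (- \<i>) *\<^sub>C V x = 0"
      using scaleR_scaleC [of 0 "V x"] by (simp add: scaleC_add_left [symmetric])
    then show "(X + X) x = (W \<i> + W (- \<i>)) x"
      by (simp add: W_apply blinfun.add_left algebra_simps)
  qed
  then have "N (2 *\<^sub>R X) \<le> N (W \<i>) + N (W (- \<i>))"
    using N_add [OF WM WM] by (simp add: scaleR_2)
  then show ?thesis using N1 [of "\<i>"] N1 [of "- \<i>"] N_scaleR [OF X(1), of 2] by simp
qed

lemma N_le_norm:
  assumes T: "T \<in> M" shows "N T \<le> norm T"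
proof (cases "T = 0")
  case True
  then show ?thesis using N_scaleR [OF M_zero, of 0] by simp
next
  case False
  have nT: "norm (modulus_op T) = norm T"
    using norm_modulus_apply [OF T] by (simp add: norm_blinfun.rep_eq onorm_def)
  define X where "X = (1 / norm T) *\<^sub>R modulus_op T"
  have "N X \<le> 1"
    using modulus(1,2) [OF T] False nT unfolding X_def
    by (intro N_positive_contraction)
      (auto simp: M_scaleR positive_iff self_adjoint_scaleR blinfun.scaleR_left rip_simps)
  then show ?thesis
    using False N_modulus [OF T] N_scaleR [OF modulus(1) [OF T]] by (simp add: X_def divide_le_eq)
qed

text \<open>This continuity lets simple approximations in operator norm stand in for the operators.\<close>

lemma N_lipschitz: "S \<in> M \<Longrightarrow> T \<in> M \<Longrightarrow> N S \<le> N T + norm (S - T)"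
  using N_add [of T "S - T"] N_le_norm [of "S - T"] M_diff [of S T] by simp

text \<open>The operator with one lowered coefficient is a convex combination of the original one and its image
  under the symmetry that flips the sign on that member.\<close>

lemma N_simple_lower_one:
  assumes G: "opart J G" and j: "j \<in> J" and c: "0 \<le> c" "c \<le> y j"
  shows "N (simple_op J G (y(j := c))) \<le> N (simple_op J G y)"
proof (cases "y j = 0")
  case True
  then have "y(j := c) = y" using c by auto
  then show ?thesis by simp
next
  case False
  define t where "t = (1 + c / y j) / 2"
  have t: "0 \<le> t" "t \<le> 1" using c False by (simp_all add: t_def divide_le_eq)
  define U where "U = simple_op J G ((\<lambda>_. 1)(j := -1))"
  define T where "T = simple_op J G y"
  have UM: "U \<in> M" and TM: "T \<in> M" unfolding U_def T_def using simple_op_M [OF G] by simp_all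
  have "U o\<^sub>L U = simple_op J G (\<lambda>_. 1)"
    unfolding U_def simple_op_comp [OF G] by (rule arg_cong [of _ _ "simple_op J G"]) auto
  then have UU: "adj U o\<^sub>L U = id_blinfun"
    using simple_op_self_adjoint [OF G] simple_op_one [OF G] by (simp add: U_def adj_self_adjoint)
  have tc: "t * y j + (1 - t) * (- y j) = c" using False by (simp add: t_def field_simps)
  have "simple_op J G (y(j := c)) = t *\<^sub>R T + (1 - t) *\<^sub>R (U o\<^sub>L T)"
    unfolding U_def T_def simple_op_comp [OF G] simple_op_scaleR simple_op_add
  proof (rule arg_cong [of _ _ "simple_op J G"], rule ext)
    fix i show "(y(j := c)) i = t * y i + (1 - t) * (((\<lambda>_. 1)(j := - 1)) i * y i)"
      using tc by (cases "i = j") (simp_all add: algebra_simps)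
  qed
  then have "N (simple_op J G (y(j := c))) \<le> N (t *\<^sub>R T) + N ((1 - t) *\<^sub>R (U o\<^sub>L T))"
    using N_add M_scaleR M_comp UM TM by simp
  also have "\<dots> = t * N T + (1 - t) * N T"
    using t by (simp add: N_scaleR TM M_comp UM N_isometry [OF UM UU TM])
  finally show ?thesis by (simp add: T_def algebra_simps)
qed

lemma N_simple_mono:
  assumes G: "opart J G" and xy: "\<And>j. j \<in> J \<Longrightarrow> G j \<noteq> 0 \<Longrightarrow> 0 \<le> x j \<and> x j \<le> y j"
  shows "N (simple_op J G x) \<le> N (simple_op J G y)"
proof -
  define x' y' where "x' j = (if G j = 0 then 0 else x j)" and "y' j = (if G j = 0 then 0 else y j)" for j
  have cong: "simple_op J G x = simple_op J G x'" "simple_op J G y = simple_op J G y'"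
    unfolding simple_op_def x'_def y'_def by (auto intro!: sum.cong)
  have fin: "finite J" using opartD(1) [OF G] .
  have "N (simple_op J G (\<lambda>j. if j \<in> A then x' j else y' j)) \<le> N (simple_op J G y')" if "A \<subseteq> J" for A
    using finite_subset [OF that fin] that
  proof (induction A)
    case (insert j A)
    define z where "z i = (if i \<in> A then x' i else y' i)" for i
    have "(\<lambda>i. if i \<in> insert j A then x' i else y' i) = z(j := x' j)"
      by (auto simp: z_def)
    moreover have "N (simple_op J G (z(j := x' j))) \<le> N (simple_op J G z)"
      using insert xy [of j] by (intro N_simple_lower_one [OF G]) (auto simp: z_def x'_def y'_def)
    moreover have "z = (\<lambda>i. if i \<in> A then x' i else y' i)" by (rule ext) (simp add: z_def)
    ultimately show ?case using insert by (auto intro: order_trans)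
  qed simp
  from this [OF order_refl] have "N (simple_op J G x') \<le> N (simple_op J G y')"
  proof -
    have "simple_op J G (\<lambda>j. if j \<in> J then x' j else y' j) = simple_op J G x'"
      unfolding simple_op_def by (intro sum.cong) auto
    then show ?thesis using \<open>N (simple_op J G (\<lambda>j. if j \<in> J then x' j else y' j)) \<le> _\<close> by simp
  qed
  then show ?thesis by (simp add: cong)
qed

lemma N_simple_equi:
  assumes G: "opart J G" and H: "opart I H"
    and a: "\<And>j. j \<in> J \<Longrightarrow> 0 \<le> a j" and b: "\<And>i. i \<in> I \<Longrightarrow> 0 \<le> b i"
    and mom: "\<And>n. (\<Sum>j\<in>J. a j ^ n * tr (G j)) = (\<Sum>i\<in>I. b i ^ n * tr (H i))"
  shows "N (simple_op J G a) = N (simple_op I H b)"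
proof (rule N_equi)
  show "equi_measurable \<tau> (simple_op J G a) (simple_op I H b)"
    unfolding equi_measurable_def opart_tr_power [OF G] opart_tr_power [OF H]
    using mom by (simp flip: of_real_mult of_real_power of_real_sum)
qed (use G H a b in \<open>simp_all add: simple_op_M simple_op_positive\<close>)

definition unif :: "nat \<Rightarrow> (nat \<Rightarrow> 'a op) \<Rightarrow> bool" where
  "unif K E \<longleftrightarrow> opart {..<K} E \<and> (\<forall>i<K. tr (E i) = 1 / real K)"

text \<open>The partition is chosen arbitrarily: on nonnegative vectors the value does not depend on it, because
  the corresponding simple operators are equi-measurable.\<close>

definition nrm :: "nat \<Rightarrow> (nat \<Rightarrow> real) \<Rightarrow> real" where
  "nrm K x = N (simple_op {..<K} (SOME E. unif K E) x)"

lemma unif_exists: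
  assumes "divisible K" shows "\<exists>E. unif K E"
proof -
  have "opart {..<1::nat} (\<lambda>_. id_blinfun)"
    by (simp add: opart_def projM_id)
  then obtain E where "opart {..<K} E" "\<And>i. i < K \<Longrightarrow> tr (E i) = 1 / real K"
    using assms by (rule adapted_partition) (rule that)
  then show ?thesis by (auto simp: unif_def)
qed

lemma unif_some: "divisible K \<Longrightarrow> unif K (SOME E. unif K E)"
  using unif_exists by (rule someI_ex)

lemma opart_some: "divisible K \<Longrightarrow> opart {..<K} (SOME E. unif K E)"
  using unif_some by (simp add: unif_def)

lemma N_unif_equi:
  assumes "unif K E" "unif L F" "\<And>i. i < K \<Longrightarrow> 0 \<le> x i" "\<And>i. i < L \<Longrightarrow> 0 \<le> y i"
    and "\<And>n. (\<Sum>i<K. x i ^ n) / real K = (\<Sum>i<L. y i ^ n) / real L"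
  shows "N (simple_op {..<K} E x) = N (simple_op {..<L} F y)"
proof (rule N_simple_equi)
  fix n
  have "(\<Sum>i<K. x i ^ n * tr (E i)) = (\<Sum>i<K. x i ^ n) / real K"
    using assms(1) by (simp add: unif_def sum_divide_distrib)
  moreover have "(\<Sum>i<L. y i ^ n * tr (F i)) = (\<Sum>i<L. y i ^ n) / real L"
    using assms(2) by (simp add: unif_def sum_divide_distrib)
  ultimately show "(\<Sum>i<K. x i ^ n * tr (E i)) = (\<Sum>i<L. y i ^ n * tr (F i))"
    using assms(5) by simp
qed (use assms in \<open>auto simp: unif_def\<close>)

lemma nrm_eq: "unif K E \<Longrightarrow> divisible K \<Longrightarrow> (\<And>i. i < K \<Longrightarrow> 0 \<le> x i) \<Longrightarrow> N (simple_op {..<K} E x) = nrm K x"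
  unfolding nrm_def by (rule N_unif_equi) (auto simp: unif_some)

lemma nrm_add: "divisible K \<Longrightarrow> nrm K (\<lambda>i. x i + y i) \<le> nrm K x + nrm K y"
  unfolding nrm_def simple_op_add [symmetric] by (intro N_add simple_op_M opart_some)

lemma nrm_scale: "divisible K \<Longrightarrow> nrm K (\<lambda>i. c * x i) = \<bar>c\<bar> * nrm K x"
  unfolding nrm_def simple_op_scaleR [symmetric] by (intro N_scaleR simple_op_M opart_some)

lemma nrm_cong: "(\<And>i. i < K \<Longrightarrow> x i = y i) \<Longrightarrow> nrm K x = nrm K y"
  unfolding nrm_def simple_op_def by (rule arg_cong [of _ _ N]) (auto intro: sum.cong)

lemma nrm_mono: "divisible K \<Longrightarrow> (\<And>i. i < K \<Longrightarrow> 0 \<le> x i \<and> x i \<le> y i) \<Longrightarrow> nrm K x \<le> nrm K y"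
  unfolding nrm_def by (intro N_simple_mono opart_some) auto

lemma nrm_one: "divisible K \<Longrightarrow> nrm K (\<lambda>_. 1) = 1"
  unfolding nrm_def by (simp add: simple_op_one opart_some N_id)

lemma nrm_sum: "divisible K \<Longrightarrow> nrm K (\<lambda>i. \<Sum>r\<in>R. f r i) \<le> (\<Sum>r\<in>R. nrm K (f r))"
proof -
  assume K: "divisible K"
  have "simple_op J G (\<lambda>i. \<Sum>r\<in>R. f r i) = (\<Sum>r\<in>R. simple_op J G (f r))" for J and G :: "nat \<Rightarrow> 'a op"
    unfolding simple_op_def scaleR_sum_left by (rule sum.swap)
  then show ?thesis
    unfolding nrm_def using K by (simp only:) (intro N_sum simple_op_M opart_some)
qed

lemma nrm_perm:
  assumes "divisible K" "bij_betw p {..<K} {..<K}" "\<And>i. i < K \<Longrightarrow> 0 \<le> x i"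
  shows "nrm K (\<lambda>i. x (p i)) = nrm K x"
  unfolding nrm_def
proof (rule N_unif_equi)
  show "0 \<le> x (p i)" if "i < K" for i
    using assms(2,3) that bij_betwE by fastforce
  show "(\<Sum>i<K. x (p i) ^ n) / real K = (\<Sum>i<K. x i ^ n) / real K" for n
    using sum.reindex_bij_betw [OF assms(2), of "\<lambda>i. x i ^ n"] by simp
qed (use assms unif_some in auto)

text \<open>Repeating every coefficient \<open>m\<close> times while dividing the traces by \<open>m\<close> does not change the moments.\<close>

lemma nrm_repeat:
  assumes "divisible n" "divisible (m * n)" "\<And>i. i < n \<Longrightarrow> 0 \<le> x i"
  shows "nrm (m * n) (\<lambda>i. x (i div m)) = nrm n x"
  unfolding nrm_def
proof (rule N_unif_equi)
  have m: "0 < m" using assms(2) by (auto simp: divisible_def)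
  show "0 \<le> x (i div m)" if "i < m * n" for i
    using assms(3) that by (simp add: less_mult_imp_div_less mult.commute)
  show "(\<Sum>i<m * n. x (i div m) ^ k) / real (m * n) = (\<Sum>i<n. x i ^ k) / real n" for k
  proof -
    have "(\<Sum>i<n * m. x (i div m) ^ k) = (\<Sum>j<n. \<Sum>i\<in>{j * m..<j * m + m}. x (i div m) ^ k)"
      by (rule sum.nat_group [symmetric])
    also have "\<dots> = (\<Sum>j<n. \<Sum>i\<in>{j * m..<j * m + m}. x j ^ k)"
    proof (intro sum.cong refl)
      fix j i assume "i \<in> {j * m..<j * m + m}"
      then have "i div m = j" by (intro div_nat_eqI) (auto simp: mult.commute)
      then show "x (i div m) ^ k = x j ^ k" by simp
    qed
    also have "\<dots> = real m * (\<Sum>i<n. x i ^ k)" by (simp add: sum_distrib_left)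
    finally show ?thesis using m by (simp add: mult.commute)
  qed
qed (use assms unif_some in auto)

text \<open>The vector of block means is the average of the images of \<open>l\<close> under the cyclic rotations inside the
  blocks, each of which has the same norm as \<open>l\<close>.\<close>

lemma nrm_block_average:
  assumes n: "divisible n" and mn: "divisible (m * n)" and l: "\<And>i. i < m * n \<Longrightarrow> 0 \<le> l i"
  shows "nrm n (\<lambda>j. (\<Sum>r<m. l (j * m + r)) / real m) \<le> nrm (m * n) l"
proof -
  have m: "0 < m" using mn by (auto simp: divisible_def)
  define c where "c j = (\<Sum>r<m. l (j * m + r)) / real m" for j
  define p where "p r i = (i div m) * m + (i + r) mod m" for r i :: nat
  have p_lt: "p r i < m * n" if "i < m * n" for r i
  proof -
    have "i div m < n" using that by (simp add: less_mult_imp_div_less mult.commute)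
    then have "i div m * m + m \<le> n * m"
      by (metis Suc_leI add.commute mult_Suc mult_le_mono1)
    then show ?thesis using m by (simp add: p_def mult.commute) (metis add_less_cancel_left mod_less_divisor order_less_le_trans)
  qed
  have rot: "a = b" if "a < m" "b < m" "(a + r) mod m = (b + r) mod m" for a b r
  proof -
    have "a \<le> b \<Longrightarrow> a = b" if "a < m" "b < m" "(a + r) mod m = (b + r) mod m" for a b
      using that mod_eq_dvd_iff_nat [of "a + r" "b + r" m] by (auto dest: dvd_imp_le)
    then show ?thesis using that by (metis nle_le)
  qed
  have bij: "bij_betw (p r) {..<m * n} {..<m * n}" for r
  proof -
    have "inj_on (p r) {..<m * n}"
    proof (rule inj_onI)
      fix i k assume eq: "p r i = p r k"
      have d: "p r i div m = i div m" "p r i mod m = (i + r) mod m" for i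
        unfolding p_def using m by (simp_all only: div_mult_self3 mod_mult_self3 mod_div_trivial mod_mod_trivial add_0_right)
      have "i div m = k div m" "(i + r) mod m = (k + r) mod m"
        using arg_cong [OF eq, of "\<lambda>j. j div m"] arg_cong [OF eq, of "\<lambda>j. j mod m"]
        by (simp_all only: d)
      moreover have "i mod m = k mod m"
        by (rule rot [of _ _ r]) (use m calculation in \<open>simp_all add: mod_add_left_eq\<close>)
      ultimately show "i = k" by (metis div_mult_mod_eq)
    qed
    moreover have "p r ` {..<m * n} \<subseteq> {..<m * n}" using p_lt by auto
    ultimately show ?thesis
      by (simp add: bij_betw_def endo_inj_surj)
  qed
  have avg: "c (i div m) = (1 / real m) * (\<Sum>r<m. l (p r i))" for i
  proof -
    have "bij_betw (\<lambda>r. (i + r) mod m) {..<m} {..<m}"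
    proof -
      have "inj_on (\<lambda>r. (i + r) mod m) {..<m}"
        by (rule inj_onI, rule rot [of _ _ i]) (simp_all add: add.commute)
      then show ?thesis using m by (simp add: bij_betw_def endo_inj_surj image_subset_iff)
    qed
    from sum.reindex_bij_betw [OF this, of "\<lambda>r. l (i div m * m + r)"]
    show ?thesis by (simp add: c_def p_def)
  qed
  have c0: "0 \<le> c j" if "j < n" for j
  proof -
    have "j * m + r < m * n" if "r < m" for r
    proof -
      have "j * m + r < Suc j * m" using that by simp
      also have "\<dots> \<le> n * m" using \<open>j < n\<close> by (intro mult_le_mono1) simp
      finally show ?thesis by (simp add: mult.commute)
    qed
    then show ?thesis unfolding c_def using l by (intro divide_nonneg_nonneg sum_nonneg) auto
  qed
  have "nrm n c = nrm (m * n) (\<lambda>i. c (i div m))"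
    by (rule nrm_repeat [OF n mn, symmetric]) (rule c0)
  also have "\<dots> = (1 / real m) * nrm (m * n) (\<lambda>i. \<Sum>r<m. l (p r i))"
    unfolding avg nrm_scale [OF mn] by simp
  also have "\<dots> \<le> (1 / real m) * (\<Sum>r<m. nrm (m * n) (\<lambda>i. l (p r i)))"
    by (intro mult_left_mono nrm_sum mn) simp
  also have "\<dots> = (1 / real m) * (\<Sum>r<m. nrm (m * n) l)"
    by (simp only: nrm_perm [where x = l, OF mn bij l])
  also have "\<dots> = nrm (m * n) l" using m by simp
  finally show ?thesis by (simp only: c_def [abs_def])
qed

end


section \<open>Supporting functionals of sublinear functions on finitely many coordinates\<close>

definition sublinear :: "((nat \<Rightarrow> real) \<Rightarrow> real) \<Rightarrow> bool" where
  "sublinear q \<longleftrightarrow> (\<forall>x y. q (\<lambda>i. x i + y i) \<le> q x + q y) \<and> (\<forall>c\<ge>0. \<forall>x. q (\<lambda>i. c * x i) = c * q x)"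

lemma sublinear_add: "sublinear q \<Longrightarrow> q (\<lambda>i. x i + y i) \<le> q x + q y"
  and sublinear_scale: "sublinear q \<Longrightarrow> 0 \<le> c \<Longrightarrow> q (\<lambda>i. c * x i) = c * q x"
  by (simp_all add: sublinear_def)

lemma sublinear_zero: "sublinear q \<Longrightarrow> q (\<lambda>i. 0) = 0"
  using sublinear_scale [of q 0 "\<lambda>_. 0"] by simp

lemma sublinear_minus: "sublinear q \<Longrightarrow> - q (\<lambda>i. - x i) \<le> q x"
  using sublinear_add [of q x "\<lambda>i. - x i"] sublinear_zero [of q] by simp

text \<open>The function \<open>inf {q (x + t v) - t q v | t \<ge> 0}\<close> is the largest sublinear function below
  \<open>q\<close> that is linear along \<open>v\<close> with the value \<open>q v\<close> at \<open>v\<close>.\<close>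

lemma sublinear_linearize:
  assumes q: "sublinear q"
  obtains q' where "sublinear q'" "\<And>x. q' x \<le> q x" "q' (\<lambda>i. - v i) \<le> - q v"
proof -
  define h where "h x t = q (\<lambda>i. x i + t * v i) - t * q v" for x t
  define q' where "q' x = Inf (h x ` {0..})" for x
  have lower: "- q (\<lambda>i. - x i) \<le> h x t" if "0 \<le> t" for x t
    using sublinear_add [OF q, of "\<lambda>i. x i + t * v i" "\<lambda>i. - x i"] sublinear_scale [OF q that, of v]
    by (simp add: h_def)
  have bdd: "bdd_below (h x ` {0..})" for x
    using lower by (auto intro!: bdd_belowI [where m = "- q (\<lambda>i. - x i)"])
  have le: "q' x \<le> h x t" if "0 \<le> t" for x t
    unfolding q'_def using that by (intro cInf_lower bdd) auto
  have ge: "c \<le> q' x" if "\<And>t. 0 \<le> t \<Longrightarrow> c \<le> h x t" for c x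
    unfolding q'_def using that by (intro cInf_greatest) auto
  have le_q: "q' x \<le> q x" for x
    using le [of 0 x] by (simp add: h_def)
  have add: "q' (\<lambda>i. x i + y i) \<le> q' x + q' y" for x y
  proof -
    have "q' (\<lambda>i. x i + y i) \<le> h x s + h y t" if "0 \<le> s" "0 \<le> t" for s t
    proof -
      have "q' (\<lambda>i. x i + y i) \<le> h (\<lambda>i. x i + y i) (s + t)" using that by (intro le) simp
      also have "\<dots> \<le> h x s + h y t"
        using sublinear_add [OF q, of "\<lambda>i. x i + s * v i" "\<lambda>i. y i + t * v i"]
        by (simp add: h_def algebra_simps)
      finally show ?thesis .
    qed
    then have "q' (\<lambda>i. x i + y i) - h y t \<le> q' x" if "0 \<le> t" for t
      using that by (intro ge) (simp add: algebra_simps)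
    then have "q' (\<lambda>i. x i + y i) - q' x \<le> q' y"
      by (intro ge) (simp add: algebra_simps)
    then show ?thesis by simp
  qed
  have scale_le: "q' (\<lambda>i. c * x i) \<le> c * q' x" if c: "0 < c" for c x
  proof -
    have "q' (\<lambda>i. c * x i) / c \<le> h x t" if "0 \<le> t" for t
    proof -
      have "q' (\<lambda>i. c * x i) \<le> h (\<lambda>i. c * x i) (c * t)" using c that by (intro le) simp
      also have "\<dots> = c * h x t"
        using sublinear_scale [OF q, of c "\<lambda>i. x i + t * v i"] c by (simp add: h_def algebra_simps)
      finally show ?thesis using c by (simp add: divide_le_eq mult.commute)
    qed
    then have "q' (\<lambda>i. c * x i) / c \<le> q' x" by (rule ge)
    then show ?thesis using c by (simp add: divide_le_eq mult.commute)
  qed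
  have "sublinear q'"
    unfolding sublinear_def
  proof (intro conjI allI impI add)
    fix c :: real and x assume "0 \<le> c"
    show "q' (\<lambda>i. c * x i) = c * q' x"
    proof (cases "c = 0")
      case True
      have "0 \<le> q' (\<lambda>i. 0)" using lower [of _ "\<lambda>_. 0"] sublinear_zero [OF q] by (intro ge) simp
      moreover have "q' (\<lambda>i. 0) \<le> 0" using le_q [of "\<lambda>_. 0"] sublinear_zero [OF q] by simp
      ultimately show ?thesis using True by simp
    next
      case False
      then have c: "0 < c" using \<open>0 \<le> c\<close> by simp
      have "c * q' x \<le> q' (\<lambda>i. c * x i)"
        using scale_le [of "1 / c" "\<lambda>i. c * x i"] c by (simp add: field_simps)
      then show ?thesis using scale_le [OF c, of x] by simp
    qed
  qed
  moreover have "q' (\<lambda>i. - v i) \<le> - q v"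
    using le [of 1 "\<lambda>i. - v i"] sublinear_zero [OF q] by (simp add: h_def)
  ultimately show ?thesis using le_q that by blast
qed

text \<open>Linearise \<open>p\<close> along \<open>a\<close> and then along all coordinate directions. Linearity along a direction survives
  further lowering, so the result is linear on \<open>\<real>\<^sup>K\<close>, lies below \<open>p\<close> and agrees with it at \<open>a\<close>.\<close>

lemma supporting_functional:
  assumes p: "sublinear p" and cong: "\<And>x y. (\<And>i. i < K \<Longrightarrow> x i = y i) \<Longrightarrow> p x = p y"
  obtains \<phi> where "\<And>x. (\<Sum>i<K. \<phi> i * x i) \<le> p x" "(\<Sum>i<K. \<phi> i * a i) = p a"
proof -
  define e :: "nat \<Rightarrow> nat \<Rightarrow> real" where "e j = (\<lambda>i. if i = j then 1 else 0)" for j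
  obtain q0 where q0: "sublinear q0" "\<And>x. q0 x \<le> p x" "q0 (\<lambda>i. - a i) \<le> - p a"
    using sublinear_linearize [OF p, of a] by metis
  have "\<exists>q. sublinear q \<and> (\<forall>x. q x \<le> q0 x) \<and> (\<forall>j<m. q (\<lambda>i. - e j i) \<le> - q (e j))" for m
  proof (induction m)
    case 0
    show ?case using q0(1) by (intro exI [of _ q0]) simp
  next
    case (Suc m)
    then obtain q where q: "sublinear q" "\<forall>x. q x \<le> q0 x" "\<forall>j<m. q (\<lambda>i. - e j i) \<le> - q (e j)"
      by blast
    obtain q' where q': "sublinear q'" "\<And>x. q' x \<le> q x" "q' (\<lambda>i. - e m i) \<le> - q (e m)"
      using sublinear_linearize [OF q(1), of "e m"] by metis
    have "q' (\<lambda>i. - e j i) \<le> - q' (e j)" if "j < Suc m" for j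
    proof (cases "j = m")
      case True
      then show ?thesis using q'(2) [of "e m"] q'(3) by simp
    next
      case False
      then have "q (\<lambda>i. - e j i) \<le> - q (e j)" using q(3) that by simp
      then show ?thesis using q'(2) [of "e j"] q'(2) [of "\<lambda>i. - e j i"] by linarith
    qed
    then show ?case using q(2) q'(1,2) order_trans by (intro exI [of _ q']) blast
  qed
  then obtain q where q: "sublinear q" "\<forall>x. q x \<le> q0 x" "\<forall>j<K. q (\<lambda>i. - e j i) \<le> - q (e j)"
    by blast
  define \<phi> where "\<phi> j = q (e j)" for j
  have coord: "q (\<lambda>i. c * e j i) = c * \<phi> j" if "j < K" for c j
  proof (cases "0 \<le> c")
    case True
    then show ?thesis using sublinear_scale [OF q(1)] by (simp add: \<phi>_def)
  next
    case False
    have "q (\<lambda>i. - e j i) = - \<phi> j"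
      using q(3) that sublinear_minus [OF q(1), of "e j"] by (auto simp: \<phi>_def intro: antisym)
    then show ?thesis
      using sublinear_scale [OF q(1), of "- c" "\<lambda>i. - e j i"] False by simp
  qed
  have sums: "q (\<lambda>i. \<Sum>j<m. x j * e j i) \<le> (\<Sum>j<m. x j * \<phi> j)" if "m \<le> K" for x m
    using that
  proof (induction m)
    case 0
    show ?case using sublinear_zero [OF q(1)] by simp
  next
    case (Suc m)
    then show ?case
      using sublinear_add [OF q(1), of "\<lambda>i. \<Sum>j<m. x j * e j i" "\<lambda>i. x m * e m i"] coord [of m "x m"]
      by simp
  qed
  have bound: "(\<Sum>i<K. \<phi> i * x i) \<le> p x" for x
  proof -
    define z where "z i = (\<Sum>j<K. - x j * e j i)" for i
    have z: "z i = - x i" if "i < K" for i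
      using that by (simp add: z_def e_def if_distrib [of "(*) _"] cong: if_cong)
    have "q z \<le> - (\<Sum>i<K. \<phi> i * x i)"
      using sums [of K "\<lambda>j. - x j"] by (simp add: z_def [abs_def] sum_negf mult.commute)
    then have "(\<Sum>i<K. \<phi> i * x i) \<le> - q z" by simp
    also have "\<dots> \<le> q (\<lambda>i. - z i)"
      using sublinear_minus [OF q(1), of "\<lambda>i. - z i"] by simp
    also have "\<dots> \<le> p (\<lambda>i. - z i)" using q(2) q0(2) order_trans by blast
    also have "\<dots> = p x" by (rule cong) (simp add: z)
    finally show ?thesis .
  qed
  have "p a \<le> (\<Sum>i<K. \<phi> i * a i)"
  proof -
    define z where "z i = (\<Sum>j<K. a j * e j i)" for i
    have z: "z i = a i" if "i < K" for i
      using that by (simp add: z_def e_def if_distrib [of "(*) _"] cong: if_cong)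
    \<comment> \<open>\<open>q\<close> may see coordinates beyond \<open>K\<close>, but \<open>p\<close>, and hence \<open>q\<close> on differences that \<open>p\<close> ignores, does not.\<close>
    have "q (\<lambda>i. - z i) \<le> q (\<lambda>i. - a i) + q (\<lambda>i. a i - z i)"
      using sublinear_add [OF q(1), of "\<lambda>i. - a i" "\<lambda>i. a i - z i"] by simp
    also have "q (\<lambda>i. a i - z i) \<le> p (\<lambda>i. a i - z i)" using q(2) q0(2) order_trans by blast
    also have "\<dots> = p (\<lambda>i. 0)" by (rule cong) (simp add: z)
    finally have "q (\<lambda>i. - z i) \<le> - p a"
      using q(2) [rule_format, of "\<lambda>i. - a i"] q0(3) sublinear_zero [OF p] by linarith
    moreover have "- q z \<le> q (\<lambda>i. - z i)"
      using sublinear_minus [OF q(1), of "\<lambda>i. - z i"] by simp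
    ultimately have "p a \<le> q z" by linarith
    also have "\<dots> \<le> (\<Sum>i<K. \<phi> i * a i)"
      using sums [of K a] by (simp add: z_def [abs_def] mult.commute)
    finally show ?thesis .
  qed
  then show ?thesis by (rule that [OF bound antisym [OF bound]])
qed

section \<open>Step functions and integrals\<close>

text \<open>The cells are half open; the point \<open>1\<close> lies in none of them and is a null set.\<close>

lemma cell_unique:
  assumes "0 < K" "real i / real K \<le> s" "s < real (Suc i) / real K"
    "real j / real K \<le> s" "s < real (Suc j) / real K"
  shows "i = j"
proof -
  have "real i / real K < real (Suc j) / real K" "real j / real K < real (Suc i) / real K"
    using assms by linarith+
  then have "real i < real (Suc j)" "real j < real (Suc i)"
    using assms(1) by (simp_all add: divide_less_cancel)
  then show ?thesis by linarith
qed

lemma cell_exists: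
  assumes "0 < K" "0 \<le> s" "s < 1"
  obtains i where "i < K" "real i / real K \<le> s" "s < real (Suc i) / real K"
proof -
  define i where "i = nat \<lfloor>s * real K\<rfloor>"
  have "0 \<le> s * real K" using assms by simp
  then have i: "real i = of_int \<lfloor>s * real K\<rfloor>" by (simp add: i_def)
  then have "real i \<le> s * real K" "s * real K < real (Suc i)" by linarith+
  moreover have "s * real K < real K" using assms by simp
  ultimately have "real i < real K" "real i / real K \<le> s" "s < real (Suc i) / real K"
    using assms(1) by (linarith, simp_all add: divide_le_eq less_divide_eq)
  then show ?thesis by (intro that [of i]) simp_all
qed

lemma set_integral_step_le:
  assumes K: "0 < K" and h: "set_integrable lborel {0..1} h"
    and le: "\<And>i s. i < K \<Longrightarrow> real i / real K \<le> s \<Longrightarrow> s < real (Suc i) / real K \<Longrightarrow> h s \<le> c i"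
  shows "(LBINT s:{0..1}. h s) \<le> (\<Sum>i<K. c i) / real K"
proof -
  define I where "I i = {real i / real K..<real (Suc i) / real K}" for i
  define g where "g s = (\<Sum>i<K. c i * indicat_real (I i) s)" for s
  have I: "emeasure lborel (I i) = ennreal (1 / real K)" "measure lborel (I i) = 1 / real K" for i
    by (simp_all add: I_def divide_right_mono diff_divide_distrib [symmetric] measure_def)
  have int_I: "integrable lborel (indicat_real (I i))" for i
    using I(1) [of i] by (simp add: I_def)
  have g: "integrable lborel g"
    unfolding g_def by (intro Bochner_Integration.integrable_sum integrable_mult_right int_I)
  have "(LBINT s:{0..1}. h s) \<le> integral\<^sup>L lborel g"
    unfolding set_lebesgue_integral_def
  proof (rule integral_mono_AE [OF h [unfolded set_integrable_def] g])
    have "indicat_real {0..1} s *\<^sub>R h s \<le> g s" if "s \<noteq> 1" for s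
    proof (cases "0 \<le> s \<and> s < 1")
      case True
      obtain i where i: "i < K" "real i / real K \<le> s" "s < real (Suc i) / real K"
        using K conjunct1 [OF True] conjunct2 [OF True] by (rule cell_exists) (rule that)
      have "g s = (\<Sum>j<K. if j = i then c i else 0)"
        unfolding g_def
      proof (rule sum.cong [OF refl])
        fix j assume "j \<in> {..<K}"
        have in_i: "s \<in> I i" using i(2,3) by (simp only: I_def atLeastLessThan_iff)
        have in_j: "j = i" if "s \<in> I j"
          using that unfolding I_def atLeastLessThan_iff
          by (elim conjE) (rule cell_unique [OF K i(2,3), symmetric])
        show "c j * indicat_real (I j) s = (if j = i then c i else 0)"
        proof (cases "j = i")
          case True
          then show ?thesis using in_i by simp
        next
          case False
          then have "s \<notin> I j" using in_j by blast
          then show ?thesis using False by simp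
        qed
      qed
      then have "g s = c i" using i(1) by simp
      moreover have "s \<in> {0..1}" using True by simp
      ultimately show ?thesis using le [OF i] by (simp only: indicator_simps scaleR_one)
    next
      case False
      have "s \<notin> I i" if "i < K" for i
      proof -
        have "0 \<le> real i / real K" "real (Suc i) / real K \<le> 1" using that by simp_all
        then show ?thesis using False unfolding I_def atLeastLessThan_iff by linarith
      qed
      then have "g s = 0" by (simp add: g_def)
      then show ?thesis using False that by (auto simp: indicator_def)
    qed
    then show "AE s in lborel. indicat_real {0..1} s *\<^sub>R h s \<le> g s"
      using AE_lborel_singleton [of "1::real"] by (auto elim: eventually_mono)
  qed
  also have "integral\<^sup>L lborel g = (\<Sum>i<K. c i) / real K"
    unfolding g_def
    by (subst Bochner_Integration.integral_sum) (auto intro!: integrable_mult_right int_I simp: I sum_divide_distrib)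
  finally show ?thesis .
qed

lemma set_integral_step_ge:
  assumes K: "0 < K" and h: "set_integrable lborel {0..1} h"
    and ge: "\<And>i s. i < K \<Longrightarrow> real i / real K \<le> s \<Longrightarrow> s < real (Suc i) / real K \<Longrightarrow> c i \<le> h s"
  shows "(\<Sum>i<K. c i) / real K \<le> (LBINT s:{0..1}. h s)"
proof -
  have "(LBINT s:{0..1}. - h s) \<le> (\<Sum>i<K. - c i) / real K"
  proof (rule set_integral_step_le [OF K])
    show "set_integrable lborel {0..1} (\<lambda>s. - h s)"
      using h by (simp add: set_integrable_def)
    show "- h s \<le> - c i" if "i < K" "real i / real K \<le> s" "s < real (Suc i) / real K" for i s
      using ge [OF that] by simp
  qed
  then show ?thesis
    using h by (simp add: set_lebesgue_integral_def sum_negf)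
qed

lemma step_fun_eq:
  assumes j: "j < n" and s: "real j / real n \<le> s" "s < real (Suc j) / real n"
  shows "step_fun n a s = a (Suc j)"
proof -
  have n: "0 < n" using j by simp
  have "s < 1"
  proof -
    have "real (Suc j) / real n \<le> 1" using j by simp
    then show ?thesis using s(2) by linarith
  qed
  have "step_fun n a s = (\<Sum>i=1..n. if i = Suc j then a (Suc j) else 0)"
    unfolding step_fun_def
  proof (rule sum.cong [OF refl])
    fix i assume "i \<in> {1..n}"
    then obtain k where k: "i = Suc k" "k < n" by (cases i) auto
    have "s \<in> (if i = n then {real (i - 1) / real n..1} else {real (i - 1) / real n..<real i / real n})
        \<longleftrightarrow> k = j"
      using cell_unique [OF n s, of k] k s \<open>s < 1\<close> by (auto split: if_splits simp: k)
    then show "a i * indicat_real (if i = n then {real (i - 1) / real n..1}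
         else {real (i - 1) / real n..<real i / real n}) s = (if i = Suc j then a (Suc j) else 0)"
      by (auto simp: indicator_def k(1))
  qed
  then show ?thesis using j by simp
qed

lemma step_fun_measurable: "step_fun n a \<in> borel_measurable borel"
  unfolding step_fun_def [abs_def]
  by (intro borel_measurable_sum borel_measurable_times borel_measurable_const borel_measurable_indicator)
    auto

lemma step_fun_bounded: "\<bar>step_fun n a s\<bar> \<le> (\<Sum>i=1..n. \<bar>a i\<bar>)"
  unfolding step_fun_def
  by (rule order_trans [OF sum_abs sum_mono]) (auto simp: abs_mult indicator_def)


section \<open>Sandwiching an operator between simple operators with equal traces\<close>

text \<open>A decreasing \<open>f\<close> with total mass at most \<open>K\<close> satisfies \<open>f i \<le> K / (i + 1)\<close>. If \<open>V\<close> has no jumps before \<open>j\<close>, all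
  remaining jumps are weighted by at most \<open>K / (j + 1)\<close>, and their sum is at most \<open>V 0\<close>.\<close>

lemma weighted_jumps_le:
  fixes f V :: "nat \<Rightarrow> real"
  assumes f0: "\<And>i. i < K \<Longrightarrow> 0 \<le> f i" and fdec: "\<And>i j. i \<le> j \<Longrightarrow> j < K \<Longrightarrow> f j \<le> f i"
    and fsum: "(\<Sum>i<K. f i) \<le> real K"
    and Vdec: "\<And>i. i < K \<Longrightarrow> V (Suc i) \<le> V i" and V0: "0 \<le> V K"
    and const: "\<And>i. i < j \<Longrightarrow> i < K \<Longrightarrow> V (Suc i) = V i"
  shows "(\<Sum>i<K. f i * (V i - V (Suc i))) \<le> real K * V 0 / real (Suc j)"
proof -
  have f_le: "real (Suc i) * f i \<le> real K" if "i < K" for i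
  proof -
    have "real (Suc i) * f i = (\<Sum>k<Suc i. f i)" by simp
    also have "\<dots> \<le> (\<Sum>k<Suc i. f k)" using that by (intro sum_mono fdec) auto
    also have "\<dots> \<le> (\<Sum>k<K. f k)" using that f0 by (intro sum_mono2) auto
    finally show ?thesis using fsum by linarith
  qed
  have "(\<Sum>i<K. f i * (V i - V (Suc i))) \<le> (\<Sum>i<K. real K / real (Suc j) * (V i - V (Suc i)))"
  proof (rule sum_mono)
    fix i assume "i \<in> {..<K}"
    then have i: "i < K" by simp
    show "f i * (V i - V (Suc i)) \<le> real K / real (Suc j) * (V i - V (Suc i))"
    proof (cases "i < j")
      case True
      then show ?thesis using const [OF True i] by simp
    next
      case False
      have "real (Suc j) * f i \<le> real (Suc i) * f i"
        using False f0 [OF i] by (intro mult_right_mono) simp_all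
      then have "f i \<le> real K / real (Suc j)"
        using f_le [OF i] by (simp add: pos_le_divide_eq mult.commute del: of_nat_Suc)
      then show ?thesis using Vdec [OF i] by (intro mult_right_mono) simp_all
    qed
  qed
  also have "\<dots> = real K / real (Suc j) * (V 0 - V K)"
    unfolding sum_distrib_left [symmetric]
    by (simp only: sum_lessThan_telescope')
  also have "\<dots> \<le> real K / real (Suc j) * V 0"
    using V0 by (intro mult_left_mono) simp_all
  finally show ?thesis by simp
qed

definition weight_seq :: "nat \<Rightarrow> (nat \<Rightarrow> real) \<Rightarrow> bool" where
  "weight_seq K f \<longleftrightarrow> (\<forall>i<K. 0 \<le> f i) \<and> (\<forall>i j. i \<le> j \<longrightarrow> j < K \<longrightarrow> f j \<le> f i) \<and> (\<Sum>i<K. f i) \<le> real K"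

context tracial_gauge
begin

text \<open>Sizes that have arbitrarily fine or, in the atomic case, exact multiples for which partitions into
  projections of equal trace exist.\<close>

definition refinable :: "nat \<Rightarrow> bool" where
  "refinable n \<longleftrightarrow> 0 < n \<and> ((\<forall>K>0. divisible K) \<or>
     (\<exists>K. divisible K \<and> (\<forall>P. projM P \<longrightarrow> (\<exists>i. tr P = real i / real K)) \<and> n dvd K))"

lemma refinable_one: "weak_dixmier M \<tau> \<Longrightarrow> refinable 1"
  using divisibility_dichotomy unfolding refinable_def by simp

lemma refinable_divisible:
  assumes "refinable n" shows "divisible n"
proof -
  have n: "0 < n" using assms by (simp add: refinable_def)
  have "divisible n" if div: "divisible K" and dvd: "n dvd K" for K
  proof -
    obtain m where K: "K = n * m" using dvd by (elim dvdE)
    have m: "0 < m" using div by (auto simp: divisible_def K)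
    have eq: "real i / real n = real (i * m) / real K" for i using m by (simp add: K)
    show ?thesis
      using div n unfolding divisible_def eq by blast
  qed
  then show ?thesis using assms n unfolding refinable_def by blast
qed

text \<open>Approximate the modulus of \<open>T\<close> by a simple operator and take a partition of size \<open>K\<close> adapted to it. On the
  \<open>i\<close>-th member let \<open>u\<close> and \<open>l\<close> be the largest and the smallest value that the simple operator takes on
  overlapping members. In the atomic case with \<open>K\<close> the grid size only one value occurs. In the diffuse case
  \<open>l i\<close> is at least \<open>u (i + 1)\<close>, and there are no jumps near \<open>0\<close>, where a weight could be large, once the
  first step of the simple operator spans many cells.\<close>

lemma sandwich:
  assumes T: "T \<in> M" and n: "refinable n" and e: "0 < e"
  obtains m l u where "0 < m" "refinable (m * n)" "\<And>i. i < m * n \<Longrightarrow> 0 \<le> l i"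
    "\<And>i j. i \<le> j \<Longrightarrow> j < m * n \<Longrightarrow> u j \<le> u i" "\<And>i. i < m * n \<Longrightarrow> 0 \<le> u i"
    "nrm (m * n) l \<le> N T + e" "N T \<le> nrm (m * n) u + e"
    "\<And>i s. i < m * n \<Longrightarrow> real i / real (m * n) \<le> s \<Longrightarrow> s < real (Suc i) / real (m * n) \<Longrightarrow>
       l i - e \<le> mu s T \<and> mu s T \<le> u i + e"
    "\<And>f. weight_seq (m * n) f \<Longrightarrow> (\<Sum>i<m * n. f i * (u i - l i)) \<le> real (m * n) * e"
proof -
  note result = that
  define A where "A = modulus_op T"
  have A: "A \<in> M" "positive_op A" using modulus [OF T] by (simp_all add: A_def)
  obtain k0 :: nat and P a where P: "opart {..<k0} P" and a0: "\<And>j. 0 \<le> a j"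
    and adec: "\<And>i j. i \<le> j \<Longrightarrow> j < k0 \<Longrightarrow> a j \<le> a i"
    and "\<And>k. k < k0 \<Longrightarrow> bicommutes A (P k)"
    and approx: "norm (A - simple_op {..<k0} P a) \<le> e"
    using A e by (rule simple_approximation) (rule that)
  define T' where "T' = simple_op {..<k0} P a"
  have T'M: "T' \<in> M" unfolding T'_def by (rule simple_op_M [OF P])
  define r where "r k = tr (\<Sum>i<k. P i)" for k
  have r_sum: "r k = (\<Sum>i<k. tr (P i))" if "k \<le> k0" for k
    unfolding r_def using that opartD(2) [OF P] by (intro tr_sum projM_D(1)) auto
  have r0: "r 0 = 0" by (simp add: r_def tr_zero)
  have r1: "r k0 = 1" unfolding r_def opartD(3) [OF P] by (rule tr_id)
  have k0: "0 < k0" using r0 r1 by (cases k0) auto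
  have rmono: "r i \<le> r j" if "i \<le> j" "j \<le> k0" for i j
    using that opartD(2) [OF P] tr_projM_nonneg by (simp add: r_sum) (intro sum_mono2; auto)
  define SU where "SU K i = {k. k < k0 \<and> real i / real K < r (Suc k)}" for K i :: nat
  define SL where "SL K i = {k. k < k0 \<and> r k < real (Suc i) / real K}" for K i :: nat
  define U where "U K i = Max (a ` SU K i)" for K i
  define L where "L K i = Min (a ` SL K i)" for K i
  have fin: "finite (SU K i)" "finite (SL K i)" for K i by (simp_all add: SU_def SL_def)
  have inSU: "k0 - 1 \<in> SU K i" if "i < K" for K i
    using that k0 r1 by (simp add: SU_def)
  have inSL: "0 \<in> SL K i" if "0 < K" for K i
    using that k0 r0 by (simp add: SL_def)
  have U_ge: "a k \<le> U K i" if "k \<in> SU K i" for K i k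
    unfolding U_def using that fin by (intro Max_ge) auto
  have L_le: "L K i \<le> a k" if "k \<in> SL K i" for K i k
    unfolding L_def using that fin by (intro Min_le) auto
  have U_in: "\<exists>k\<in>SU K i. U K i = a k" if "i < K" for K i
  proof -
    have "U K i \<in> a ` SU K i" unfolding U_def using inSU [OF that] fin by (intro Max_in) blast+
    then show ?thesis by blast
  qed
  have L_in: "\<exists>k\<in>SL K i. L K i = a k" if "0 < K" for K i
  proof -
    have "L K i \<in> a ` SL K i" unfolding L_def using inSL [OF that] fin by (intro Min_in) blast+
    then show ?thesis by blast
  qed
  have U0: "0 \<le> U K i" if "i < K" for K i using U_in [OF that] a0 by auto
  have L0: "0 \<le> L K i" if "0 < K" for K i using L_in [OF that, of i] a0 by auto
  have Udec: "U K j \<le> U K i" if ij: "i \<le> j" "j < K" for K i j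
  proof -
    obtain k where k: "k \<in> SU K j" "U K j = a k" using U_in ij(2) by blast
    have "real i / real K \<le> real j / real K" using ij by (intro divide_right_mono) auto
    then have "k \<in> SU K i" using k(1) by (simp add: SU_def)
    then show ?thesis using U_ge k(2) by simp
  qed
  have Ldec: "L K j \<le> L K i" if ij: "i \<le> j" "0 < K" for K i j
  proof -
    obtain k where k: "k \<in> SL K i" "L K i = a k" using L_in ij(2) by blast
    have "real (Suc i) / real K \<le> real (Suc j) / real K" using ij by (intro divide_right_mono) auto
    then have "k \<in> SL K j" using k(1) by (simp add: SL_def)
    then show ?thesis using L_le k(2) by simp
  qed
  have key: "nrm K (L K) \<le> N T + e \<and> N T \<le> nrm K (U K) + e \<and>
      (\<forall>i<K. \<forall>s. real i / real K \<le> s \<longrightarrow> s < real (Suc i) / real K \<longrightarrow>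
        L K i - e \<le> mu s T \<and> mu s T \<le> U K i + e)" if div: "divisible K" for K
  proof -
    have K: "0 < K" using div by (simp add: divisible_def)
    obtain E where E: "opart {..<K} E" and trE: "\<And>i. i < K \<Longrightarrow> tr (E i) = 1 / real K"
      and comm: "\<And>k i. k < k0 \<Longrightarrow> i < K \<Longrightarrow> P k o\<^sub>L E i = E i o\<^sub>L P k"
      and overlap': "\<And>k i. k < k0 \<Longrightarrow> i < K \<Longrightarrow> P k o\<^sub>L E i \<noteq> 0 \<Longrightarrow>
        tr (\<Sum>j<k. P j) < real (Suc i) / real K \<and> real i / real K < tr (\<Sum>j<Suc k. P j)"
      using P div by (rule adapted_partition) (rule that)
    note overlap = overlap' [folded r_def]
    have between: "L K i \<le> a k \<and> a k \<le> U K i" if "k < k0" "i < K" "P k o\<^sub>L E i \<noteq> 0" for k i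
      using overlap [OF that] that(1) by (intro conjI L_le U_ge) (simp_all add: SL_def SU_def)
    have unif: "unif K E" using E trE by (simp add: unif_def)
    define G where "G = (\<lambda>(k, i). P k o\<^sub>L E i)"
    define J where "J = {..<k0} \<times> {..<K}"
    note prod = opart_product [OF P E comm, folded G_def J_def]
    have G: "opart J G" and PG: "T' = simple_op J G (\<lambda>(k, i). a k)"
      and EG: "\<And>b. simple_op {..<K} E b = simple_op J G (\<lambda>(k, i). b i)"
      unfolding T'_def using prod by (simp_all only: lessThan_iff)
    have "N (simple_op {..<K} E (L K)) \<le> N T'"
      unfolding PG EG using between L0 [OF K] by (intro N_simple_mono [OF G]) (auto simp: J_def G_def)
    then have lower: "nrm K (L K) \<le> N T'" using nrm_eq [OF unif div L0 [OF K]] by simp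
    have "N T' \<le> N (simple_op {..<K} E (U K))"
      unfolding PG EG using between a0 by (intro N_simple_mono [OF G]) (auto simp: J_def G_def)
    then have upper: "N T' \<le> nrm K (U K)" using nrm_eq [OF unif div U0] by simp
    have NT: "N T = N A" unfolding A_def by (rule N_modulus [OF T])
    have close: "norm (A - T') \<le> e" "norm (T' - A) \<le> e"
      using approx by (simp_all add: T'_def norm_minus_commute)
    have 1: "nrm K (L K) \<le> N T + e"
      using lower N_lipschitz [OF T'M A(1)] close NT by linarith
    have 2: "N T \<le> nrm K (U K) + e"
      using upper N_lipschitz [OF A(1) T'M] close NT by linarith
    have 3: "L K i - e \<le> mu s T \<and> mu s T \<le> U K i + e"
      if i: "i < K" and s: "real i / real K \<le> s" "s < real (Suc i) / real K" for i s
    proof -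
      have s0: "0 \<le> s" using s(1) by (rule order_trans [rotated]) simp
      have "L K i \<le> mu s T'"
        unfolding T'_def
        by (rule mu_simple_bounds(1) [where l = "L K" and u = "U K", OF P E trE _ _ L0 [OF K] _ _ U0 i s])
          (use comm between Ldec K Udec in auto)
      moreover have "mu s T' \<le> U K i"
        unfolding T'_def
        by (rule mu_simple_bounds(2) [where l = "L K" and u = "U K", OF P E trE _ _ L0 [OF K] _ _ U0 i s])
          (use comm between Ldec K Udec in auto)
      moreover have "mu s T = mu s A" using mu_modulus [OF T] by (simp add: A_def)
      ultimately show ?thesis
        using mu_lipschitz [OF s0, of T' A] mu_lipschitz [OF s0, of A T'] close by linarith
    qed
    show ?thesis using 1 2 3 by blast
  qed
  have finish: ?thesis
    if m: "0 < m" "refinable (m * n)" and jumps: "\<And>f. weight_seq (m * n) f \<Longrightarrow>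
        (\<Sum>i<m * n. f i * (U (m * n) i - L (m * n) i)) \<le> real (m * n) * e" for m
  proof -
    note K = key [OF refinable_divisible [OF m(2)]]
    have pos: "0 < m * n" using m by (simp add: refinable_def)
    show ?thesis
    proof (rule result [of m "L (m * n)" "U (m * n)"])
      show "L (m * n) i - e \<le> mu s T \<and> mu s T \<le> U (m * n) i + e"
        if "i < m * n" "real i / real (m * n) \<le> s" "s < real (Suc i) / real (m * n)" for i s
        using K that by blast
    qed (use m K L0 [OF pos] U0 Udec jumps in \<open>(assumption | blast)+\<close>)
  qed
  show ?thesis
  proof (cases "\<forall>K>0. divisible K")
    case True
    \<comment> \<open>In the diffuse case each lower value is at least the upper value of the next cell, so only the
      jumps of \<open>U\<close> matter; \<open>U\<close> is constant at the grid points below \<open>rmin\<close>, the end of the first nonzero step.\<close>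
    define rmin where "rmin = Min (insert 1 {r (Suc k) | k. k < k0 \<and> 0 < r (Suc k)})"
    have finr: "finite {r (Suc k) | k. k < k0 \<and> 0 < r (Suc k)}" by simp
    have rmin: "0 < rmin" unfolding rmin_def using finr by (subst Min_gr_iff) auto
    have rmin_le: "rmin \<le> r (Suc k)" if "k < k0" "0 < r (Suc k)" for k
      unfolding rmin_def using finr that by (intro Min_le) auto
    \<comment> \<open>\<open>j\<close> makes the bound of \<open>weighted_jumps_le\<close> at most \<open>K e\<close>; then \<open>m\<close> makes \<open>j\<close> cells fit below \<open>rmin\<close>.\<close>
    obtain j :: nat where j: "a 0 / e \<le> real j" using real_arch_simple by blast
    obtain m' :: nat where m': "real j / rmin \<le> real m'" using real_arch_simple by blast
    define m where "m = Suc m'"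
    define K where "K = m * n"
    have n0: "0 < n" using n by (simp add: refinable_def)
    have K: "0 < K" using n0 by (simp add: K_def m_def)
    have jK: "real j / real K < rmin"
    proof -
      have "m \<le> K" using n0 by (simp add: K_def)
      then have "real m \<le> real K" by (simp only: of_nat_le_iff)
      then have "real j / rmin < real K" using m' by (simp add: m_def)
      then show ?thesis using rmin K by (simp add: field_simps)
    qed
    have constU: "U K i = U K 0" if "i \<le> j" "i < K" for i
    proof -
      have "real i / real K < rmin"
        using that jK by (meson divide_right_mono of_nat_0_le_iff of_nat_le_iff order_le_less_trans)
      then have "SU K i = SU K 0"
        using rmin_le unfolding SU_def by (auto intro: order_le_less_trans order_less_le_trans [OF _ rmin_le])
          (meson divide_nonneg_nonneg of_nat_0_le_iff order_le_less_trans)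
      then show ?thesis by (simp add: U_def)
    qed
    define V where "V i = (if i < K then U K i else 0)" for i
    have LV: "V (Suc i) \<le> L K i" if i: "i < K" for i
    proof (cases "Suc i < K")
      case True
      obtain k where k: "k \<in> SU K (Suc i)" "U K (Suc i) = a k" using U_in True by blast
      obtain k' where k': "k' \<in> SL K i" "L K i = a k'" using L_in K by blast
      have "k' \<le> k"
      proof (rule ccontr)
        assume "\<not> k' \<le> k"
        then have "r (Suc k) \<le> r k'" using k' by (intro rmono) (auto simp: SL_def)
        then show False using k k' by (simp add: SU_def SL_def)
      qed
      then have "a k \<le> a k'" using k(1) by (intro adec) (auto simp: SU_def)
      then show ?thesis using True k k' by (simp add: V_def)
    next
      case False
      then show ?thesis using L0 [OF K] by (simp add: V_def)
    qed
    have Vdec: "V (Suc i) \<le> V i" if "i < K" for i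
      using that Udec [of i "Suc i" K] U0 [OF that] by (simp add: V_def)
    have "(\<Sum>i<K. f i * (U K i - L K i)) \<le> real K * e"
      if "weight_seq K f" for f
    proof -
      have f: "\<And>i. i < K \<Longrightarrow> 0 \<le> f i" "\<And>i j. i \<le> j \<Longrightarrow> j < K \<Longrightarrow> f j \<le> f i" "(\<Sum>i<K. f i) \<le> real K"
        using that by (simp_all add: weight_seq_def)
      have jltK: "j < K"
      proof -
        have "rmin \<le> 1" unfolding rmin_def using finr by (intro Min_le) auto
        then have "real j / real K < 1" using jK by linarith
        then show ?thesis using K by simp
      qed
      have "(\<Sum>i<K. f i * (U K i - L K i)) \<le> (\<Sum>i<K. f i * (V i - V (Suc i)))"
        using f(1) LV by (intro sum_mono mult_left_mono) (auto simp: V_def)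
      also have "\<dots> \<le> real K * V 0 / real (Suc j)"
      proof (rule weighted_jumps_le [OF f])
        show "V (Suc i) = V i" if "i < j" "i < K" for i
          using that jltK constU [of i] constU [of "Suc i"] by (simp add: V_def)
      qed (use Vdec in \<open>auto simp: V_def\<close>)
      also have "\<dots> \<le> real K * e"
      proof -
        obtain k where "k \<in> SU K 0" "U K 0 = a k" using U_in K by blast
        then have "V 0 \<le> a 0" using adec [of 0 k] K by (simp add: V_def SU_def)
        also have "a 0 \<le> e * real (Suc j)" using j e by (simp add: divide_le_eq algebra_simps)
        finally have "V 0 / real (Suc j) \<le> e" by (simp add: divide_le_eq)
        then have "real K * (V 0 / real (Suc j)) \<le> real K * e" by (intro mult_left_mono) simp_all
        then show ?thesis by simp
      qed
      finally show ?thesis .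
    qed
    moreover have "refinable K" using True K by (simp add: refinable_def)
    ultimately show ?thesis
      using finish [of m] unfolding K_def m_def by simp
  next
    case False
    then obtain K where K: "divisible K" "\<forall>P. projM P \<longrightarrow> (\<exists>i. tr P = real i / real K)" "n dvd K"
      using n unfolding refinable_def by blast
    have K0: "0 < K" using K(1) by (simp add: divisible_def)
    obtain m where m: "K = m * n" using K(3) by (metis dvdE mult.commute)
    have rK: "\<exists>i. r k = real i / real K" if "k \<le> k0" for k
    proof -
      have "\<forall>i. \<exists>q. i < k0 \<longrightarrow> tr (P i) = real q / real K"
        using K(2) opartD(2) [OF P] by simp
      then obtain f where "\<forall>i. i < k0 \<longrightarrow> tr (P i) = real (f i) / real K"
        by (rule choice [THEN exE]) (rule that)
      then have "r k = real (\<Sum>i<k. f i) / real K"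
        using that by (simp add: r_sum sum_divide_distrib)
      then show ?thesis by blast
    qed
    have UL: "U K i \<le> L K i" if i: "i < K" for i
    proof -
      obtain k where k: "k \<in> SU K i" "U K i = a k" using U_in i by blast
      obtain k' where k': "k' \<in> SL K i" "L K i = a k'" using L_in K0 by blast
      obtain p q where pq: "r (Suc k) = real p / real K" "r k' = real q / real K"
        using rK [of "Suc k"] rK [of k'] k(1) k'(1) by (auto simp: SU_def SL_def)
      have "q \<le> i" "i < p"
        using k(1) k'(1) K0 pq by (simp_all add: SU_def SL_def divide_less_cancel del: of_nat_Suc)
      then have less: "r k' < r (Suc k)" using K0 by (simp add: pq divide_strict_right_mono)
      have "k' \<le> k"
      proof (rule ccontr)
        assume "\<not> k' \<le> k"
        then have "r (Suc k) \<le> r k'" using k' by (intro rmono) (auto simp: SL_def)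
        then show False using less by simp
      qed
      then have "a k \<le> a k'" using k(1) by (intro adec) (auto simp: SU_def)
      then show ?thesis using k k' by simp
    qed
    have "(\<Sum>i<K. f i * (U K i - L K i)) \<le> real K * e" if "weight_seq K f" for f
    proof -
      have f0: "\<And>i. i < K \<Longrightarrow> 0 \<le> f i" using that by (simp add: weight_seq_def)
      have "(\<Sum>i<K. f i * (U K i - L K i)) \<le> 0"
        using f0 UL by (intro sum_nonpos mult_nonneg_nonpos) auto
      also have "0 \<le> real K * e" using e by simp
      finally show ?thesis .
    qed
    moreover have "refinable K" 
      unfolding refinable_def by (intro conjI K0 disjI2 exI [of _ K] K(1,2)) simp
    moreover have "0 < m" using K0 m by (cases m) auto
    ultimately show ?thesis
      using finish [of m] unfolding m by simp
  qed
qed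

section \<open>The weight functions\<close>

lemma weighted_norm_integrable: "set_integrable lborel {0..1} (\<lambda>s. step_fun n a s * mu s T)"
proof -
  define h where "h s = step_fun n a s * mu (max 0 s) T" for s
  define B where "B = (\<Sum>i=1..n. \<bar>a i\<bar>) * norm T"
  have "(\<lambda>s. - mu (max 0 s) T) \<in> borel_measurable borel"
    by (rule borel_measurable_mono) (auto simp: mono_def intro!: mu_antimono)
  then have "(\<lambda>s. - (- mu (max 0 s) T)) \<in> borel_measurable borel" by (rule borel_measurable_uminus)
  then have h: "h \<in> borel_measurable borel"
    unfolding h_def [abs_def] using step_fun_measurable by (intro borel_measurable_times) simp_all
  have "integrable lborel (\<lambda>s. indicat_real {0..1} s *\<^sub>R h s)"
  proof (rule Bochner_Integration.integrable_bound)
    show "integrable lborel (\<lambda>s. B * indicat_real {0..1::real} s)"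
      by (intro integrable_mult_right) simp
    show "(\<lambda>s. indicat_real {0..1} s *\<^sub>R h s) \<in> borel_measurable lborel"
      using h by (intro borel_measurable_scaleR) simp_all
    have "\<bar>h s\<bar> \<le> B" for s
      unfolding h_def B_def abs_mult
      using mu_nonneg [of "max 0 s" T] mu_le_norm [of "max 0 s" T]
      by (intro mult_mono step_fun_bounded) auto
    then show "AE s in lborel. norm (indicat_real {0..1} s *\<^sub>R h s) \<le> norm (B * indicat_real {0..1} s)"
      by (intro AE_I2) (auto simp: indicator_def intro: order_trans [OF _ abs_ge_self])
  qed
  moreover have "(\<lambda>s. indicat_real {0..1} s *\<^sub>R h s) = (\<lambda>s. indicat_real {0..1} s *\<^sub>R (step_fun n a s * mu s T))"
    by (rule ext) (auto simp: indicator_def h_def max_def)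
  ultimately show ?thesis
    by (simp only: set_integrable_def)
qed

text \<open>Functionals are indexed from \<open>0\<close>, step functions from \<open>1\<close>; the factor \<open>n\<close> turns a total mass of \<open>\<phi>\<close> into
  the integral.\<close>

definition weight :: "nat \<Rightarrow> (nat \<Rightarrow> real) \<Rightarrow> real \<Rightarrow> real" where
  "weight n \<phi> = step_fun n (\<lambda>i. real n * \<phi> (i - 1))"

lemma weight_eq:
  assumes n: "0 < n" and m: "0 < m" and i: "i < m * n"
    and s: "real i / real (m * n) \<le> s" "s < real (Suc i) / real (m * n)"
  shows "weight n \<phi> s = real n * \<phi> (i div m)"
proof -
  define j where "j = i div m"
  have j: "j < n" using i by (simp add: j_def less_mult_imp_div_less mult.commute)
  have "j * m \<le> i" "Suc i \<le> Suc j * m"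
    using m by (simp_all add: j_def Suc_le_eq dividend_less_div_times)
  then have "real (j * m) / real (m * n) \<le> real i / real (m * n)"
    "real (Suc i) / real (m * n) \<le> real (Suc j * m) / real (m * n)"
    by (intro divide_right_mono; simp only: of_nat_le_iff of_nat_0_le_iff)+
  moreover have "real (k * m) / real (m * n) = real k / real n" for k
    using m by simp
  ultimately have "real j / real n \<le> s" "s < real (Suc j) / real n"
    using s by (simp_all only:)
  then show ?thesis
    unfolding weight_def using step_fun_eq [OF j] by (simp add: j_def)
qed

text \<open>Up to an error, the integral pairs \<open>\<phi>\<close> with the block means \<open>c\<close> of the lower vector of a sandwich whose size
  is a multiple \<open>m n\<close>, and \<open>nrm n c\<close> is at most the norm of that lower vector.\<close>

lemma weighted_norm_le:
  assumes n: "refinable n" and \<phi>0: "\<And>i. i < n \<Longrightarrow> 0 \<le> \<phi> i"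
    and \<phi>dec: "\<And>i j. i \<le> j \<Longrightarrow> j < n \<Longrightarrow> \<phi> j \<le> \<phi> i" and \<phi>: "\<And>x. (\<Sum>i<n. \<phi> i * x i) \<le> nrm n x"
    and T: "T \<in> M"
  shows "weighted_norm M \<tau> (weight n \<phi>) T \<le> N T"
proof (rule field_le_epsilon)
  fix d :: real assume "0 < d"
  \<comment> \<open>one part each for the bound on \<open>\<mu>\<close>, the gap of the sandwich, and its lower norm estimate\<close>
  define e where "e = d / 3"
  have e: "0 < e" using \<open>0 < d\<close> by (simp add: e_def)
  have n0: "0 < n" using n by (simp add: refinable_def)
  obtain m l u where m: "0 < m" "refinable (m * n)" and l0: "\<And>i. i < m * n \<Longrightarrow> 0 \<le> l i"
    and "\<And>i j. i \<le> j \<Longrightarrow> j < m * n \<Longrightarrow> u j \<le> u i" "\<And>i. i < m * n \<Longrightarrow> 0 \<le> u i"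
    and lower: "nrm (m * n) l \<le> N T + e" and "N T \<le> nrm (m * n) u + e"
    and bounds: "\<And>i s. i < m * n \<Longrightarrow> real i / real (m * n) \<le> s \<Longrightarrow> s < real (Suc i) / real (m * n) \<Longrightarrow>
       l i - e \<le> mu s T \<and> mu s T \<le> u i + e"
    and jumps: "\<And>f. weight_seq (m * n) f \<Longrightarrow> (\<Sum>i<m * n. f i * (u i - l i)) \<le> real (m * n) * e"
    using T n e by (rule sandwich) (rule that)
  define K where "K = m * n"
  have K: "0 < K" using m n0 by (simp add: K_def)
  define F where "F i = real n * \<phi> (i div m)" for i
  have div: "i div m < n" if "i < K" for i
    using that by (simp add: K_def less_mult_imp_div_less mult.commute)
  have F0: "0 \<le> F i" if "i < K" for i
    unfolding F_def by (intro mult_nonneg_nonneg \<phi>0 div that) simp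
  have Fdec: "F j \<le> F i" if "i \<le> j" "j < K" for i j
    unfolding F_def using that by (intro mult_left_mono \<phi>dec div div_le_mono) auto
  have blocks: "(\<Sum>i<K. F i * x i) = real n * (\<Sum>j<n. \<phi> j * (\<Sum>r<m. x (j * m + r)))" for x
  proof -
    have "(\<Sum>i<n * m. F i * x i) = (\<Sum>j<n. \<Sum>i\<in>{j * m..<j * m + m}. F i * x i)"
      by (rule sum.nat_group [symmetric])
    also have "\<dots> = (\<Sum>j<n. \<Sum>r<m. F (j * m + r) * x (j * m + r))"
    proof (rule sum.cong [OF refl])
      fix j
      show "(\<Sum>i\<in>{j * m..<j * m + m}. F i * x i) = (\<Sum>r<m. F (j * m + r) * x (j * m + r))"
        using sum.shift_bounds_nat_ivl [of "\<lambda>i. F i * x i" 0 "j * m" m]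
        by (simp add: add.commute lessThan_atLeast0)
    qed
    also have "\<dots> = (\<Sum>j<n. \<Sum>r<m. real n * \<phi> j * x (j * m + r))"
      using m(1) by (intro sum.cong refl) (simp add: F_def)
    also have "\<dots> = real n * (\<Sum>j<n. \<phi> j * (\<Sum>r<m. x (j * m + r)))"
      by (simp add: sum_distrib_left mult.assoc)
    finally show ?thesis by (simp add: K_def mult.commute)
  qed
  have total: "(\<Sum>j<n. \<phi> j) \<le> 1"
    using \<phi> [of "\<lambda>_. 1"] nrm_one [OF refinable_divisible [OF n]] by simp
  have Fsum: "(\<Sum>i<K. F i) \<le> real K"
  proof -
    have "(\<Sum>i<K. F i) = real K * (\<Sum>j<n. \<phi> j)"
      using blocks [of "\<lambda>_. 1"] by (simp add: K_def sum_distrib_left sum_distrib_right algebra_simps)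
    also have "\<dots> \<le> real K * 1" using total by (intro mult_left_mono) simp_all
    finally show ?thesis by simp
  qed
  have wF: "weight_seq K F" using F0 Fdec Fsum by (simp add: weight_seq_def)
  define c where "c j = (\<Sum>r<m. l (j * m + r)) / real m" for j
  have Fl: "(\<Sum>i<K. F i * l i) \<le> real K * (N T + e)"
  proof -
    have eq: "\<phi> j * (\<Sum>r<m. l (j * m + r)) = real m * (\<phi> j * c j)" for j
      using m(1) by (simp add: c_def)
    have "(\<Sum>i<K. F i * l i) = real K * (\<Sum>j<n. \<phi> j * c j)"
      unfolding blocks eq by (simp add: K_def sum_distrib_left mult.assoc mult.left_commute)
    also have "\<dots> \<le> real K * nrm n c" by (intro mult_left_mono \<phi>) simp
    also have "\<dots> \<le> real K * nrm K l"
      unfolding K_def c_def using nrm_block_average [OF refinable_divisible [OF n] refinable_divisible [OF m(2)]] l0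
      by (intro mult_left_mono) auto
    also have "\<dots> \<le> real K * (N T + e)" using lower by (intro mult_left_mono) (simp_all add: K_def)
    finally show ?thesis .
  qed
  have "weighted_norm M \<tau> (weight n \<phi>) T = (LBINT s:{0..1}. weight n \<phi> s * mu s T)"
    by (simp add: weighted_norm_def mu_def)
  also have "\<dots> \<le> (\<Sum>i<K. F i * (u i + e)) / real K"
  proof (rule set_integral_step_le [OF K])
    show "set_integrable lborel {0..1} (\<lambda>s. weight n \<phi> s * mu s T)"
      unfolding weight_def by (rule weighted_norm_integrable)
    fix i s assume i: "i < K" and s: "real i / real K \<le> s" "s < real (Suc i) / real K"
    have "weight n \<phi> s = F i"
      unfolding F_def using n0 m(1) i s unfolding K_def by (rule weight_eq)
    moreover have "mu s T \<le> u i + e" using bounds i s unfolding K_def by blast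
    ultimately show "weight n \<phi> s * mu s T \<le> F i * (u i + e)"
      using F0 [OF i] by (simp add: mult_left_mono)
  qed
  also have "(\<Sum>i<K. F i * (u i + e)) = (\<Sum>i<K. F i * l i) + (\<Sum>i<K. F i * (u i - l i)) + (\<Sum>i<K. F i) * e"
    by (simp add: sum.distrib sum_subtractf right_diff_distrib distrib_left flip: sum_distrib_right)
  also have "\<dots> / real K \<le> (real K * (N T + e) + real K * e + real K * e) / real K"
    using Fl jumps [OF wF [unfolded K_def]] Fsum e unfolding K_def
    by (intro divide_right_mono add_mono mult_right_mono) auto
  also have "\<dots> = N T + d" using K by (simp add: e_def field_simps)
  finally show "weighted_norm M \<tau> (weight n \<phi>) T \<le> N T + d" .
qed

lemma weight_step_weights:
  assumes "0 < n" "\<And>i. i < n \<Longrightarrow> 0 \<le> \<phi> i" "\<And>i j. i \<le> j \<Longrightarrow> j < n \<Longrightarrow> \<phi> j \<le> \<phi> i" "(\<Sum>i<n. \<phi> i) \<le> 1"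
  shows "weight n \<phi> \<in> step_weights"
proof -
  have "(\<Sum>i=1..n. real n * \<phi> (i - 1)) = real n * (\<Sum>i<n. \<phi> i)"
    unfolding sum_distrib_left by (rule sum.reindex_bij_witness [where i = Suc and j = "\<lambda>i. i - 1"]) auto
  then have "(\<Sum>i=1..n. real n * \<phi> (i - 1)) / real n \<le> 1" using assms(1,4) by simp
  moreover have "real n * \<phi> (j - 1) \<le> real n * \<phi> (i - 1)" if "i \<in> {1..n}" "j \<in> {1..n}" "i \<le> j" for i j
    using that by (intro mult_left_mono assms(3)) auto
  moreover have "0 \<le> real n * \<phi> (n - 1)" using assms(1,2) by simp
  ultimately show ?thesis
    unfolding step_weights_def weight_def using assms(1)
    by (intro CollectI exI [of _ n] exI [of _ "\<lambda>i. real n * \<phi> (i - 1)"]) auto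
qed

text \<open>At a strictly decreasing positive vector, symmetry and monotonicity of \<open>nrm\<close> force a supporting
  functional to be decreasing and nonnegative: exchanging two neighbouring coordinates, or replacing the
  last one by \<open>0\<close>, cannot increase its value.\<close>

lemma decreasing_support:
  assumes n: "divisible n" and pos: "\<And>i. i < n \<Longrightarrow> 0 < a i" and dec: "\<And>i. Suc i < n \<Longrightarrow> a (Suc i) < a i"
  obtains \<phi> where "\<And>i. i < n \<Longrightarrow> 0 \<le> \<phi> i" "\<And>i j. i \<le> j \<Longrightarrow> j < n \<Longrightarrow> \<phi> j \<le> \<phi> i"
    "\<And>x. (\<Sum>i<n. \<phi> i * x i) \<le> nrm n x" "(\<Sum>i<n. \<phi> i * a i) = nrm n a"
proof -
  have n0: "0 < n" using n by (simp add: divisible_def)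
  have lin: "sublinear (nrm n)"
    unfolding sublinear_def using nrm_add [OF n] nrm_scale [OF n] by simp
  obtain \<phi> where \<phi>: "\<And>x. (\<Sum>i<n. \<phi> i * x i) \<le> nrm n x" "(\<Sum>i<n. \<phi> i * a i) = nrm n a"
    by (rule supporting_functional [where p = "nrm n" and K = n and a = a])
      (rule lin, (rule nrm_cong; simp), rule that)
  have step: "\<phi> (Suc i) \<le> \<phi> i" if i: "Suc i < n" for i
  proof -
    define b where "b = (\<lambda>k. a (Transposition.transpose i (Suc i) k))"
    have "bij_betw (Transposition.transpose i (Suc i)) {..<n} {..<n}"
      using i by (intro bij_betw_byWitness [where f' = "Transposition.transpose i (Suc i)"])
        (auto simp: Transposition.transpose_def)
    then have "nrm n b = nrm n a"
      unfolding b_def using pos by (intro nrm_perm n) (auto intro: less_imp_le)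
    then have "(\<Sum>k<n. \<phi> k * b k) \<le> (\<Sum>k<n. \<phi> k * a k)"
      using \<phi>(1) [of b] \<phi>(2) by simp
    moreover have "(\<Sum>k<n. \<phi> k * a k) - (\<Sum>k<n. \<phi> k * b k) = (\<Sum>k\<in>{i, Suc i}. \<phi> k * (a k - b k))"
      unfolding sum_subtractf [symmetric] right_diff_distrib [symmetric] using i
      by (intro sum.mono_neutral_right) (auto simp: b_def Transposition.transpose_def)
    ultimately have "0 \<le> (a i - a (Suc i)) * (\<phi> i - \<phi> (Suc i))"
      by (simp add: b_def Transposition.transpose_def algebra_simps)
    then show ?thesis using dec [OF i] by (simp add: zero_le_mult_iff)
  qed
  have dec': "\<phi> j \<le> \<phi> i" if "i \<le> j" "j < n" for i j
    using that by (induction j rule: dec_induct) (auto intro: order_trans [OF step])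
  define z where "z = n - 1"
  have z: "z < n" using n0 by (simp add: z_def)
  have "nrm n (a(z := 0)) \<le> nrm n a"
    using pos by (intro nrm_mono n) (auto intro: less_imp_le)
  then have "(\<Sum>k<n. \<phi> k * (a(z := 0)) k) \<le> (\<Sum>k<n. \<phi> k * a k)"
    using \<phi>(1) [of "a(z := 0)"] \<phi>(2) by simp
  moreover have "(\<Sum>k<n. \<phi> k * a k) - (\<Sum>k<n. \<phi> k * (a(z := 0)) k) = (\<Sum>k\<in>{z}. \<phi> k * a k)"
    unfolding sum_subtractf [symmetric] using z by (intro sum.mono_neutral_cong_right) auto
  ultimately have "0 \<le> \<phi> z * a z" by simp
  then have "0 \<le> \<phi> z" using pos [OF z] by (simp add: zero_le_mult_iff)
  then have "0 \<le> \<phi> i" if "i < n" for i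
    by (rule order_trans [OF _ dec']) (use that z in \<open>auto simp: z_def\<close>)
  then show ?thesis using dec' \<phi> by (rule that)
qed

text \<open>The largest set of weights for which the supremum cannot exceed \<open>N\<close>.\<close>

definition dominated_weights :: "(real \<Rightarrow> real) set" where
  "dominated_weights = {f \<in> step_weights. \<forall>T\<in>M. weighted_norm M \<tau> f T \<le> N T}"

lemma weight_dominated:
  assumes n: "refinable n" and \<phi>0: "\<And>i. i < n \<Longrightarrow> 0 \<le> \<phi> i"
    and \<phi>dec: "\<And>i j. i \<le> j \<Longrightarrow> j < n \<Longrightarrow> \<phi> j \<le> \<phi> i" and \<phi>: "\<And>x. (\<Sum>i<n. \<phi> i * x i) \<le> nrm n x"
  shows "weight n \<phi> \<in> dominated_weights"
proof -
  have "(\<Sum>i<n. \<phi> i) \<le> 1"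
    using \<phi> [of "\<lambda>_. 1"] nrm_one [OF refinable_divisible [OF n]] by simp
  then have "weight n \<phi> \<in> step_weights"
    using n \<phi>0 \<phi>dec by (intro weight_step_weights) (auto simp: refinable_def)
  then show ?thesis
    using weighted_norm_le [OF n \<phi>0 \<phi>dec \<phi>] by (simp add: dominated_weights_def)
qed

text \<open>On \<open>\<real>\<^sup>1\<close> the norm is the absolute value, which dominates the functional that gives the weight \<open>1\<close>.\<close>

lemma one_dominated:
  assumes "weak_dixmier M \<tau>" shows "indicat_real {0..1} \<in> dominated_weights"
proof -
  note b = refinable_one [OF assms]
  have "weight 1 (\<lambda>_. 1) \<in> dominated_weights"
  proof (rule weight_dominated [OF b])
    fix x :: "nat \<Rightarrow> real"
    have "nrm 1 x = nrm 1 (\<lambda>i. x 0 * 1)" by (rule nrm_cong) simp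
    also have "\<dots> = \<bar>x 0\<bar>"
      unfolding nrm_scale [OF refinable_divisible [OF b]] nrm_one [OF refinable_divisible [OF b]] by simp
    finally show "(\<Sum>i<1. 1 * x i) \<le> nrm 1 x" by simp
  qed simp_all
  moreover have "weight 1 (\<lambda>_. 1) = indicat_real {0..1}"
    by (rule ext) (simp add: weight_def step_fun_def)
  ultimately show ?thesis by simp
qed

text \<open>The weight comes from a functional supporting \<open>nrm m\<close> at a vector \<open>a\<close> slightly above \<open>u\<close>. Its integral
  against \<open>\<mu>(T)\<close> is nearly the pairing with \<open>l\<close>, hence with \<open>u\<close> and with \<open>a\<close>, and the last one is
  \<open>nrm m a \<ge> nrm m u\<close>.\<close>

lemma nearly_attained:
  assumes dixmier: "weak_dixmier M \<tau>" and T: "T \<in> M" and d: "0 < d"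
  shows "\<exists>f\<in>dominated_weights. N T \<le> weighted_norm M \<tau> f T + d"
proof -
  define e where "e = d / 4"
  have e: "0 < e" using d by (simp add: e_def)
  obtain m l u where m: "0 < m" "refinable (m * 1)" and "\<And>i. i < m * 1 \<Longrightarrow> 0 \<le> l i"
    and udec: "\<And>i j. i \<le> j \<Longrightarrow> j < m * 1 \<Longrightarrow> u j \<le> u i" and u0: "\<And>i. i < m * 1 \<Longrightarrow> 0 \<le> u i"
    and "nrm (m * 1) l \<le> N T + e" and upper: "N T \<le> nrm (m * 1) u + e"
    and bounds: "\<And>i s. i < m * 1 \<Longrightarrow> real i / real (m * 1) \<le> s \<Longrightarrow> s < real (Suc i) / real (m * 1) \<Longrightarrow>
       l i - e \<le> mu s T \<and> mu s T \<le> u i + e"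
    and jumps: "\<And>f. weight_seq (m * 1) f \<Longrightarrow> (\<Sum>i<m * 1. f i * (u i - l i)) \<le> real (m * 1) * e"
    using T refinable_one [OF dixmier] e by (rule sandwich) (rule that)
  note K = refinable_divisible [OF m(2), unfolded mult_1_right]
  \<comment> \<open>the tilt makes \<open>u\<close> strictly decreasing and positive, at the cost of at most \<open>e\<close>\<close>
  define a where "a i = u i + e * (real (m - i) / real m)" for i
  have a_pos: "0 < a i" if "i < m" for i
    unfolding a_def using u0 that e m(1) by (intro add_nonneg_pos mult_pos_pos divide_pos_pos) simp_all
  have a_dec: "a (Suc i) < a i" if "Suc i < m" for i
    unfolding a_def using udec [of i "Suc i"] that e m(1)
    by (intro add_le_less_mono mult_strict_left_mono divide_strict_right_mono) simp_all
  have a_le: "a i \<le> u i + e" for i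
  proof -
    have "real (m - i) / real m \<le> 1" using m(1) by simp
    then have "e * (real (m - i) / real m) \<le> e * 1" using e by (intro mult_left_mono) simp_all
    then show ?thesis by (simp add: a_def)
  qed
  obtain \<phi> where \<phi>0: "\<And>i. i < m \<Longrightarrow> 0 \<le> \<phi> i" and \<phi>dec: "\<And>i j. i \<le> j \<Longrightarrow> j < m \<Longrightarrow> \<phi> j \<le> \<phi> i"
    and \<phi>: "\<And>x. (\<Sum>i<m. \<phi> i * x i) \<le> nrm m x" and \<phi>a: "(\<Sum>i<m. \<phi> i * a i) = nrm m a"
    by (rule decreasing_support [OF K, of a]) (rule a_pos, assumption, rule a_dec, assumption, rule that)
  have total: "(\<Sum>i<m. \<phi> i) \<le> 1"
    using \<phi> [of "\<lambda>_. 1"] nrm_one [OF K] by simp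
  have "refinable m" using m(2) by simp
  then have dom: "weight m \<phi> \<in> dominated_weights"
    using \<phi>0 \<phi>dec \<phi> by (rule weight_dominated)
  have "weight_seq m (\<lambda>i. real m * \<phi> i)"
    unfolding weight_seq_def using \<phi>0 \<phi>dec total m(1)
    by (simp add: mult_left_mono flip: sum_distrib_left)
  then have "(\<Sum>i<m. real m * \<phi> i * (u i - l i)) \<le> real m * e"
    using jumps by simp
  then have "real m * (\<Sum>i<m. \<phi> i * (u i - l i)) \<le> real m * e"
    by (simp only: sum_distrib_left mult.assoc)
  then have gap: "(\<Sum>i<m. \<phi> i * (u i - l i)) \<le> e"
    using m(1) by simp
  have "N T - e \<le> nrm m u" using upper by simp
  also have "\<dots> \<le> nrm m a"
    using u0 e m(1) by (intro nrm_mono K) (simp add: a_def)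
  also have "\<dots> \<le> (\<Sum>i<m. \<phi> i * (u i + e))"
    unfolding \<phi>a [symmetric] using \<phi>0 a_le by (intro sum_mono mult_left_mono) simp_all
  also have "\<dots> = (\<Sum>i<m. \<phi> i * (l i - e)) + (\<Sum>i<m. \<phi> i * (u i - l i)) + (\<Sum>i<m. \<phi> i) * (2 * e)"
    by (simp add: sum.distrib sum_subtractf right_diff_distrib distrib_left flip: sum_distrib_right)
  also have "\<dots> \<le> (\<Sum>i<m. \<phi> i * (l i - e)) + e + 1 * (2 * e)"
    using gap total e by (intro add_mono mult_right_mono) simp_all
  also have "(\<Sum>i<m. \<phi> i * (l i - e)) = (\<Sum>i<m. real m * \<phi> i * (l i - e)) / real m"
    using m(1) by (simp add: mult.assoc flip: sum_distrib_left)
  also have "\<dots> \<le> (LBINT s:{0..1}. weight m \<phi> s * mu s T)"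
  proof (rule set_integral_step_ge [OF m(1)])
    show "set_integrable lborel {0..1} (\<lambda>s. weight m \<phi> s * mu s T)"
      unfolding weight_def by (rule weighted_norm_integrable)
    fix i s assume i: "i < m" and s: "real i / real m \<le> s" "s < real (Suc i) / real m"
    have "weight m \<phi> s = real m * \<phi> i"
      using weight_eq [OF m(1) zero_less_one, of i s \<phi>] i s by simp
    moreover have "l i - e \<le> mu s T" using bounds [of i s] i s by simp
    ultimately show "real m * \<phi> i * (l i - e) \<le> weight m \<phi> s * mu s T"
      using \<phi>0 [OF i] by (simp add: mult_left_mono)
  qed
  also have "\<dots> = weighted_norm M \<tau> (weight m \<phi>) T"
    by (simp add: weighted_norm_def mu_def)
  finally have "N T \<le> weighted_norm M \<tau> (weight m \<phi>) T + d"
    by (simp add: e_def)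
  then show ?thesis using dom by blast
qed

end

section \<open>The representation of tracial gauge norms\<close>

theorem theoremA:
  fixes M :: "('h::chilbert_space \<Rightarrow>\<^sub>L 'h) set"
    and \<tau> :: "('h \<Rightarrow>\<^sub>L 'h) \<Rightarrow> complex"
    and N :: "('h \<Rightarrow>\<^sub>L 'h) \<Rightarrow> real"
  assumes "finite_von_neumann_algebra M \<tau>"
    and "weak_dixmier M \<tau>"
    and "tracial_gauge_norm M \<tau> N"
    and "normalized N"
  shows "\<exists>F' \<subseteq> step_weights. indicat_real {0..1} \<in> F' \<and>
    (\<forall>T\<in>M. bdd_above ((\<lambda>f. weighted_norm M \<tau> f T) ` F') \<and>
       N T = (SUP f\<in>F'. weighted_norm M \<tau> f T))"
proof -
  interpret tracial_gauge M \<tau> N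
    by unfold_locales (fact assms)+
  show ?thesis
  proof (rule exI [of _ dominated_weights], intro conjI ballI)
    show "dominated_weights \<subseteq> step_weights" by (auto simp: dominated_weights_def)
    show one: "indicat_real {0..1} \<in> dominated_weights"
      using assms(2) by (rule one_dominated)
    fix T assume T: "T \<in> M"
    have le: "weighted_norm M \<tau> f T \<le> N T" if "f \<in> dominated_weights" for f
      using that T by (simp add: dominated_weights_def)
    then show bdd: "bdd_above ((\<lambda>f. weighted_norm M \<tau> f T) ` dominated_weights)"
      by (auto intro!: bdd_aboveI [where M = "N T"])
    show "N T = (SUP f\<in>dominated_weights. weighted_norm M \<tau> f T)"
    proof (rule antisym)
      show "(SUP f\<in>dominated_weights. weighted_norm M \<tau> f T) \<le> N T"
        using one le by (intro cSUP_least) auto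
      show "N T \<le> (SUP f\<in>dominated_weights. weighted_norm M \<tau> f T)"
      proof (rule field_le_epsilon)
        fix d :: real assume "0 < d"
        then obtain f where f: "f \<in> dominated_weights" "N T \<le> weighted_norm M \<tau> f T + d"
          using nearly_attained [OF assms(2) T] by blast
        moreover have "weighted_norm M \<tau> f T \<le> (SUP f\<in>dominated_weights. weighted_norm M \<tau> f T)"
          by (rule cSUP_upper [OF f(1) bdd])
        ultimately show "N T \<le> (SUP f\<in>dominated_weights. weighted_norm M \<tau> f T) + d"
          by linarith
      qed
    qed
  qed
qed

end
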